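(* Assume $f\in L^1(\Omega)$. Let $(\varepsilon_n)_{n\in\mathbb{N}}$ be a sequence of positive numbers converging to zero and, for every $n$, let $u_n\in W^{1,p}_0(\Omega)$ be such that for any $w\in W^{1,p}_0(\Omega)$, $$\int_\Omega \Lambda\nabla u_n\cdot\nabla w\,dx+\varepsilon_n\int_\Omega|\nabla\psi(u_n)|^{p-2}\nabla u_n\cdot\nabla w\,dx=\int_\Omega f\,w\,dx .$$ Let $u\in\mathcal{S}_N(\Omega)$ be a limit of a subsequence of $(u_n)_{n\in\mathbb{N}}$ in the following sense: the subsequence converges to $u$ weakly in $W^{1,q}_0(\Omega)$ for any $q\in(1,N/(N-1))$, strongly in $L^{\hat q}(\Omega)$ for all $\hat q\in[1,+\infty)$ if $N=2$ and for all $\hat q\in[1,N/(N-2))$ if $N\ge3$, and almost everywhere in $\Omega$. Then, for all $k>0$, there exists $C$ only depending on $\underline\lambda$, $k$ and $\|f\|_{L^1(\Omega)}$ such that $$\|\nabla T_k(u)\|_{L^2(\Omega)}\le C .$$ Moreover, $u$ is the entropy weak solution of the linear problem $-\mathrm{div}(\Lambda\nabla u)=f$ in $\Omega$, $u=0$ on $\partial\Omega$, in the sense of the definition of entropy solution recalled in the context.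
   Context: $N\ge2$ is an integer, $\Omega\subset\mathbb{R}^N$ is open and bounded, and $p\in(N,+\infty)$ is fixed (so $W^{1,p}_0(\Omega)\subset C(\overline\Omega)$). $\Lambda\in L^\infty(\Omega)^{N\times N}$ is symmetric and there exist $\underline\lambda,\overline\lambda>0$ such that for a.e. $x\in\Omega$ and all $\xi\in\mathbb{R}^N$, $\underline\lambda|\xi|^2\le\Lambda(x)\xi\cdot\xi\le\overline\lambda|\xi|^2$. The function $\psi:\mathbb{R}\to(-1,1)$ is $\psi(s)=\frac{\ln(1+|s|)}{1+\ln(1+|s|)}\,\mathrm{sign}(s)$, with $\mathrm{sign}(s)=1$ if $s\ge0$ and $-1$ if $s<0$. For $k>0$, $T_k(s)=\min(|s|,k)\,\mathrm{sign}(s)$. $\mathcal{S}_N(\Omega)=\bigcap_{q\in(1,\frac{N}{N-1})}W^{1,q}_0(\Omega)$. Definition (entropy solution of the linear problem, $f\in L^1(\Omega)$): a measurable function $u$ such that (1) $u\in\mathcal{S}_N(\Omega)$ and, for all $k>0$, $T_k(u)\in H^1_0(\Omega)$; (2) for any $\phi\in C_c^\infty(\Omega)$ and any $k>0$, $$\int_\Omega\Lambda\nabla u\cdot\nabla T_k(u-\phi)\,dx\le\int_\Omega f\,T_k(u-\phi)\,dx .$$ *)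

theory Defs
  imports "HOL-Analysis.Analysis"
begin

text \<open>
  The constant in the final estimate must not depend on the dimension \<open>N\<close>, so \<open>N\<close> has to be
  quantified inside the statement and cannot be the cardinality of an index type. Points of
  \<open>\<real>\<^sup>N\<close> are therefore the extensional functions \<open>{..<N} \<rightarrow>\<^sub>E UNIV\<close>, which are the points of the
  library's product topology and product measure over the index set \<open>{..<N}\<close>. Vectors such as
  gradients are functions on \<open>nat\<close> of which only the components below \<open>N\<close> are ever used.
\<close>

type_synonym rvec = "nat \<Rightarrow> real"

abbreviation RN :: "nat \<Rightarrow> rvec topology" where
  "RN N \<equiv> powertop_real {..<N}"

definition leb_on :: "nat \<Rightarrow> rvec set \<Rightarrow> rvec measure" where
  "leb_on N \<Omega> = restrict_space (completion (\<Pi>\<^sub>M i\<in>{..<N}. lborel)) \<Omega>"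

definition dotN :: "nat \<Rightarrow> rvec \<Rightarrow> rvec \<Rightarrow> real" where
  "dotN N v w = (\<Sum>i<N. v i * w i)"

definition normN :: "nat \<Rightarrow> rvec \<Rightarrow> real" where
  "normN N v = sqrt (dotN N v v)"

definition matvecN :: "nat \<Rightarrow> (nat \<Rightarrow> nat \<Rightarrow> real) \<Rightarrow> rvec \<Rightarrow> rvec" where
  "matvecN N A v = (\<lambda>i. \<Sum>j<N. A i j * v j)"

definition open_bounded :: "nat \<Rightarrow> rvec set \<Rightarrow> bool" where
  "open_bounded N \<Omega> \<longleftrightarrow> openin (RN N) \<Omega> \<and> (\<exists>B. \<forall>x\<in>\<Omega>. normN N x \<le> B)"

section \<open>Lebesgue spaces\<close>

text \<open>
  Functions are used as representatives of their classes modulo null sets. The real-valued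
  \<open>Lp_norm\<close> is only meaningful together with \<open>Lp\<close>, because the Bochner integral of a
  non-integrable function is 0.
\<close>

definition Lp :: "'a measure \<Rightarrow> real \<Rightarrow> ('a \<Rightarrow> real) \<Rightarrow> bool" where
  "Lp M q f \<longleftrightarrow> f \<in> borel_measurable M \<and> integrable M (\<lambda>x. \<bar>f x\<bar> powr q)"

definition Linf :: "'a measure \<Rightarrow> ('a \<Rightarrow> real) \<Rightarrow> bool" where
  "Linf M f \<longleftrightarrow> f \<in> borel_measurable M \<and> (\<exists>B. AE x in M. \<bar>f x\<bar> \<le> B)"

definition Lp_norm :: "'a measure \<Rightarrow> real \<Rightarrow> ('a \<Rightarrow> real) \<Rightarrow> real" where
  "Lp_norm M q f = (LINT x|M. \<bar>f x\<bar> powr q) powr (1 / q)"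

definition Lp_converges ::
    "'a measure \<Rightarrow> real \<Rightarrow> (nat \<Rightarrow> 'a \<Rightarrow> real) \<Rightarrow> ('a \<Rightarrow> real) \<Rightarrow> bool" where
  "Lp_converges M q v u \<longleftrightarrow>
     (\<forall>n. Lp M q (v n)) \<and> Lp M q u \<and> (\<lambda>n. Lp_norm M q (\<lambda>x. v n x - u x)) \<longlonglongrightarrow> 0"

section \<open>Smooth functions with compact support\<close>

definition pd :: "nat \<Rightarrow> (rvec \<Rightarrow> real) \<Rightarrow> rvec \<Rightarrow> real" where
  "pd i \<phi> x = deriv (\<lambda>t. \<phi> (x(i := t))) (x i)"

definition smoothN :: "nat \<Rightarrow> (rvec \<Rightarrow> real) \<Rightarrow> bool" where
  "smoothN N \<phi> \<longleftrightarrow>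
     (\<forall>js\<in>lists {..<N}.
        continuous_map (RN N) euclideanreal (foldr pd js \<phi>) \<and>
        (\<forall>i<N. \<forall>x\<in>topspace (RN N).
           (\<lambda>t. foldr pd js \<phi> (x(i := t))) field_differentiable (at (x i))))"

definition Cc_smooth :: "nat \<Rightarrow> rvec set \<Rightarrow> (rvec \<Rightarrow> real) \<Rightarrow> bool" where
  "Cc_smooth N \<Omega> \<phi> \<longleftrightarrow> smoothN N \<phi> \<and>
     (\<exists>K. compactin (RN N) K \<and> K \<subseteq> \<Omega> \<and> (\<forall>x\<in>topspace (RN N) - K. \<phi> x = 0))"

section \<open>Sobolev spaces\<close>

definition loc_integrable :: "nat \<Rightarrow> rvec set \<Rightarrow> (rvec \<Rightarrow> real) \<Rightarrow> bool" where
  "loc_integrable N \<Omega> u \<longleftrightarrow>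
     (\<forall>K. compactin (RN N) K \<and> K \<subseteq> \<Omega> \<longrightarrow> set_integrable (leb_on N \<Omega>) K u)"

definition has_weak_grad :: "nat \<Rightarrow> rvec set \<Rightarrow> (rvec \<Rightarrow> real) \<Rightarrow> (rvec \<Rightarrow> rvec) \<Rightarrow> bool" where
  "has_weak_grad N \<Omega> u g \<longleftrightarrow>
     loc_integrable N \<Omega> u \<and> (\<forall>i<N. loc_integrable N \<Omega> (\<lambda>x. g x i)) \<and>
     (\<forall>\<phi>. Cc_smooth N \<Omega> \<phi> \<longrightarrow>
        (\<forall>i<N. (LINT x|leb_on N \<Omega>. u x * pd i \<phi> x) = - (LINT x|leb_on N \<Omega>. g x i * \<phi> x)))"

text \<open>A representative of the weak gradient, which is unique almost everywhere if it exists.\<close>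

definition weak_grad :: "nat \<Rightarrow> rvec set \<Rightarrow> (rvec \<Rightarrow> real) \<Rightarrow> rvec \<Rightarrow> rvec" where
  "weak_grad N \<Omega> u = (SOME g. has_weak_grad N \<Omega> u g)"

definition W1 :: "nat \<Rightarrow> rvec set \<Rightarrow> real \<Rightarrow> (rvec \<Rightarrow> real) \<Rightarrow> bool" where
  "W1 N \<Omega> q u \<longleftrightarrow> Lp (leb_on N \<Omega>) q u \<and>
     (\<exists>g. has_weak_grad N \<Omega> u g \<and> (\<forall>i<N. Lp (leb_on N \<Omega>) q (\<lambda>x. g x i)))"

definition W1_norm :: "nat \<Rightarrow> rvec set \<Rightarrow> real \<Rightarrow> (rvec \<Rightarrow> real) \<Rightarrow> real" where
  "W1_norm N \<Omega> q u = Lp_norm (leb_on N \<Omega>) q u +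
     Lp_norm (leb_on N \<Omega>) q (\<lambda>x. normN N (weak_grad N \<Omega> u x))"

definition W10 :: "nat \<Rightarrow> rvec set \<Rightarrow> real \<Rightarrow> (rvec \<Rightarrow> real) \<Rightarrow> bool" where
  "W10 N \<Omega> q u \<longleftrightarrow> W1 N \<Omega> q u \<and>
     (\<exists>\<phi>. (\<forall>n. Cc_smooth N \<Omega> (\<phi> n)) \<and>
          (\<lambda>n. W1_norm N \<Omega> q (\<lambda>x. \<phi> n x - u x)) \<longlonglongrightarrow> 0)"

abbreviation H10 :: "nat \<Rightarrow> rvec set \<Rightarrow> (rvec \<Rightarrow> real) \<Rightarrow> bool" where
  "H10 N \<Omega> \<equiv> W10 N \<Omega> 2"

text \<open>Boundedness makes such a functional well defined on classes modulo null sets.\<close>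

definition W10_dual :: "nat \<Rightarrow> rvec set \<Rightarrow> real \<Rightarrow> ((rvec \<Rightarrow> real) \<Rightarrow> real) \<Rightarrow> bool" where
  "W10_dual N \<Omega> q L \<longleftrightarrow>
     (\<forall>v w. W10 N \<Omega> q v \<longrightarrow> W10 N \<Omega> q w \<longrightarrow> L (\<lambda>x. v x + w x) = L v + L w) \<and>
     (\<forall>a v. W10 N \<Omega> q v \<longrightarrow> L (\<lambda>x. a * v x) = a * L v) \<and>
     (\<exists>c. \<forall>v. W10 N \<Omega> q v \<longrightarrow> \<bar>L v\<bar> \<le> c * W1_norm N \<Omega> q v)"

definition W10_weakly_converges ::
    "nat \<Rightarrow> rvec set \<Rightarrow> real \<Rightarrow> (nat \<Rightarrow> rvec \<Rightarrow> real) \<Rightarrow> (rvec \<Rightarrow> real) \<Rightarrow> bool" where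
  "W10_weakly_converges N \<Omega> q v u \<longleftrightarrow>
     (\<forall>n. W10 N \<Omega> q (v n)) \<and> W10 N \<Omega> q u \<and>
     (\<forall>L. W10_dual N \<Omega> q L \<longrightarrow> (\<lambda>n. L (v n)) \<longlonglongrightarrow> L u)"

definition SN :: "nat \<Rightarrow> rvec set \<Rightarrow> (rvec \<Rightarrow> real) \<Rightarrow> bool" where
  "SN N \<Omega> u \<longleftrightarrow> (\<forall>q. 1 < q \<and> q < real N / (real N - 1) \<longrightarrow> W10 N \<Omega> q u)"

section \<open>The equations\<close>

text \<open>Unlike the library's \<open>sgn\<close>, \<open>sign 0 = 1\<close>.\<close>

definition sign :: "real \<Rightarrow> real" where
  "sign s = (if s \<ge> 0 then 1 else - 1)"

definition psi :: "real \<Rightarrow> real" where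
  "psi s = ln (1 + \<bar>s\<bar>) / (1 + ln (1 + \<bar>s\<bar>)) * sign s"

definition Trunc :: "real \<Rightarrow> real \<Rightarrow> real" where
  "Trunc k s = min \<bar>s\<bar> k * sign s"

definition elliptic_coeff ::
    "nat \<Rightarrow> rvec set \<Rightarrow> real \<Rightarrow> real \<Rightarrow> (rvec \<Rightarrow> nat \<Rightarrow> nat \<Rightarrow> real) \<Rightarrow> bool" where
  "elliptic_coeff N \<Omega> lo hi \<Lambda> \<longleftrightarrow> 0 < lo \<and> 0 < hi \<and>
     (\<forall>i<N. \<forall>j<N. Linf (leb_on N \<Omega>) (\<lambda>x. \<Lambda> x i j)) \<and>
     (AE x in leb_on N \<Omega>. \<forall>i<N. \<forall>j<N. \<Lambda> x i j = \<Lambda> x j i) \<and>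
     (AE x in leb_on N \<Omega>. \<forall>\<xi>.
        lo * (normN N \<xi>)\<^sup>2 \<le> dotN N (matvecN N (\<Lambda> x) \<xi>) \<xi> \<and>
        dotN N (matvecN N (\<Lambda> x) \<xi>) \<xi> \<le> hi * (normN N \<xi>)\<^sup>2)"

text \<open>
  All integrands below are integrable: for \<open>p > N \<ge> 2\<close> by Hoelder's inequality,
  \<open>\<bar>\<nabla>\<psi>(u)\<bar> \<le> \<bar>\<nabla>u\<bar>\<close> and the boundedness of \<open>w\<close>; in \<open>entropy_solution\<close> because
  \<open>\<nabla>T\<^sub>k(u - \<phi>)\<close> vanishes outside a set on which \<open>u\<close> coincides with some \<open>T\<^sub>m(u)\<close>. At points
  where \<open>\<nabla>\<psi>(u) = 0\<close> the power is \<open>0 powr (p - 2) = 0\<close>, as it should be since \<open>p > 2\<close>.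
\<close>

definition regularised_solution ::
    "nat \<Rightarrow> rvec set \<Rightarrow> real \<Rightarrow> (rvec \<Rightarrow> nat \<Rightarrow> nat \<Rightarrow> real) \<Rightarrow> (rvec \<Rightarrow> real) \<Rightarrow> real \<Rightarrow>
     (rvec \<Rightarrow> real) \<Rightarrow> bool" where
  "regularised_solution N \<Omega> p \<Lambda> f e u \<longleftrightarrow> W10 N \<Omega> p u \<and>
     (\<forall>w. W10 N \<Omega> p w \<longrightarrow>
        (LINT x|leb_on N \<Omega>.
           dotN N (matvecN N (\<Lambda> x) (weak_grad N \<Omega> u x)) (weak_grad N \<Omega> w x)) +
        e * (LINT x|leb_on N \<Omega>.
           normN N (weak_grad N \<Omega> (\<lambda>y. psi (u y)) x) powr (p - 2) *
           dotN N (weak_grad N \<Omega> u x) (weak_grad N \<Omega> w x)) =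
        (LINT x|leb_on N \<Omega>. f x * w x))"

definition entropy_solution ::
    "nat \<Rightarrow> rvec set \<Rightarrow> (rvec \<Rightarrow> nat \<Rightarrow> nat \<Rightarrow> real) \<Rightarrow> (rvec \<Rightarrow> real) \<Rightarrow> (rvec \<Rightarrow> real) \<Rightarrow> bool" where
  "entropy_solution N \<Omega> \<Lambda> f u \<longleftrightarrow>
     u \<in> borel_measurable (leb_on N \<Omega>) \<and>
     SN N \<Omega> u \<and> (\<forall>k>0. H10 N \<Omega> (\<lambda>x. Trunc k (u x))) \<and>
     (\<forall>\<phi>. Cc_smooth N \<Omega> \<phi> \<longrightarrow> (\<forall>k>0.
        (LINT x|leb_on N \<Omega>.
           dotN N (matvecN N (\<Lambda> x) (weak_grad N \<Omega> u x))
             (weak_grad N \<Omega> (\<lambda>y. Trunc k (u y - \<phi> y)) x))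
        \<le> (LINT x|leb_on N \<Omega>. f x * Trunc k (u x - \<phi> x))))"

definition approx_converges ::
    "nat \<Rightarrow> rvec set \<Rightarrow> (nat \<Rightarrow> rvec \<Rightarrow> real) \<Rightarrow> (rvec \<Rightarrow> real) \<Rightarrow> bool" where
  "approx_converges N \<Omega> v u \<longleftrightarrow>
     (\<forall>q. 1 < q \<and> q < real N / (real N - 1) \<longrightarrow> W10_weakly_converges N \<Omega> q v u) \<and>
     (\<forall>r\<ge>1. (N = 2 \<or> (3 \<le> N \<and> r < real N / (real N - 2))) \<longrightarrow>
        Lp_converges (leb_on N \<Omega>) r v u) \<and>
     (AE x in leb_on N \<Omega>. (\<lambda>n. v n x) \<longlonglongrightarrow> u x)"

end

theory Submission
  imports Defs
begin

text \<open>
  The argument rests on one family of test functions. Testing the regularised equation for \<open>v\<^sub>n\<close>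
  with the truncation \<open>T\<^sub>k(v\<^sub>n)\<close> gives two nonnegative terms, because the gradient of \<open>T\<^sub>k(v\<^sub>n)\<close> is that
  of \<open>v\<^sub>n\<close> on the set \<open>\<bar>v\<^sub>n\<bar> < k\<close> and vanishes elsewhere. Coercivity then bounds the squared norm
  of \<open>\<nabla>T\<^sub>k(v\<^sub>n)\<close> by \<open>k / lo\<close> times the norm of \<open>f\<close>, uniformly in n (lemma
  \<open>truncation_estimate\<close>), and the perturbation, restricted to this set, is bounded as well. As \<open>v\<^sub>n\<close>
  converges almost everywhere, \<open>T\<^sub>k(u)\<close> is the weak limit of \<open>T\<^sub>k(v\<^sub>n)\<close> and obeys the same estimate
  (theorem \<open>weak_closure\<close>). The constant is therefore the square root of \<open>k F / lo\<close>, where \<open>F\<close> is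
  the norm of \<open>f\<close>.

  For the entropy inequality the test function is \<open>T\<^sub>k(v\<^sub>n - \<phi>)\<close>. Where the truncation is inactive,
  \<open>v\<^sub>n\<close> is bounded by a constant m depending on \<open>\<phi>\<close> and k only. There the perturbation is bounded
  below by a negative multiple of \<open>\<epsilon>\<^sub>n\<close> times the integral of \<open>\<bar>\<nabla>\<psi>(v\<^sub>n)\<bar>\<close> to the power p - 2, which tends
  to zero by the estimate for \<open>T\<^sub>m(v\<^sub>n)\<close> and \<open>\<bar>\<nabla>\<psi>(v\<^sub>n)\<bar> \<le> \<bar>\<nabla>v\<^sub>n\<bar>\<close> (lemma \<open>perturbation_null\<close>). The
  elliptic term is a positive quadratic form in \<open>\<nabla>T\<^sub>k(v\<^sub>n - \<phi>)\<close> plus a linear one, and hence is weakly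
  lower semicontinuous (lemmas \<open>tangent_estimate\<close> and \<open>entropy_inequality\<close>).

  The theory of Sobolev functions that this needs is developed from the definitions. Weak
  gradients are unique by the fundamental lemma of the calculus of variations, which is proved by
  approximating the indicators of boxes by test functions. All functions that occur are limits of test
  functions in a Sobolev norm, so the chain rule follows from the classical one by passing to the limit;
  truncation is reached through smooth functions with bounded derivatives that converge at every point
  (theorem \<open>W10g_Trunc\<close>). Weak compactness is replaced by a parallelogram argument: midpoints of tails
  of nearly minimal energy converge strongly.
\<close>

section \<open>Lebesgue measure on open sets\<close>

abbreviation PN :: "nat \<Rightarrow> rvec measure" where
  "PN N \<equiv> \<Pi>\<^sub>M i\<in>{..<N}. lborel"

text \<open>Boxes with edges parallel to the axes. The open ones exhaust an open set and generate
the Borel sets; the closed ones are the compact supports of the test functions used below.\<close>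

definition obox :: "nat \<Rightarrow> rvec \<Rightarrow> rvec \<Rightarrow> rvec set" where
  "obox N a b = (\<Pi>\<^sub>E i\<in>{..<N}. {a i<..<b i})"

definition clbox :: "nat \<Rightarrow> rvec \<Rightarrow> rvec \<Rightarrow> rvec set" where
  "clbox N a b = (\<Pi>\<^sub>E i\<in>{..<N}. {a i..b i})"

lemma obox_subset_clbox: "obox N a b \<subseteq> clbox N a b"
  unfolding obox_def clbox_def by (intro PiE_mono) auto

lemma topspace_RN: "topspace (RN N) = (\<Pi>\<^sub>E i\<in>{..<N}. UNIV)"
  by simp

lemma space_PN: "space (PN N) = topspace (RN N)"
  by (simp add: space_PiM)

lemma in_topspace_upd: "x \<in> topspace (RN N) \<Longrightarrow> i < N \<Longrightarrow> x(i := t) \<in> topspace (RN N)"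
  by (auto simp: PiE_iff extensional_def)

lemma rational_interval:
  assumes "open U" "(t::real) \<in> U"
  shows "\<exists>a\<in>\<rat>. \<exists>b\<in>\<rat>. a < t \<and> t < b \<and> {a..b} \<subseteq> U"
proof -
  obtain e where e: "e > 0" "ball t e \<subseteq> U" using assms by (meson openE)
  obtain a where a: "a \<in> \<rat>" "t - e < a" "a < t" using Rats_dense_in_real[of "t - e" t] e by auto
  obtain b where b: "b \<in> \<rat>" "t < b" "b < t + e" using Rats_dense_in_real[of t "t + e"] e by auto
  have "{a..b} \<subseteq> ball t e" using a b by (auto simp: dist_real_def)
  with a b e show ?thesis by blast
qed

text \<open>The closed boxes lie inside the set as well, so that each of them can serve as the
support of a test function. Countability lets statements that hold almost everywhere on each box be
collected.\<close>

lemma open_rational_boxes: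
  assumes "openin (RN N) \<Omega>"
  shows "\<exists>C. countable C \<and> (\<forall>(a,b)\<in>C. clbox N a b \<subseteq> \<Omega>) \<and> \<Omega> = (\<Union>(a,b)\<in>C. obox N a b)"
proof -
  define Q where "Q = (\<Pi>\<^sub>E i\<in>{..<N}. (\<rat>::real set))"
  define C where "C = {(a,b). a \<in> Q \<and> b \<in> Q \<and> clbox N a b \<subseteq> \<Omega>}"
  have "countable Q" unfolding Q_def by (intro countable_PiE) (auto simp: countable_rat)
  then have "countable C"
    by (rule_tac countable_subset[of _ "Q \<times> Q"]) (auto simp: C_def)
  moreover have "\<Omega> \<subseteq> (\<Union>(a,b)\<in>C. obox N a b)"
  proof
    fix x assume x: "x \<in> \<Omega>"
    then have xt: "x \<in> topspace (RN N)" using assms openin_subset by blast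
    obtain U where U: "\<And>i. i < N \<Longrightarrow> open (U i)" "x \<in> Pi\<^sub>E {..<N} U" "Pi\<^sub>E {..<N} U \<subseteq> \<Omega>"
      using assms x unfolding openin_product_topology_alt
      by simp (metis lessThan_iff)
    have "\<forall>i. \<exists>a b. i < N \<longrightarrow> a \<in> \<rat> \<and> b \<in> \<rat> \<and> a < x i \<and> x i < b \<and> {a..b} \<subseteq> U i"
      using rational_interval U by (metis PiE_mem lessThan_iff)
    then obtain a b where ab: "\<And>i. i < N \<Longrightarrow> a i \<in> \<rat> \<and> b i \<in> \<rat> \<and> a i < x i \<and> x i < b i \<and> {a i..b i} \<subseteq> U i"
      by metis
    let ?a = "restrict a {..<N}" and ?b = "restrict b {..<N}"
    have "clbox N ?a ?b \<subseteq> Pi\<^sub>E {..<N} U" unfolding clbox_def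
      by (intro PiE_mono) (use ab in auto)
    then have "(?a, ?b) \<in> C" using U(3) ab by (auto simp: C_def Q_def)
    moreover have "x \<in> obox N ?a ?b" using ab xt by (auto simp: obox_def PiE_iff)
    ultimately show "x \<in> (\<Union>(a,b)\<in>C. obox N a b)" by blast
  qed
  moreover have "(\<Union>(a,b)\<in>C. obox N a b) \<subseteq> \<Omega>"
    using obox_subset_clbox by (fastforce simp: C_def)
  ultimately show ?thesis
    by (intro exI[of _ C]) (auto simp: C_def)
qed

lemma obox_sets: "obox N a b \<in> sets (PN N)"
  unfolding obox_def by (intro sets_PiM_I_finite) auto

lemma clbox_sets: "clbox N a b \<in> sets (PN N)"
  unfolding clbox_def by (intro sets_PiM_I_finite) auto

lemma compactin_clbox: "compactin (RN N) (clbox N a b)"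
  unfolding clbox_def by (subst compactin_PiE) auto

text \<open>The product sigma algebra is defined without reference to the topology. That it contains
all open sets rests on the countable cover by boxes.\<close>

lemma open_in_sets_PN:
  assumes "openin (RN N) \<Omega>" shows "\<Omega> \<in> sets (PN N)"
proof -
  obtain C where "countable C" "\<Omega> = (\<Union>(a,b)\<in>C. obox N a b)"
    using open_rational_boxes[OF assms] by blast
  then show ?thesis by (auto intro!: sets.countable_UN' obox_sets)
qed

lemma continuous_borel_PN:
  assumes "continuous_map (RN N) euclideanreal f" shows "f \<in> borel_measurable (PN N)"
proof (rule borel_measurableI)
  fix S :: "real set" assume "open S"
  then have "openin (RN N) {x \<in> topspace (RN N). f x \<in> S}"
    using assms by (intro openin_continuous_map_preimage) auto
  moreover have "f -` S \<inter> space (PN N) = {x \<in> topspace (RN N). f x \<in> S}"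
    unfolding space_PN by auto
  ultimately show "f -` S \<inter> space (PN N) \<in> sets (PN N)" using open_in_sets_PN by metis
qed

lemma sets_leb_on: "openin (RN N) \<Omega> \<Longrightarrow> \<Omega> \<inter> space (completion (PN N)) \<in> sets (completion (PN N))"
  using open_in_sets_PN[of N \<Omega>] sets.top[of "completion (PN N)"]
  by (intro sets.Int sets_completionI_sets) auto

lemma space_leb_on: "openin (RN N) \<Omega> \<Longrightarrow> space (leb_on N \<Omega>) = \<Omega>"
  unfolding leb_on_def using openin_subset[of "RN N" \<Omega>] by (auto simp: space_restrict_space space_PiM)

lemma measurable_leb_on: "f \<in> borel_measurable (PN N) \<Longrightarrow> f \<in> borel_measurable (leb_on N \<Omega>)"
  unfolding leb_on_def by (intro measurable_restrict_space1 measurable_completion)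

lemma product_sigma_finite_lborel: "product_sigma_finite (\<lambda>i. lborel :: real measure)"
  by unfold_locales

lemma emeasure_clbox: "emeasure (PN N) (clbox N a b) < \<infinity>"
proof -
  interpret product_sigma_finite "\<lambda>i::nat. lborel :: real measure" by (rule product_sigma_finite_lborel)
  show ?thesis unfolding clbox_def
    by (subst emeasure_PiM) (auto simp: less_top[symmetric] ennreal_prod_eq_top emeasure_lborel_Icc_eq)
qed

lemma normN_nonneg: "0 \<le> normN N v"
  unfolding normN_def dotN_def by (auto intro!: sum_nonneg)

lemma dotN_self: "dotN N v v = (normN N v)\<^sup>2"
  unfolding normN_def by (simp add: dotN_def sum_nonneg)

lemma normN_sq: "(normN N v)\<^sup>2 = (\<Sum>i<N. (v i)\<^sup>2)"
  unfolding dotN_self[symmetric] dotN_def by (simp add: power2_eq_square)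

lemma abs_le_normN: assumes "i < N" shows "\<bar>v i\<bar> \<le> normN N v"
proof -
  have "(v i)\<^sup>2 \<le> (normN N v)\<^sup>2" unfolding normN_sq
    using assms by (intro member_le_sum) auto
  then show ?thesis using normN_nonneg abs_le_square_iff by (metis abs_of_nonneg)
qed

lemma normN_le_sum: "normN N v \<le> (\<Sum>i<N. \<bar>v i\<bar>)"
proof -
  have "normN N v = L2_set v {..<N}"
    unfolding normN_def dotN_def L2_set_def by (simp add: power2_eq_square)
  then show ?thesis by (simp add: L2_set_le_sum_abs)
qed

lemma bounded_subset_clbox:
  assumes "\<Omega> \<subseteq> topspace (RN N)" "\<And>x. x \<in> \<Omega> \<Longrightarrow> normN N x \<le> B"
  shows "\<Omega> \<subseteq> clbox N (\<lambda>_. - B) (\<lambda>_. B)"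
proof
  fix x assume x: "x \<in> \<Omega>"
  have "\<bar>x i\<bar> \<le> B" if "i < N" for i
    using abs_le_normN[of i N x] that assms(2)[OF x] by linarith
  then show "x \<in> clbox N (\<lambda>_. - B) (\<lambda>_. B)"
    using x assms(1) by (fastforce simp: clbox_def PiE_iff abs_le_iff)
qed

lemma finite_measure_leb_on:
  assumes "open_bounded N \<Omega>" shows "finite_measure (leb_on N \<Omega>)"
proof
  obtain B where op: "openin (RN N) \<Omega>" and B: "\<And>x. x \<in> \<Omega> \<Longrightarrow> normN N x \<le> B"
    using assms unfolding open_bounded_def by blast
  have "\<Omega> \<subseteq> clbox N (\<lambda>_. - B) (\<lambda>_. B)" using bounded_subset_clbox B openin_subset[OF op] by metis
  then have "emeasure (PN N) \<Omega> \<le> emeasure (PN N) (clbox N (\<lambda>_. - B) (\<lambda>_. B))"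
    by (intro emeasure_mono clbox_sets)
  also have "\<dots> < \<infinity>" by (rule emeasure_clbox)
  finally have "emeasure (PN N) \<Omega> < \<infinity>" .
  moreover have "emeasure (leb_on N \<Omega>) \<Omega> = emeasure (PN N) \<Omega>"
    unfolding leb_on_def by (simp add: emeasure_restrict_space sets_leb_on[OF op] open_in_sets_PN[OF op] del: space_completion)
  ultimately show "emeasure (leb_on N \<Omega>) (space (leb_on N \<Omega>)) \<noteq> \<infinity>"
    by (simp add: space_leb_on[OF op])
qed

lemma integral_leb_on_PN:
  fixes f :: "rvec \<Rightarrow> real"
  assumes "openin (RN N) \<Omega>" "f \<in> borel_measurable (PN N)" "\<And>x. x \<in> topspace (RN N) - \<Omega> \<Longrightarrow> f x = 0"
  shows "(LINT x|leb_on N \<Omega>. f x) = (LINT x|PN N. f x)"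
proof -
  have "(LINT x|leb_on N \<Omega>. f x) = (LINT x|completion (PN N). indicator \<Omega> x *\<^sub>R f x)"
    unfolding leb_on_def by (intro integral_restrict_space sets_leb_on assms)
  also have "\<dots> = (LINT x|completion (PN N). f x)"
    using assms(3) by (intro Bochner_Integration.integral_cong) (auto simp: indicator_def space_PN)
  also have "\<dots> = (LINT x|PN N. f x)" using assms by (intro integral_completion)
  finally show ?thesis .
qed

section \<open>Smooth functions\<close>

text \<open>The derivatives are carried along as a sequence, because the algebra argument for
compositions uses all of them as generators.\<close>

definition smooth1 :: "(real \<Rightarrow> real) \<Rightarrow> bool" where
  "smooth1 G \<longleftrightarrow> (\<exists>D. D 0 = G \<and> (\<forall>j x. (D j has_real_derivative D (Suc j) x) (at x)))"

text \<open>Partial differentiability only constrains the values at points of the space, i.e. at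
extensional functions, since the axis-parallel lines through such points stay inside the space.\<close>

definition pdiff :: "nat \<Rightarrow> nat \<Rightarrow> (rvec \<Rightarrow> real) \<Rightarrow> (rvec \<Rightarrow> real) \<Rightarrow> bool" where
  "pdiff N i g g' \<longleftrightarrow> (\<forall>x\<in>topspace (RN N). ((\<lambda>t. g (x(i := t))) has_real_derivative g' x) (at (x i)))"

text \<open>Closure under sums and products. If every generator has its derivatives in the algebra,
the product rule extends this to the whole algebra, so that all its elements are differentiable
infinitely often. This replaces any bookkeeping of higher derivatives.\<close>

inductive_set alg :: "('a \<Rightarrow> real) set \<Rightarrow> ('a \<Rightarrow> real) set" for B where
  alg_base: "g \<in> B \<Longrightarrow> g \<in> alg B"
| alg_const: "(\<lambda>_. c) \<in> alg B"
| alg_add: "g \<in> alg B \<Longrightarrow> h \<in> alg B \<Longrightarrow> (\<lambda>x. g x + h x) \<in> alg B"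
| alg_mult: "g \<in> alg B \<Longrightarrow> h \<in> alg B \<Longrightarrow> (\<lambda>x. g x * h x) \<in> alg B"

lemma alg_mono: "A \<subseteq> B \<Longrightarrow> g \<in> alg A \<Longrightarrow> g \<in> alg B"
  by (rotate_tac 1, induction rule: alg.induct) (auto intro: alg.intros)

lemma alg_cmult: "g \<in> alg B \<Longrightarrow> (\<lambda>x. c * g x) \<in> alg B"
  by (intro alg_mult alg_const)

lemma alg_diff: "g \<in> alg B \<Longrightarrow> h \<in> alg B \<Longrightarrow> (\<lambda>x. g x - h x) \<in> alg B"
  using alg_add[OF _ alg_cmult, of g B h "-1"] by simp

lemma smooth1_alg:
  assumes B: "\<And>g. g \<in> B \<Longrightarrow> \<exists>g'\<in>alg B. \<forall>x. (g has_real_derivative g' x) (at x)"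
    and "g \<in> alg B"
  shows "smooth1 g"
proof -
  have D: "\<exists>g'\<in>alg B. \<forall>x. (g has_real_derivative g' x) (at x)" if "g \<in> alg B" for g
    using that
  proof induction
    case (alg_base g) then show ?case using B by auto
  next
    case (alg_const c) show ?case
      by (intro bexI[of _ "\<lambda>_. 0"] alg.alg_const allI) (auto intro!: derivative_eq_intros)
  next
    case (alg_add g h)
    then obtain g' h' where "g' \<in> alg B" "\<forall>x. (g has_real_derivative g' x) (at x)"
      "h' \<in> alg B" "\<forall>x. (h has_real_derivative h' x) (at x)" by blast
    then show ?case
      by (intro bexI[of _ "\<lambda>x. g' x + h' x"] alg.alg_add allI) (auto intro!: derivative_intros)
  next
    case (alg_mult g h)
    then obtain g' h' where *: "g' \<in> alg B" "\<forall>x. (g has_real_derivative g' x) (at x)"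
      "h' \<in> alg B" "\<forall>x. (h has_real_derivative h' x) (at x)" by blast
    show ?case
    proof (intro bexI[of _ "\<lambda>x. g' x * h x + h' x * g x"] allI)
      show "(\<lambda>x. g' x * h x + h' x * g x) \<in> alg B"
        using * alg_mult by (intro alg.alg_add alg.alg_mult)
      show "((\<lambda>x. g x * h x) has_real_derivative g' x * h x + h' x * g x) (at x)" for x
        using * by (intro DERIV_mult) auto
    qed
  qed
  then obtain d where d: "\<And>g. g \<in> alg B \<Longrightarrow> d g \<in> alg B \<and> (\<forall>x. (g has_real_derivative d g x) (at x))"
    by metis
  have "(d ^^ j) g \<in> alg B" for j using d \<open>g \<in> alg B\<close> by (induction j) auto
  then show ?thesis unfolding smooth1_def
    using d by (intro exI[of _ "\<lambda>j. (d ^^ j) g"]) auto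
qed

lemma pdiff_pd:
  assumes "pdiff N i g g'" "x \<in> topspace (RN N)" shows "pd i g x = g' x"
  using assms unfolding pdiff_def pd_def by (auto intro: DERIV_imp_deriv)

text \<open>Smoothness is coinductive: a family of continuous functions that contains the partial
derivatives of its members consists of smooth functions. The derivative need only be matched on the
space, because the partial derivatives there see no other values.\<close>

lemma smoothN_coinduct:
  assumes S: "\<And>g. g \<in> S \<Longrightarrow> continuous_map (RN N) euclideanreal g"
    "\<And>g i. g \<in> S \<Longrightarrow> i < N \<Longrightarrow> \<exists>g'\<in>S. pdiff N i g g'"
    and "g \<in> S"
  shows "smoothN N g"
proof -
  have *: "\<exists>h\<in>S. \<forall>x\<in>topspace (RN N). foldr pd js g x = h x" if "js \<in> lists {..<N}" for js
    using that
  proof (induction js)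
    case Nil then show ?case using \<open>g \<in> S\<close> by auto
  next
    case (Cons i js)
    then obtain h where h: "h \<in> S" "\<forall>x\<in>topspace (RN N). foldr pd js g x = h x" by auto
    have i: "i < N" using Cons by auto
    obtain h' where h': "h' \<in> S" "pdiff N i h h'" using S(2)[OF h(1) i] by blast
    have "foldr pd (i # js) g x = h' x" if x: "x \<in> topspace (RN N)" for x
    proof -
      have "(\<lambda>t. foldr pd js g (x(i := t))) = (\<lambda>t. h (x(i := t)))"
        using h(2) in_topspace_upd[OF x i] by blast
      then have "pd i (foldr pd js g) x = pd i h x" unfolding pd_def by simp
      then show ?thesis using pdiff_pd[OF h'(2) x] by (simp only: foldr.simps comp_apply)
    qed
    then show ?case using h'(1) by blast
  qed
  show ?thesis unfolding smoothN_def
  proof (intro ballI conjI allI impI)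
    fix js assume js: "js \<in> lists {..<N}"
    then obtain h where h: "h \<in> S" "\<forall>x\<in>topspace (RN N). foldr pd js g x = h x" using * by blast
    show "continuous_map (RN N) euclideanreal (foldr pd js g)"
      by (rule continuous_map_eq[OF S(1)[OF h(1)]]) (use h(2) in auto)
    fix i x assume i: "i < N" and x: "x \<in> topspace (RN N)"
    obtain h' where h': "h' \<in> S" "pdiff N i h h'" using S(2)[OF h(1) i] by blast
    have "(\<lambda>t. foldr pd js g (x(i := t))) = (\<lambda>t. h (x(i := t)))"
      using h(2) in_topspace_upd[OF x i] by blast
    then show "(\<lambda>t. foldr pd js g (x(i := t))) field_differentiable at (x i)"
      using h'(2) x unfolding pdiff_def field_differentiable_def by auto
  qed
qed

lemma smoothN_alg:
  assumes B: "\<And>g. g \<in> B \<Longrightarrow> continuous_map (RN N) euclideanreal g"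
    "\<And>g i. g \<in> B \<Longrightarrow> i < N \<Longrightarrow> \<exists>g'\<in>alg B. pdiff N i g g'"
    and "g \<in> alg B"
  shows "smoothN N g"
proof (rule smoothN_coinduct[of "alg B"])
  show "continuous_map (RN N) euclideanreal h" if "h \<in> alg B" for h
    using that
    by induction (auto intro: B(1) continuous_map_add continuous_map_real_mult)
  show "\<exists>g'\<in>alg B. pdiff N i g g'" if "g \<in> alg B" "i < N" for g i
    using that
  proof induction
    case (alg_base g) then show ?case using B by auto
  next
    case (alg_const c) show ?case
      by (intro bexI[of _ "\<lambda>_. 0"] alg.alg_const) (auto simp: pdiff_def)
  next
    case (alg_add g h)
    then obtain g' h' where "g' \<in> alg B" "pdiff N i g g'" "h' \<in> alg B" "pdiff N i h h'" by blast
    then show ?case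
      by (intro bexI[of _ "\<lambda>x. g' x + h' x"] alg.alg_add) (auto simp: pdiff_def intro!: derivative_intros)
  next
    case (alg_mult g h)
    then obtain g' h' where *: "g' \<in> alg B" "pdiff N i g g'" "h' \<in> alg B" "pdiff N i h h'" by blast
    show ?case
    proof (intro bexI[of _ "\<lambda>x. g' x * h x + h' x * g x"])
      show "(\<lambda>x. g' x * h x + h' x * g x) \<in> alg B"
        using * alg_mult by (intro alg.alg_add alg.alg_mult)
      show "pdiff N i (\<lambda>x. g x * h x) (\<lambda>x. g' x * h x + h' x * g x)"
        unfolding pdiff_def
      proof
        fix x assume "x \<in> topspace (RN N)"
        then have "((\<lambda>t. g (x(i:=t)) * h (x(i:=t))) has_real_derivative
          g' x * h (x(i := x i)) + h' x * g (x(i := x i))) (at (x i))"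
          using * unfolding pdiff_def by (intro DERIV_mult) auto
        then show "((\<lambda>t. g (x(i:=t)) * h (x(i:=t))) has_real_derivative g' x * h x + h' x * g x) (at (x i))"
          by simp
      qed
    qed
  qed
qed fact

text \<open>All iterated partial derivatives, the natural generators for the algebras below.\<close>

definition pds :: "nat \<Rightarrow> (rvec \<Rightarrow> real) \<Rightarrow> (rvec \<Rightarrow> real) set" where
  "pds N g = (\<lambda>js. foldr pd js g) ` lists {..<N}"

lemma pds_smooth:
  assumes "smoothN N g" "h \<in> pds N g"
  shows "continuous_map (RN N) euclideanreal h" "i < N \<Longrightarrow> pdiff N i h (pd i h)" "i < N \<Longrightarrow> pd i h \<in> pds N g"
proof -
  obtain js where js: "js \<in> lists {..<N}" "h = foldr pd js g" using assms(2) by (auto simp: pds_def)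
  show "continuous_map (RN N) euclideanreal h" using assms(1) js unfolding smoothN_def by blast
  show "pdiff N i h (pd i h)" if "i < N"
    using assms(1) js that unfolding smoothN_def pdiff_def pd_def DERIV_deriv_iff_field_differentiable
    by simp
  show "pd i h \<in> pds N g" if "i < N"
    unfolding pds_def using js that by (intro image_eqI[of _ _ "i # js"]) auto
qed

lemma self_in_pds: "g \<in> pds N g"
  unfolding pds_def by (intro image_eqI[of _ _ "[]"]) auto

lemma smoothN_cont: "smoothN N g \<Longrightarrow> continuous_map (RN N) euclideanreal g"
  by (rule pds_smooth(1)[OF _ self_in_pds])

lemma smoothN_pdiff: "smoothN N g \<Longrightarrow> i < N \<Longrightarrow> pdiff N i g (pd i g)"
  by (rule pds_smooth(2)[OF _ self_in_pds])

lemma smoothN_pd_cont: "smoothN N g \<Longrightarrow> i < N \<Longrightarrow> continuous_map (RN N) euclideanreal (pd i g)"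
  by (rule pds_smooth(1)[OF _ pds_smooth(3)[OF _ self_in_pds]])

lemma smoothN_alg2:
  assumes "smoothN N g" "smoothN N h" "f \<in> alg {g, h}"
  shows "smoothN N f"
proof (rule smoothN_alg[of "pds N g \<union> pds N h"])
  show "continuous_map (RN N) euclideanreal k" if "k \<in> pds N g \<union> pds N h" for k
    using that pds_smooth(1)[of N g k] pds_smooth(1)[of N h k] assms by auto
  show "\<exists>k'\<in>alg (pds N g \<union> pds N h). pdiff N i k k'" if "k \<in> pds N g \<union> pds N h" "i < N" for k i
  proof -
    have "pdiff N i k (pd i k)" "pd i k \<in> pds N g \<union> pds N h"
      using that assms pds_smooth(2,3)[of N g k i] pds_smooth(2,3)[of N h k i] by auto
    then show ?thesis using alg_base by blast
  qed
  show "f \<in> alg (pds N g \<union> pds N h)"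
    by (rule alg_mono[OF _ assms(3)]) (auto simp: self_in_pds)
qed

lemma smoothN_add: "smoothN N g \<Longrightarrow> smoothN N h \<Longrightarrow> smoothN N (\<lambda>x. g x + h x)"
  by (rule smoothN_alg2[of N g h]) (auto intro: alg.intros)

lemma smoothN_diff: "smoothN N g \<Longrightarrow> smoothN N h \<Longrightarrow> smoothN N (\<lambda>x. g x - h x)"
  by (rule smoothN_alg2[of N g h]) (auto intro: alg_diff alg_base)

lemma smoothN_mult: "smoothN N g \<Longrightarrow> smoothN N h \<Longrightarrow> smoothN N (\<lambda>x. g x * h x)"
  by (rule smoothN_alg2[of N g h]) (auto intro: alg.intros)

lemma smoothN_const: "smoothN N (\<lambda>x. c)"
  by (rule smoothN_alg[of "{}"]) (auto intro!: alg.intros)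

lemma smoothN_coord:
  assumes "j < N" shows "smoothN N (\<lambda>x. x j)"
proof (rule smoothN_alg[of "{\<lambda>x. x j}"])
  show "continuous_map (RN N) euclideanreal g" if "g \<in> {\<lambda>x. x j}" for g :: "rvec \<Rightarrow> real"
    using that assms continuous_map_product_projection[of j "{..<N}" "\<lambda>_. euclideanreal"] by auto
  show "\<exists>g'\<in>alg {\<lambda>x. x j}. pdiff N i g g'" if "g \<in> {\<lambda>x. x j}" for g :: "rvec \<Rightarrow> real" and i
  proof (intro bexI[of _ "\<lambda>_. if i = j then 1 else 0"] alg_const)
    show "pdiff N i g (\<lambda>_. if i = j then 1 else 0)"
      using that by (auto simp: pdiff_def)
  qed
qed (auto intro: alg_base)

text \<open>The generators are the derivatives of the inner function and all the compositions with a
derivative of the outer function; the chain rule keeps the derivatives in their algebra.\<close>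

lemma smoothN_compose:
  assumes "smoothN N g" "smooth1 G" shows "smoothN N (\<lambda>x. G (g x))"
proof -
  obtain D where D: "D 0 = G" "\<And>j x. (D j has_real_derivative D (Suc j) x) (at x)"
    using assms(2) unfolding smooth1_def by blast
  let ?B = "pds N g \<union> range (\<lambda>j x. D j (g x))"
  show ?thesis
  proof (rule smoothN_alg[of ?B])
    show "continuous_map (RN N) euclideanreal k" if "k \<in> ?B" for k
    proof -
      have "continuous_map (RN N) euclideanreal (D j \<circ> g)" for j
      proof (rule continuous_map_compose[OF smoothN_cont[OF assms(1)]])
        have "continuous_on UNIV (D j)"
          using D(2) DERIV_isCont continuous_at_imp_continuous_on by blast
        then show "continuous_map euclideanreal euclideanreal (D j)" by simp
      qed
      then show ?thesis using that pds_smooth(1)[OF assms(1)] by (auto simp: comp_def)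
    qed
    show "\<exists>k'\<in>alg ?B. pdiff N i k k'" if k: "k \<in> ?B" and i: "i < N" for k i
    proof (cases "k \<in> pds N g")
      case True
      show ?thesis
        by (rule bexI[of _ "pd i k"], rule pds_smooth(2)[OF assms(1) True i], rule alg_base)
          (use pds_smooth(3)[OF assms(1) True i] in simp)
    next
      case False
      then obtain j where j: "k = (\<lambda>x. D j (g x))" using k by blast
      have "(\<lambda>x. D (Suc j) (g x) * pd i g x) \<in> alg ?B"
        using pds_smooth(3)[OF assms(1) self_in_pds i] by (intro alg_mult alg_base) auto
      moreover have "pdiff N i k (\<lambda>x. D (Suc j) (g x) * pd i g x)"
        unfolding pdiff_def j
      proof
        fix x assume "x \<in> topspace (RN N)"
        then have *: "((\<lambda>t. g (x(i := t))) has_real_derivative pd i g x) (at (x i))"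
          using smoothN_pdiff[OF assms(1) i] unfolding pdiff_def by blast
        have "(D j has_real_derivative D (Suc j) (g x)) (at (g (x(i := x i))))" using D(2) by simp
        from DERIV_chain2[OF this *]
        show "((\<lambda>t. D j (g (x(i := t)))) has_real_derivative D (Suc j) (g x) * pd i g x) (at (x i))" .
      qed
      ultimately show ?thesis by blast
    qed
    show "(\<lambda>x. G (g x)) \<in> alg ?B" using D(1) by (intro alg_base) auto
  qed
qed

lemma smoothN_prod:
  assumes "finite I" "\<And>i. i \<in> I \<Longrightarrow> smoothN N (g i)" shows "smoothN N (\<lambda>x. \<Prod>i\<in>I. g i x)"
  using assms by (induction I) (auto intro: smoothN_const smoothN_mult)

subsection \<open>Compactly supported functions\<close>

text \<open>The second conjunct of the test function predicate, kept apart because it is inherited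
by products and derivatives that need not be smooth.\<close>

definition csupp :: "nat \<Rightarrow> rvec set \<Rightarrow> (rvec \<Rightarrow> real) \<Rightarrow> bool" where
  "csupp N \<Omega> \<phi> \<longleftrightarrow> (\<exists>K. compactin (RN N) K \<and> K \<subseteq> \<Omega> \<and> (\<forall>x\<in>topspace (RN N) - K. \<phi> x = 0))"

lemma Cc_smooth_alt: "Cc_smooth N \<Omega> \<phi> \<longleftrightarrow> smoothN N \<phi> \<and> csupp N \<Omega> \<phi>"
  by (simp add: Cc_smooth_def csupp_def)

lemma csupp_zero_outside: "csupp N \<Omega> \<phi> \<Longrightarrow> x \<in> topspace (RN N) - \<Omega> \<Longrightarrow> \<phi> x = 0"
  unfolding csupp_def by blast

lemma csupp_null: "csupp N \<Omega> \<phi> \<Longrightarrow> (\<And>x. \<phi> x = 0 \<Longrightarrow> \<psi> x = 0) \<Longrightarrow> csupp N \<Omega> \<psi>"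
  unfolding csupp_def by blast

lemma csupp_add:
  assumes "csupp N \<Omega> \<phi>" "csupp N \<Omega> \<psi>" "\<And>x. \<phi> x = 0 \<Longrightarrow> \<psi> x = 0 \<Longrightarrow> \<theta> x = 0"
  shows "csupp N \<Omega> \<theta>"
proof -
  obtain K L where "compactin (RN N) K" "K \<subseteq> \<Omega>" "\<forall>x\<in>topspace (RN N) - K. \<phi> x = 0"
    "compactin (RN N) L" "L \<subseteq> \<Omega>" "\<forall>x\<in>topspace (RN N) - L. \<psi> x = 0"
    using assms unfolding csupp_def by blast
  then show ?thesis unfolding csupp_def using assms(3)
    by (intro exI[of _ "K \<union> L"]) (auto intro: compactin_Un)
qed

lemma Hausdorff_RN: "Hausdorff_space (RN N)"
  by (simp add: Hausdorff_space_product_topology)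

lemma continuous_map_line:
  assumes "x \<in> topspace (RN N)" "i < N"
  shows "continuous_map euclideanreal (RN N) (\<lambda>t. x(i := t))"
  unfolding continuous_map_componentwise
proof (intro conjI ballI)
  show "(\<lambda>t. x(i := t)) ` topspace euclideanreal \<subseteq> extensional {..<N}"
    using assms by (auto simp: PiE_iff extensional_def)
  fix k assume "k \<in> {..<N}"
  show "continuous_map euclideanreal euclideanreal (\<lambda>t. (x(i := t)) k)"
    by (cases "k = i") auto
qed

text \<open>The complement of the compact support is open, so along every line the function vanishes
near a point outside of it.\<close>

lemma csupp_pdiff:
  assumes c: "csupp N \<Omega> \<phi>" and "pdiff N i \<phi> \<phi>'" and i: "i < N"
  shows "csupp N \<Omega> \<phi>'"
proof -
  obtain K where K: "compactin (RN N) K" "K \<subseteq> \<Omega>" "\<forall>x\<in>topspace (RN N) - K. \<phi> x = 0"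
    using c unfolding csupp_def by blast
  have "\<phi>' x = 0" if x: "x \<in> topspace (RN N) - K" for x
  proof -
    have op: "openin (RN N) (topspace (RN N) - K)"
      using compactin_imp_closedin[OF Hausdorff_RN K(1)] by blast
    have "openin euclideanreal {t \<in> topspace euclideanreal. x(i := t) \<in> topspace (RN N) - K}"
      using continuous_map_line[of x N i] x i op by (intro openin_continuous_map_preimage) auto
    then have "open {t. x(i := t) \<in> topspace (RN N) - K}" by simp
    moreover have "x i \<in> {t. x(i := t) \<in> topspace (RN N) - K}" using x by simp
    ultimately have "eventually (\<lambda>t. t \<in> {t. x(i := t) \<in> topspace (RN N) - K}) (nhds (x i))"
      by (rule eventually_nhds_in_open)
    then have "eventually (\<lambda>t. \<phi> (x(i := t)) = 0) (nhds (x i))"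
      by eventually_elim (use K(3) in auto)
    moreover have "((\<lambda>t. \<phi> (x(i := t))) has_real_derivative \<phi>' x) (at (x i))"
      using assms(2) x unfolding pdiff_def by auto
    ultimately have "((\<lambda>t. 0) has_real_derivative \<phi>' x) (at (x i))"
      using DERIV_cong_ev[OF refl, of "\<lambda>t. \<phi> (x(i := t))" "\<lambda>t. 0" "x i", OF _ refl] by simp
    then show ?thesis by (rule DERIV_unique) (rule DERIV_const)
  qed
  then show ?thesis unfolding csupp_def using K by blast
qed

lemma csupp_bounded:
  assumes "csupp N \<Omega> \<phi>" "continuous_map (RN N) euclideanreal \<phi>"
  shows "\<exists>B>0. \<forall>x\<in>topspace (RN N). \<bar>\<phi> x\<bar> \<le> B"
proof -
  obtain K where K: "compactin (RN N) K" "\<forall>x\<in>topspace (RN N) - K. \<phi> x = 0"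
    using assms(1) unfolding csupp_def by blast
  have "compactin euclideanreal (\<phi> ` K)" by (rule image_compactin[OF K(1) assms(2)])
  then have "bounded (\<phi> ` K)" using compact_imp_bounded by simp
  then obtain B where B: "B > 0" "\<forall>y\<in>\<phi> ` K. norm y \<le> B" unfolding bounded_pos by blast
  then have "\<bar>\<phi> x\<bar> \<le> B" if "x \<in> topspace (RN N)" for x
    using that K(2) by (cases "x \<in> K") auto
  with B(1) show ?thesis by blast
qed

lemma Cc_smooth_add: "Cc_smooth N \<Omega> \<phi> \<Longrightarrow> Cc_smooth N \<Omega> \<psi> \<Longrightarrow> Cc_smooth N \<Omega> (\<lambda>x. \<phi> x + \<psi> x)"
  unfolding Cc_smooth_alt using csupp_add[of N \<Omega> \<phi> \<psi> "\<lambda>x. \<phi> x + \<psi> x"] smoothN_add by auto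

lemma Cc_smooth_cmult: "Cc_smooth N \<Omega> \<phi> \<Longrightarrow> Cc_smooth N \<Omega> (\<lambda>x. c * \<phi> x)"
  unfolding Cc_smooth_alt using csupp_null[of N \<Omega> \<phi> "\<lambda>x. c * \<phi> x"] smoothN_mult[OF smoothN_const] by auto

lemma Cc_smooth_compose: "Cc_smooth N \<Omega> \<phi> \<Longrightarrow> smooth1 G \<Longrightarrow> G 0 = 0 \<Longrightarrow> Cc_smooth N \<Omega> (\<lambda>x. G (\<phi> x))"
  unfolding Cc_smooth_alt using csupp_null[of N \<Omega> \<phi> "\<lambda>x. G (\<phi> x)"] smoothN_compose by auto

subsection \<open>Bump functions\<close>

text \<open>The functions exp(-1/t)/t^m on the positive half line. The derivatives of exp(-1/t) are
linear combinations of them, and all of them vanish to infinite order at 0.\<close>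

definition flat_exp :: "nat \<Rightarrow> real \<Rightarrow> real" where
  "flat_exp m t = (if t > 0 then exp (- (1 / t)) / t ^ m else 0)"

lemma flat_exp_tendsto_0: "((\<lambda>t. flat_exp m t) \<longlongrightarrow> 0) (at 0)"
proof -
  have "((\<lambda>s::real. s ^ m / exp s) \<longlongrightarrow> 0) at_top" by (rule tendsto_power_div_exp_0)
  then have "((\<lambda>t::real. inverse t ^ m / exp (inverse t)) \<longlongrightarrow> 0) (at_right 0)"
    by (rule filterlim_compose[OF _ filterlim_inverse_at_top_right])
  then have "((\<lambda>t. flat_exp m t) \<longlongrightarrow> 0) (at_right 0)"
    by (rule Lim_transform_eventually)
      (auto simp: eventually_at_filter flat_exp_def field_simps exp_minus)
  moreover have "((\<lambda>t. flat_exp m t) \<longlongrightarrow> 0) (at_left 0)"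
    by (rule Lim_transform_eventually[of "\<lambda>_. 0"]) (auto simp: eventually_at_filter flat_exp_def)
  ultimately show ?thesis by (simp add: filterlim_split_at)
qed

text \<open>At 0 the difference quotient is the next member of the family, which tends to 0.\<close>

lemma flat_exp_deriv:
  "(flat_exp m has_real_derivative flat_exp (m + 2) t - real m * flat_exp (m + 1) t) (at t)"
proof -
  consider "t > 0" | "t < 0" | "t = 0" by linarith
  then show ?thesis
  proof cases
    case 1
    have "((\<lambda>t. exp (- (1 / t)) / t ^ m) has_real_derivative
       flat_exp (m + 2) t - real m * flat_exp (m + 1) t) (at t)"
      using 1 
      apply (auto intro!: derivative_eq_intros simp: flat_exp_def)
      apply (cases m)
       apply (auto simp: field_simps power2_eq_square)
      done
    moreover have "eventually (\<lambda>s. s \<in> {0<..}) (nhds t)" using 1 by (intro eventually_nhds_in_open) auto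
    then have "eventually (\<lambda>s. exp (- (1 / s)) / s ^ m = flat_exp m s) (nhds t)"
      by eventually_elim (auto simp: flat_exp_def)
    ultimately show ?thesis
      using DERIV_cong_ev[OF refl, of "\<lambda>t. exp (- (1 / t)) / t ^ m" "flat_exp m" t, OF _ refl] by simp
  next
    case 2
    have "((\<lambda>t. 0) has_real_derivative flat_exp (m + 2) t - real m * flat_exp (m + 1) t) (at t)"
      using 2 by (auto simp: flat_exp_def)
    moreover have "eventually (\<lambda>s. s \<in> {..<0}) (nhds t)" using 2 by (intro eventually_nhds_in_open) auto
    then have "eventually (\<lambda>s. 0 = flat_exp m s) (nhds t)"
      by eventually_elim (auto simp: flat_exp_def)
    ultimately show ?thesis
      using DERIV_cong_ev[OF refl, of "\<lambda>_. 0" "flat_exp m" t, OF _ refl] by simp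
  next
    case 3
    have "((\<lambda>h. flat_exp m h / h) \<longlongrightarrow> 0) (at 0)"
      by (rule Lim_transform_eventually[OF flat_exp_tendsto_0[of "m + 1"]])
        (auto simp: eventually_at_filter flat_exp_def)
    then show ?thesis using 3 by (simp add: DERIV_def flat_exp_def)
  qed
qed

lemma smooth1_flat_exp: "smooth1 (flat_exp m)"
proof (rule smooth1_alg[of "range flat_exp"])
  fix g assume "g \<in> range flat_exp"
  then obtain m where m: "g = flat_exp m" by blast
  show "\<exists>g'\<in>alg (range flat_exp). \<forall>x. (g has_real_derivative g' x) (at x)"
    unfolding m using flat_exp_deriv
    by (intro bexI[of _ "\<lambda>t. flat_exp (m + 2) t - real m * flat_exp (m + 1) t"] alg_diff alg_cmult alg_base) auto
qed (auto intro: alg_base)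

lemma smooth1_one_minus_exp: "smooth1 (\<lambda>s. 1 - exp (- (c * s)))"
proof (rule smooth1_alg[of "{\<lambda>s. exp (- (c * s))}"])
  fix g :: "real \<Rightarrow> real" assume g: "g \<in> {\<lambda>s. exp (- (c * s))}"
  show "\<exists>g'\<in>alg {\<lambda>s. exp (- (c * s))}. \<forall>x. (g has_real_derivative g' x) (at x)"
    using g by (intro bexI[of _ "\<lambda>s. (- c) * exp (- (c * s))"] alg_cmult alg_base)
      (auto intro!: derivative_eq_intros)
qed (intro alg_diff alg_base alg_const, simp)

text \<open>For a smooth \<beta> that is positive exactly on the open box, 1 - exp(-n \<beta>) is
smooth, supported in the closed box, and tends to the indicator of the open one.\<close>

lemma box_test_functions:
  assumes "clbox N a b \<subseteq> \<Omega>"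
  shows "\<exists>\<phi>. (\<forall>n. Cc_smooth N \<Omega> (\<phi> n)) \<and>
    (\<forall>n. \<forall>x\<in>topspace (RN N). 0 \<le> \<phi> n x \<and> \<phi> n x \<le> indicator (clbox N a b) x) \<and>
    (\<forall>x\<in>topspace (RN N). (\<lambda>n. \<phi> n x) \<longlonglongrightarrow> indicator (obox N a b) x)"
proof -
  define \<beta> where "\<beta> x = (\<Prod>i<N. flat_exp 0 (x i - a i) * flat_exp 0 (b i - x i))" for x
  define \<phi> where "\<phi> n x = 1 - exp (- (real n * \<beta> x))" for n :: nat and x
  have sm_coord: "smoothN N (\<lambda>x. flat_exp 0 (x i - a i))" "smoothN N (\<lambda>x. flat_exp 0 (b i - x i))" if "i < N" for i
    using smoothN_compose[OF smoothN_diff[OF smoothN_coord smoothN_const] smooth1_flat_exp] 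
      smoothN_compose[OF smoothN_diff[OF smoothN_const smoothN_coord] smooth1_flat_exp] that by auto
  have sm\<beta>: "smoothN N \<beta>" unfolding \<beta>_def
    by (rule smoothN_prod) (use sm_coord in \<open>auto intro: smoothN_mult\<close>)
  have sm: "smoothN N (\<phi> n)" for n unfolding \<phi>_def by (rule smoothN_compose[OF sm\<beta> smooth1_one_minus_exp])
  have fnn: "flat_exp 0 t \<ge> 0" for t by (simp add: flat_exp_def)
  have fpos: "flat_exp 0 t > 0 \<longleftrightarrow> t > 0" for t by (simp add: flat_exp_def)
  have \<beta>0: "\<beta> x \<ge> 0" for x unfolding \<beta>_def by (intro prod_nonneg ballI mult_nonneg_nonneg fnn)
  have pos: "\<beta> x > 0" if "x \<in> obox N a b" for x
    unfolding \<beta>_def using that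
    by (intro prod_pos ballI mult_pos_pos) (simp_all add: fpos obox_def PiE_iff)
  have zero: "\<beta> x = 0" if "x \<in> topspace (RN N)" "x \<notin> obox N a b" for x
  proof -
    have "\<exists>i<N. \<not> (a i < x i \<and> x i < b i)"
    proof (rule ccontr)
      assume "\<not> ?thesis"
      then have "x \<in> obox N a b" using that(1) unfolding obox_def by (simp add: PiE_iff)
      then show False using that(2) by simp
    qed
    then obtain i where "i < N" "\<not> (a i < x i \<and> x i < b i)" by blast
    then have "flat_exp 0 (x i - a i) * flat_exp 0 (b i - x i) = 0" by (auto simp: flat_exp_def)
    with \<open>i < N\<close> show ?thesis unfolding \<beta>_def by (intro prod_zero bexI[of _ i]) auto
  qed
  have z2: "\<phi> n x = 0" if "x \<in> topspace (RN N) - clbox N a b" for n x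
  proof -
    have "x \<notin> obox N a b" using that obox_subset_clbox[of N a b] by auto
    then have "\<beta> x = 0" using zero[of x] that by auto
    then show ?thesis by (simp add: \<phi>_def)
  qed
  have "csupp N \<Omega> (\<phi> n)" for n unfolding csupp_def
    using compactin_clbox assms z2 by (intro exI[of _ "clbox N a b"]) simp
  then have "\<forall>n. Cc_smooth N \<Omega> (\<phi> n)" using sm by (simp add: Cc_smooth_alt)
  moreover have "0 \<le> \<phi> n x \<and> \<phi> n x \<le> indicator (clbox N a b) x" if "x \<in> topspace (RN N)" for n x
  proof (cases "x \<in> clbox N a b")
    case True
    then show ?thesis using \<beta>0[of x] by (simp add: \<phi>_def)
  next
    case False
    then show ?thesis using z2[of x n] that by simp
  qed
  moreover have "(\<lambda>n. \<phi> n x) \<longlonglongrightarrow> indicator (obox N a b) x" if x: "x \<in> topspace (RN N)" for x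
  proof (cases "x \<in> obox N a b")
    case True
    have "filterlim (\<lambda>n. \<beta> x * real n) at_top sequentially"
      using pos[OF True] by (intro filterlim_tendsto_pos_mult_at_top[OF tendsto_const] filterlim_real_sequentially)
    then have "filterlim (\<lambda>n. - (\<beta> x * real n)) at_bot sequentially"
      by (simp add: filterlim_uminus_at_top)
    then have "(\<lambda>n. exp (- (\<beta> x * real n))) \<longlonglongrightarrow> 0"
      by (rule filterlim_compose[OF exp_at_bot])
    then have "(\<lambda>n. 1 - exp (- (\<beta> x * real n))) \<longlonglongrightarrow> 1 - 0" by (intro tendsto_intros)
    then show ?thesis using True by (simp add: \<phi>_def mult.commute)
  qed (use x in \<open>simp add: zero \<phi>_def\<close>)
  ultimately show ?thesis by (intro exI[of _ \<phi>] conjI) simp_all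
qed

section \<open>The fundamental lemma of the calculus of variations\<close>

text \<open>A generator stable under intersection, and such that the intersection of an orthant with
an open box is again an open box with the same lower corner.\<close>

lemma sets_PN_eq_orthants:
  "sets (PN N) = sigma_sets (topspace (RN N)) {(\<Pi>\<^sub>E i\<in>{..<N}. {..<d i}) |d. True}"
proof -
  let ?E = "range lessThan :: real set set"
  have b: "sets (lborel :: real measure) = sets (sigma UNIV ?E)"
    unfolding sets_lborel by (rule arg_cong[OF borel_Iio])
  have "sets (PN N) = sets (\<Pi>\<^sub>M i\<in>{..<N}. sigma UNIV ?E)"
    by (rule sets_PiM_cong[OF refl]) (rule b)
  also have "\<dots> = sets (sigma (\<Pi>\<^sub>E i\<in>{..<N}. UNIV)
     {{f\<in>(\<Pi>\<^sub>E i\<in>{..<N}. UNIV). \<forall>i\<in>j. f i \<in> A i} | A j. j \<in> {{..<N}} \<and> A \<in> Pi j (\<lambda>_. ?E)})"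
  proof (intro sets_PiM_sigma)
    have "\<exists>n::nat. t < real n" for t :: real by (rule reals_Archimedean2)
    then have "UNIV = (\<Union>n::nat. {..<real n})" by auto
    then show "\<exists>S\<subseteq>?E. countable S \<and> UNIV = \<Union> S" for i :: nat
      by (intro exI[of _ "range (\<lambda>n::nat. {..<real n})"]) auto
  qed simp_all
  also have "{{f\<in>(\<Pi>\<^sub>E i\<in>{..<N}. UNIV). \<forall>i\<in>j. f i \<in> A i} | A j. j \<in> {{..<N}} \<and> A \<in> Pi j (\<lambda>_. ?E)}
     = {(\<Pi>\<^sub>E i\<in>{..<N}. {..<d i}) |d. True}" (is "?L = ?R")
  proof (intro subset_antisym subsetI)
    fix X assume "X \<in> ?L"
    then obtain A where X: "X = {f\<in>(\<Pi>\<^sub>E i\<in>{..<N}. UNIV). \<forall>i\<in>{..<N}. f i \<in> A i}" and A: "A \<in> Pi {..<N} (\<lambda>_. ?E)"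
      by auto
    have "\<forall>i. \<exists>d. i < N \<longrightarrow> A i = {..<d}" using A by (meson Pi_mem lessThan_iff imageE)
    then obtain d where d: "\<And>i. i < N \<Longrightarrow> A i = {..<d i}" by metis
    have "X = (\<Pi>\<^sub>E i\<in>{..<N}. {..<d i})" unfolding X using d by (simp add: set_eq_iff PiE_iff conj_commute)
    then show "X \<in> ?R" by (intro CollectI exI[of _ d] conjI) simp_all
  next
    fix X assume "X \<in> ?R"
    then obtain d where X: "X = (\<Pi>\<^sub>E i\<in>{..<N}. {..<d i})" by blast
    have "X = {f\<in>(\<Pi>\<^sub>E i\<in>{..<N}. UNIV). \<forall>i\<in>{..<N}. f i \<in> {..<d i}}"
      unfolding X by (simp add: set_eq_iff PiE_iff conj_commute)
    then show "X \<in> ?L"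
      by (intro CollectI exI[of _ "\<lambda>i. {..<d i}"] exI[of _ "{..<N}"] conjI) simp_all
  qed
  also have "sets (sigma (\<Pi>\<^sub>E i\<in>{..<N}. UNIV) ?R) = sigma_sets (\<Pi>\<^sub>E i\<in>{..<N}. UNIV) ?R"
    by (rule sets_measure_of) (auto simp: PiE_iff)
  finally show ?thesis unfolding topspace_RN .
qed

lemma orthants_Int_stable: "Int_stable {(\<Pi>\<^sub>E i\<in>{..<N}. {..<d i :: real}) |d. True}"
proof (rule Int_stableI)
  fix A B assume "A \<in> {(\<Pi>\<^sub>E i\<in>{..<N}. {..<d i :: real}) |d. True}" "B \<in> {(\<Pi>\<^sub>E i\<in>{..<N}. {..<d i :: real}) |d. True}"
  then obtain d e where "A = (\<Pi>\<^sub>E i\<in>{..<N}. {..<d i})" "B = (\<Pi>\<^sub>E i\<in>{..<N}. {..<e i})" by blast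
  then have "A \<inter> B = (\<Pi>\<^sub>E i\<in>{..<N}. {..<min (d i) (e i)})"
  proof -
    have "{..<d i} \<inter> {..<e i} = {..<min (d i) (e i)}" for i by auto
    then show ?thesis using \<open>A = _\<close> \<open>B = _\<close> by (simp add: PiE_Int)
  qed
  then show "A \<inter> B \<in> {(\<Pi>\<^sub>E i\<in>{..<N}. {..<d i :: real}) |d. True}"
    by (intro CollectI exI[of _ "\<lambda>i. min (d i) (e i)"] conjI) simp_all
qed

text \<open>The sets over which the integral vanishes form a Dynkin system.\<close>

lemma null_integrals_on_orthants:
  fixes k :: "rvec \<Rightarrow> real"
  assumes k: "integrable (PN N) k" and total: "(LINT x|PN N. k x) = 0"
    and orth: "\<And>d. (LINT x:(\<Pi>\<^sub>E i\<in>{..<N}. {..<d i})|PN N. k x) = 0"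
  shows "AE x in PN N. k x = 0"
proof -
  have si: "set_integrable (PN N) A k" if "A \<in> sets (PN N)" for A
    unfolding set_integrable_def using that k by (rule integrable_mult_indicator)
  have "(LINT x:A|PN N. k x) = 0" if "A \<in> sets (PN N)" for A
  proof -
    have mem: "A \<in> sigma_sets (topspace (RN N)) {(\<Pi>\<^sub>E i\<in>{..<N}. {..<d i}) |d. True}"
      using that by (subst (asm) sets_PN_eq_orthants)
    have sub: "{(\<Pi>\<^sub>E i\<in>{..<N}. {..<d i :: real}) |d. True} \<subseteq> Pow (topspace (RN N))"
      unfolding topspace_RN using PiE_mono[of "{..<N}" _ "\<lambda>_. UNIV"] by blast
    from orthants_Int_stable sub mem show ?thesis
    proof (induction rule: sigma_sets_induct_disjoint)
      case (basic A) then show ?case using orth by auto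
    next
      case empty show ?case by (simp add: set_lebesgue_integral_def)
    next
      case (compl A)
      then have A: "A \<in> sets (PN N)" by (subst sets_PN_eq_orthants)
      have sub: "A \<subseteq> topspace (RN N)" using sets.sets_into_space[OF A] by (simp only: space_PN)
      have top: "topspace (RN N) \<in> sets (PN N)" using sets.top[of "PN N"] by (simp only: space_PN)
      have "(LINT x:topspace (RN N)|PN N. k x) = (LINT x:A \<union> (topspace (RN N) - A)|PN N. k x)"
        using sub by (metis Un_Diff_cancel Un_absorb1)
      also have "\<dots> = (LINT x:A|PN N. k x) + (LINT x:topspace (RN N) - A|PN N. k x)"
        by (rule set_integral_Un[OF _ si[OF A] si[OF sets.Diff[OF top A]]]) blast
      also have "(LINT x:topspace (RN N)|PN N. k x) = 0"
        using set_integral_space[OF k] total by (simp only: space_PN)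
      finally show ?case using compl by simp
    next
      case (union A)
      then have A: "A i \<in> sets (PN N)" for i by (subst sets_PN_eq_orthants) blast
      have "(LINT x:(\<Union>i. A i)|PN N. k x) = (\<Sum>i. (LINT x:(A i)|PN N. k x))"
      proof (rule lebesgue_integral_countable_add[OF A])
        show "A i \<inter> A j = {}" if "i \<noteq> j" for i j
          using union(1) that by (simp add: disjoint_family_on_def)
        show "set_integrable (PN N) (\<Union>i. A i) k" using A by (intro si sets.countable_UN) auto
      qed
      also have "\<dots> = (\<Sum>i. 0)" by (intro suminf_cong union)
      finally show ?case by simp
    qed
  qed
  then have "(LINT x:A|PN N. k x) = (LINT x:A|PN N. 0)" if "A \<in> sets (PN N)" for A
    using that by (simp add: set_lebesgue_integral_def)
  from density_unique_real[OF k _ this] show ?thesis by simp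
qed

text \<open>A bounded open set, whose Lebesgue measure is therefore finite.\<close>

locale open_domain =
  fixes N :: nat and \<Omega> :: "rvec set"
  assumes open_bounded: "open_bounded N \<Omega>"
begin

abbreviation "M \<equiv> leb_on N \<Omega>"

lemma open_\<Omega>: "openin (RN N) \<Omega>"
  using open_bounded by (simp add: open_bounded_def)

lemma \<Omega>_subset: "\<Omega> \<subseteq> topspace (RN N)"
  by (rule openin_subset[OF open_\<Omega>])

lemma space_M [simp]: "space M = \<Omega>"
  by (rule space_leb_on[OF open_\<Omega>])

sublocale finite_measure M
  by (rule finite_measure_leb_on[OF open_bounded])

lemma borel_M_of_continuous: "continuous_map (RN N) euclideanreal f \<Longrightarrow> f \<in> borel_measurable M"
  by (intro measurable_leb_on continuous_borel_PN)

lemma sets_PN_M: "A \<in> sets (PN N) \<Longrightarrow> A \<inter> \<Omega> \<in> sets M"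
  unfolding leb_on_def by (subst sets_restrict_space_iff[OF sets_leb_on[OF open_\<Omega>]]) 
    (use open_in_sets_PN[OF open_\<Omega>] in auto)

lemma indicator_borel_M: 
  assumes "A \<in> sets (PN N)" shows "(indicator A :: rvec \<Rightarrow> real) \<in> borel_measurable M"
  using assms by (intro measurable_leb_on) simp

text \<open>Dominated convergence along the test functions that increase to the indicator of the
box. Only the values of the function on the closed box matter, where it is integrable.\<close>

lemma box_integral_zero:
  assumes h: "loc_integrable N \<Omega> h" and z: "\<And>\<phi>. Cc_smooth N \<Omega> \<phi> \<Longrightarrow> (LINT x|M. h x * \<phi> x) = 0"
    and K: "clbox N a b \<subseteq> \<Omega>"
  shows "integrable M (\<lambda>x. indicator (obox N a b) x * h x)"
    and "(LINT x|M. indicator (obox N a b) x * h x) = 0"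
proof -
  obtain \<phi> where \<phi>: "\<And>n. Cc_smooth N \<Omega> (\<phi> n)"
    "\<And>n x. x \<in> topspace (RN N) \<Longrightarrow> 0 \<le> \<phi> n x \<and> \<phi> n x \<le> indicator (clbox N a b) x"
    "\<And>x. x \<in> topspace (RN N) \<Longrightarrow> (\<lambda>n. \<phi> n x) \<longlonglongrightarrow> indicator (obox N a b) x"
    using box_test_functions[OF K] by blast
  define k where "k x = indicator (clbox N a b) x * h x" for x
  have k: "integrable M k"
    using h K compactin_clbox unfolding loc_integrable_def set_integrable_def k_def by auto
  note [measurable] = borel_measurable_integrable[OF k] indicator_borel_M[OF obox_sets[of N a b]]
  have *: "indicator (obox N a b) x * h x = k x * indicator (obox N a b) x" for x
    using obox_subset_clbox[of N a b] by (auto simp: k_def indicator_def)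
  show "integrable M (\<lambda>x. indicator (obox N a b) x * h x)"
    unfolding *
  proof (rule Bochner_Integration.integrable_bound[OF k])
    show "(\<lambda>x. k x * indicator (obox N a b) x) \<in> borel_measurable M" by measurable
  qed (auto simp: indicator_def)
  have \<phi>k: "h x * \<phi> n x = k x * \<phi> n x" if "x \<in> \<Omega>" for x n
    using \<phi>(2)[of x n] that \<Omega>_subset by (cases "x \<in> clbox N a b") (auto simp: k_def)
  have m\<phi>: "\<phi> n \<in> borel_measurable M" for n
    using \<phi>(1) by (intro borel_M_of_continuous smoothN_cont) (simp add: Cc_smooth_alt)
  have "(\<lambda>n. LINT x|M. h x * \<phi> n x) \<longlonglongrightarrow> (LINT x|M. k x * indicator (obox N a b) x)"
  proof (rule integral_dominated_convergence[where w = "\<lambda>x. \<bar>k x\<bar>"])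
    show "(\<lambda>x. h x * \<phi> n x) \<in> borel_measurable M" for n
    proof -
      have "(\<lambda>x. k x * \<phi> n x) \<in> borel_measurable M" using m\<phi> by measurable
      then show ?thesis by (subst measurable_cong[of _ _ "\<lambda>x. k x * \<phi> n x"]) (auto simp: \<phi>k)
    qed
    show "AE x in M. (\<lambda>n. h x * \<phi> n x) \<longlonglongrightarrow> k x * indicator (obox N a b) x"
    proof (rule AE_I2)
      fix x assume "x \<in> space M"
      then have x: "x \<in> \<Omega>" by simp
      then have "(\<lambda>n. k x * \<phi> n x) \<longlonglongrightarrow> k x * indicator (obox N a b) x"
        using \<Omega>_subset by (intro tendsto_mult_left \<phi>(3)) auto
      then show "(\<lambda>n. h x * \<phi> n x) \<longlonglongrightarrow> k x * indicator (obox N a b) x" by (simp only: \<phi>k[OF x])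
    qed
    show "AE x in M. norm (h x * \<phi> n x) \<le> \<bar>k x\<bar>" for n
    proof (rule AE_I2)
      fix x assume "x \<in> space M"
      then have x: "x \<in> \<Omega>" by simp
      have "x \<in> topspace (RN N)" using x \<Omega>_subset by blast
      then have "0 \<le> \<phi> n x" "\<phi> n x \<le> indicator (clbox N a b) x" using \<phi>(2)[of x n] by blast+
      moreover have "indicator (clbox N a b) x \<le> (1::real)" by (rule indicator_le_1)
      ultimately have "\<bar>\<phi> n x\<bar> \<le> 1" by linarith
      then have "\<bar>k x\<bar> * \<bar>\<phi> n x\<bar> \<le> \<bar>k x\<bar> * 1" by (intro mult_left_mono) auto
      then show "norm (h x * \<phi> n x) \<le> \<bar>k x\<bar>" unfolding \<phi>k[OF x] real_norm_def abs_mult by simp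
    qed
  qed (use k in auto)
  moreover have "(LINT x|M. h x * \<phi> n x) = 0" for n using z[OF \<phi>(1)] .
  ultimately have "(\<lambda>n::nat. 0::real) \<longlonglongrightarrow> (LINT x|M. k x * indicator (obox N a b) x)" by simp
  then have "(LINT x|M. k x * indicator (obox N a b) x) = 0"
    by (rule LIMSEQ_unique) (rule tendsto_const)
  then show "(LINT x|M. indicator (obox N a b) x * h x) = 0" unfolding * .
qed

lemma AE_M_of_PN:
  assumes "AE x in PN N. P x" shows "AE x in M. P x"
proof -
  have "AE x in completion (PN N). x \<in> \<Omega> \<longrightarrow> P x"
    using AE_completion[OF assms] by (rule AE_mp) auto
  then show ?thesis unfolding leb_on_def by (subst AE_restrict_space_iff[OF sets_leb_on[OF open_\<Omega>]])
qed

text \<open>The measure is completed, while the generating argument lives on the Borel sets; the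
function is therefore exchanged for a Borel representative first.\<close>

lemma vanishes_on_box:
  assumes h: "loc_integrable N \<Omega> h" and z: "\<And>\<phi>. Cc_smooth N \<Omega> \<phi> \<Longrightarrow> (LINT x|M. h x * \<phi> x) = 0"
    and K: "clbox N a b \<subseteq> \<Omega>"
  shows "AE x in M. x \<in> obox N a b \<longrightarrow> h x = 0"
proof -
  define k where "k x = indicator (obox N a b) x * h x" for x
  have O: "obox N a b \<subseteq> \<Omega>" using K obox_subset_clbox by blast
  have k\<Omega>: "indicator \<Omega> x *\<^sub>R k x = k x" for x using O by (auto simp: k_def indicator_def)
  have k: "integrable (completion (PN N)) k"
    using box_integral_zero(1)[OF h z K] 
    unfolding leb_on_def integrable_restrict_space[OF sets_leb_on[OF open_\<Omega>]] k_def[symmetric] k\<Omega> .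
  have kint: "(LINT x|M. f x * k x) = (LINT x|completion (PN N). f x * k x)" for f
  proof -
    have "(LINT x|M. f x * k x) = (LINT x|completion (PN N). indicator \<Omega> x *\<^sub>R (f x * k x))"
      unfolding leb_on_def by (rule integral_restrict_space[OF sets_leb_on[OF open_\<Omega>]])
    also have "(\<lambda>x. indicator \<Omega> x *\<^sub>R (f x * k x)) = (\<lambda>x. f x * k x)"
      using k\<Omega> by (auto simp: algebra_simps)
    finally show ?thesis .
  qed
  obtain k' where k'[measurable]: "k' \<in> borel_measurable (PN N)" and kk': "AE x in PN N. k x = k' x"
    using completion_ex_borel_measurable_real[OF borel_measurable_integrable[OF k]] by blast
  have kk'c: "AE x in completion (PN N). k x = k' x" by (rule AE_completion[OF kk'])
  have "integrable (completion (PN N)) k'"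
    by (rule integrable_cong_AE_imp[OF k]) (use kk'c in \<open>auto intro: measurable_completion\<close>)
  then have k'i: "integrable (PN N) k'" by (simp add: integrable_completion)
  have tr: "(LINT x|M. f x * k x) = (LINT x|PN N. f x * k' x)" if f[measurable]: "f \<in> borel_measurable (PN N)" for f
  proof -
    have "(LINT x|completion (PN N). f x * k x) = (LINT x|completion (PN N). f x * k' x)"
    proof (rule integral_cong_AE)
      have [measurable]: "f \<in> borel_measurable (completion (PN N))" "k' \<in> borel_measurable (completion (PN N))"
        using f k' by (simp_all add: measurable_completion)
      note [measurable] = borel_measurable_integrable[OF k]
      show "(\<lambda>x. f x * k x) \<in> borel_measurable (completion (PN N))" by measurable
      show "(\<lambda>x. f x * k' x) \<in> borel_measurable (completion (PN N))" by measurable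
      show "AE x in completion (PN N). f x * k x = f x * k' x" using kk'c by eventually_elim simp
    qed
    then show ?thesis unfolding kint by (simp add: integral_completion)
  qed
  have "AE x in PN N. k' x = 0"
  proof (rule null_integrals_on_orthants[OF k'i])
    show "(LINT x|PN N. k' x) = 0" 
      using tr[of "\<lambda>_. 1"] box_integral_zero(2)[OF h z K] by (simp add: k_def)
    fix d :: rvec
    let ?A = "\<Pi>\<^sub>E i\<in>{..<N}. {..<d i}"
    have A: "?A \<in> sets (PN N)" by (intro sets_PiM_I_finite) auto
    have "(LINT x|PN N. indicator ?A x * k' x) = (LINT x|M. indicator ?A x * k x)"
      using A by (intro tr[symmetric]) simp
    moreover have "(\<lambda>x. indicator ?A x * k x) = (\<lambda>x. indicator (obox N a (\<lambda>i. min (b i) (d i))) x * h x)"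
    proof -
      have "{..<d i} \<inter> {a i<..<b i} = {a i<..<min (b i) (d i)}" for i by auto
      then have "obox N a (\<lambda>i. min (b i) (d i)) = ?A \<inter> obox N a b"
        unfolding obox_def PiE_Int by simp
      then show ?thesis by (simp add: k_def indicator_inter_arith mult.assoc)
    qed
    moreover have "(LINT x|M. indicator (obox N a (\<lambda>i. min (b i) (d i))) x * h x) = 0"
    proof (rule box_integral_zero(2)[OF h z])
      have "clbox N a (\<lambda>i. min (b i) (d i)) \<subseteq> clbox N a b" unfolding clbox_def by (intro PiE_mono) auto
      then show "clbox N a (\<lambda>i. min (b i) (d i)) \<subseteq> \<Omega>" using K by blast
    qed
    ultimately show "(LINT x:?A|PN N. k' x) = 0"
      unfolding set_lebesgue_integral_def real_scaleR_def by (simp only:)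
  qed
  with kk' have "AE x in PN N. k x = 0" by eventually_elim simp
  from AE_M_of_PN[OF this] show ?thesis by eventually_elim (auto simp: k_def)
qed

text \<open>Countably many boxes cover the set, and the function vanishes almost everywhere on each.\<close>

theorem fundamental_lemma:
  assumes h: "loc_integrable N \<Omega> h" and z: "\<And>\<phi>. Cc_smooth N \<Omega> \<phi> \<Longrightarrow> (LINT x|M. h x * \<phi> x) = 0"
  shows "AE x in M. h x = 0"
proof -
  obtain C where C: "countable C" "\<forall>(a,b)\<in>C. clbox N a b \<subseteq> \<Omega>" "\<Omega> = (\<Union>(a,b)\<in>C. obox N a b)"
    using open_rational_boxes[OF open_\<Omega>] by (elim exE conjE) (rule that)
  have "AE x in M. \<forall>c\<in>C. x \<in> obox N (fst c) (snd c) \<longrightarrow> h x = 0"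
  proof (rule AE_ball_countable[OF C(1), THEN iffD2], rule ballI)
    fix c assume "c \<in> C"
    then have "clbox N (fst c) (snd c) \<subseteq> \<Omega>" using C(2) by (simp add: case_prod_beta)
    with h z show "AE x in M. x \<in> obox N (fst c) (snd c) \<longrightarrow> h x = 0"
      by (rule vanishes_on_box)
  qed
  moreover have "AE x in M. x \<in> \<Omega>" by (rule AE_I2) simp
  ultimately show ?thesis
  proof eventually_elim
    case (elim x)
    then have "x \<in> (\<Union>(a,b)\<in>C. obox N a b)" by (subst C(3)[symmetric])
    then obtain c where "c \<in> C" "x \<in> obox N (fst c) (snd c)" by (auto simp: case_prod_beta)
    then show ?case using bspec[OF elim(1) \<open>c \<in> C\<close>] by simp
  qed
qed

end

section \<open>Weak gradients\<close>

context open_domain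
begin

lemma integrable_bounded_continuous:
  assumes "continuous_map (RN N) euclideanreal f" "\<And>x. x \<in> topspace (RN N) \<Longrightarrow> \<bar>f x\<bar> \<le> B"
  shows "integrable M f"
proof (rule integrable_const_bound)
  show "AE x in M. norm (f x) \<le> B"
  proof (rule AE_I2)
    fix x assume "x \<in> space M"
    then have "x \<in> topspace (RN N)" using \<Omega>_subset by auto
    then show "norm (f x) \<le> B" using assms(2) by simp
  qed
qed (rule borel_M_of_continuous[OF assms(1)])

lemma domain_in_box: "\<exists>B>0. \<Omega> \<subseteq> clbox N (\<lambda>_. - B) (\<lambda>_. B)"
proof -
  obtain B where B: "\<And>x. x \<in> \<Omega> \<Longrightarrow> normN N x \<le> B"
    using open_bounded unfolding open_bounded_def by auto
  have "\<Omega> \<subseteq> clbox N (\<lambda>_. - max B 1) (\<lambda>_. max B 1)"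
    by (rule bounded_subset_clbox[OF \<Omega>_subset]) (use B in \<open>simp add: le_max_iff_disj\<close>)
  then show ?thesis by (intro exI[of _ "max B 1"]) simp
qed

text \<open>Fubini's theorem reduces the claim to the lines parallel to one axis, on which the
integral of the derivative is a difference of two values outside the support.\<close>

lemma integral_pdiff_zero:
  assumes i: "i < N" and z: "csupp N \<Omega> \<zeta>" and pd: "pdiff N i \<zeta> \<zeta>'"
    and cont: "continuous_map (RN N) euclideanreal \<zeta>'"
  shows "(LINT x|M. \<zeta>' x) = 0"
proof -
  have z': "csupp N \<Omega> \<zeta>'" by (rule csupp_pdiff[OF z pd i])
  obtain B where B: "B > 0" "\<Omega> \<subseteq> clbox N (\<lambda>_. - B) (\<lambda>_. B)" using domain_in_box by blast
  let ?Q = "clbox N (\<lambda>_. - B) (\<lambda>_. B)"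
  obtain D where D: "D > 0" "\<And>x. x \<in> topspace (RN N) \<Longrightarrow> \<bar>\<zeta>' x\<bar> \<le> D"
    using csupp_bounded[OF z' cont] by blast
  have out: "\<zeta> x = 0" "\<zeta>' x = 0" if "x \<in> topspace (RN N)" "x \<notin> ?Q" for x
    using that B(2) csupp_zero_outside[OF z, of x] csupp_zero_outside[OF z', of x] by auto
  have int: "integrable (PN N) \<zeta>'"
  proof (rule Bochner_Integration.integrable_bound)
    show "integrable (PN N) (\<lambda>x. D * indicator ?Q x)"
      using emeasure_clbox clbox_sets by (intro integrable_mult_right integrable_real_indicator) auto
    show "\<zeta>' \<in> borel_measurable (PN N)" by (rule continuous_borel_PN[OF cont])
    show "AE x in PN N. norm (\<zeta>' x) \<le> norm (D * indicator ?Q x)"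
    proof (rule AE_I2)
      fix x assume "x \<in> space (PN N)"
      then have x: "x \<in> topspace (RN N)" by (simp only: space_PN)
      show "norm (\<zeta>' x) \<le> norm (D * indicator ?Q x)"
        using D(1) D(2)[OF x] out(2)[OF x] by (cases "x \<in> ?Q") auto
    qed
  qed
  interpret product_sigma_finite "\<lambda>i::nat. lborel :: real measure" by (rule product_sigma_finite_lborel)
  let ?J = "{..<N} - {i}"
  have ins: "{..<N} = insert i ?J" using i by auto
  have "(LINT x|M. \<zeta>' x) = (LINT x|PN N. \<zeta>' x)"
    using csupp_zero_outside[OF z'] by (intro integral_leb_on_PN open_\<Omega> continuous_borel_PN cont)
  also have "\<dots> = (LINT x|Pi\<^sub>M (insert i ?J) (\<lambda>_. lborel). \<zeta>' x)" by (simp only: ins[symmetric])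
  also have "\<dots> = (LINT x|Pi\<^sub>M ?J (\<lambda>_. lborel). LINT t|lborel. \<zeta>' (x(i := t)))"
    by (rule product_integral_insert) (use int ins in \<open>simp_all add: insert_absorb\<close>)
  also have "\<dots> = (LINT x|Pi\<^sub>M ?J (\<lambda>_. lborel :: real measure). 0)"
  proof (rule Bochner_Integration.integral_cong[OF refl])
    fix x :: rvec assume "x \<in> space (Pi\<^sub>M ?J (\<lambda>_. lborel))"
    then have x: "x \<in> extensional ?J" by (simp add: space_PiM PiE_iff)
    define y where "y = x(i := 0)"
    have y: "y \<in> topspace (RN N)" using x i by (auto simp: y_def PiE_iff extensional_def)
    have xy: "x(i := t) = y(i := t)" for t by (simp add: y_def)
    have top: "y(i := t) \<in> topspace (RN N)" for t by (rule in_topspace_upd[OF y i])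
    have outt: "\<bar>t\<bar> > B \<Longrightarrow> y(i := t) \<notin> ?Q" for t
      using i by (auto simp: clbox_def PiE_iff intro!: bexI[of _ i])
    have "(LINT t|lborel. \<zeta>' (y(i := t))) = (LINT t|lborel. \<zeta>' (y(i := t)) * indicator {-(B+1)..B+1} t)"
    proof (rule Bochner_Integration.integral_cong[OF refl])
      fix t :: real
      show "\<zeta>' (y(i := t)) = \<zeta>' (y(i := t)) * indicator {-(B+1)..B+1} t"
      proof (cases "\<bar>t\<bar> > B")
        case True then show ?thesis using out(2)[OF top outt[OF True]] by simp
      next
        case False
        then have "t \<in> {-(B+1)..B+1}" by auto
        then show ?thesis by simp
      qed
    qed
    also have "\<dots> = \<zeta> (y(i := B+1)) - \<zeta> (y(i := -(B+1)))"
    proof (rule integral_FTC_Icc_real)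
      show "- (B+1) \<le> B+1" using B by simp
      fix t :: real
      have "((\<lambda>s. \<zeta> ((y(i := t))(i := s))) has_real_derivative \<zeta>' (y(i := t))) (at ((y(i := t)) i))"
        using pd top[of t] unfolding pdiff_def by blast
      then show "((\<lambda>s. \<zeta> (y(i := s))) has_real_derivative \<zeta>' (y(i := t))) (at t)" by simp
      have "continuous_map euclideanreal euclideanreal (\<zeta>' \<circ> (\<lambda>t. y(i := t)))"
        by (rule continuous_map_compose[OF continuous_map_line[OF y i] cont])
      then show "isCont (\<lambda>t. \<zeta>' (y(i := t))) t" by (simp add: comp_def continuous_on_eq_continuous_at)
    qed
    also have "\<dots> = 0"
      using out(1)[OF top outt[of "B+1"]] out(1)[OF top outt[of "-(B+1)"]] B(1) by simp
    finally show "(LINT t|lborel. \<zeta>' (x(i := t))) = 0" by (simp only: xy)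
  qed
  finally show ?thesis by simp
qed

lemma compact_sets_PN:
  assumes "compactin (RN N) K" shows "K \<in> sets (PN N)"
proof -
  have "closedin (RN N) K" by (rule compactin_imp_closedin[OF Hausdorff_RN assms])
  then have K: "openin (RN N) (topspace (RN N) - K)" "K \<subseteq> topspace (RN N)"
    by (auto simp: closedin_def)
  have "space (PN N) - (topspace (RN N) - K) \<in> sets (PN N)"
    by (rule sets.compl_sets[OF open_in_sets_PN[OF K(1)]])
  moreover have "space (PN N) - (topspace (RN N) - K) = K" using K(2) by (simp only: space_PN double_diff[OF K(2) subset_refl])
  ultimately show ?thesis by simp
qed

lemma integrable_imp_loc_integrable:
  assumes "integrable M f" shows "loc_integrable N \<Omega> f"
  unfolding loc_integrable_def set_integrable_def
proof (intro allI impI)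
  fix K assume K: "compactin (RN N) K \<and> K \<subseteq> \<Omega>"
  then have "K \<inter> \<Omega> \<in> sets M" by (intro sets_PN_M compact_sets_PN) simp
  moreover have "K \<inter> \<Omega> = K" using K by blast
  ultimately show "integrable M (\<lambda>x. indicator K x *\<^sub>R f x)"
    using assms by (intro integrable_mult_indicator) simp_all
qed

lemma loc_integrable_times_test:
  assumes u: "loc_integrable N \<Omega> u" and c: "continuous_map (RN N) euclideanreal \<phi>" "csupp N \<Omega> \<phi>"
  shows "integrable M (\<lambda>x. u x * \<phi> x)"
proof -
  obtain K where K: "compactin (RN N) K" "K \<subseteq> \<Omega>" "\<forall>x\<in>topspace (RN N) - K. \<phi> x = 0"
    using c(2) unfolding csupp_def by blast
  obtain B where B: "B > 0" "\<forall>x\<in>topspace (RN N). \<bar>\<phi> x\<bar> \<le> B" using csupp_bounded[OF c(2,1)] by blast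
  define k where "k x = indicator K x * u x" for x
  have k: "integrable M k"
    using u K(1,2) unfolding loc_integrable_def set_integrable_def k_def by simp
  have m: "\<phi> \<in> borel_measurable M" by (rule borel_M_of_continuous[OF c(1)])
  have "integrable M (\<lambda>x. k x * \<phi> x)"
  proof (rule Bochner_Integration.integrable_bound)
    show "integrable M (\<lambda>x. B * \<bar>k x\<bar>)" using k by simp
    show "(\<lambda>x. k x * \<phi> x) \<in> borel_measurable M"
      using m borel_measurable_integrable[OF k] by simp
    show "AE x in M. norm (k x * \<phi> x) \<le> norm (B * \<bar>k x\<bar>)"
    proof (rule AE_I2)
      fix x assume "x \<in> space M"
      then have "\<bar>\<phi> x\<bar> \<le> B" using B(2) \<Omega>_subset by auto
      then have "\<bar>\<phi> x\<bar> * \<bar>k x\<bar> \<le> B * \<bar>k x\<bar>" by (rule mult_right_mono) simp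
      then show "norm (k x * \<phi> x) \<le> norm (B * \<bar>k x\<bar>)" using B(1) by (simp add: abs_mult mult.commute)
    qed
  qed
  moreover have "k x * \<phi> x = u x * \<phi> x" if "x \<in> space M" for x
  proof (cases "x \<in> K")
    case False
    then have "\<phi> x = 0" using K(3) that \<Omega>_subset by auto
    then show ?thesis by simp
  qed (simp add: k_def)
  ultimately show ?thesis using Bochner_Integration.integrable_cong[OF refl, of M "\<lambda>x. k x * \<phi> x" "\<lambda>x. u x * \<phi> x"] by simp
qed

lemma Cc_smooth_test:
  assumes "Cc_smooth N \<Omega> \<phi>"
  shows "continuous_map (RN N) euclideanreal \<phi>" "csupp N \<Omega> \<phi>"
    and "i < N \<Longrightarrow> pdiff N i \<phi> (pd i \<phi>)" "i < N \<Longrightarrow> continuous_map (RN N) euclideanreal (pd i \<phi>)"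
    and "i < N \<Longrightarrow> csupp N \<Omega> (pd i \<phi>)"
proof -
  have s: "smoothN N \<phi>" and c: "csupp N \<Omega> \<phi>" using assms by (auto simp: Cc_smooth_alt)
  show "csupp N \<Omega> \<phi>" by (rule c)
  show "continuous_map (RN N) euclideanreal \<phi>" by (rule smoothN_cont[OF s])
  show "i < N \<Longrightarrow> pdiff N i \<phi> (pd i \<phi>)" by (rule smoothN_pdiff[OF s])
  then show "i < N \<Longrightarrow> csupp N \<Omega> (pd i \<phi>)" using csupp_pdiff[OF c] by blast
  show "i < N \<Longrightarrow> continuous_map (RN N) euclideanreal (pd i \<phi>)" by (rule smoothN_pd_cont[OF s])
qed

lemma Cc_smooth_bounded:
  assumes "Cc_smooth N \<Omega> \<phi>"
  shows "\<exists>B>0. \<forall>x\<in>topspace (RN N). \<bar>\<phi> x\<bar> \<le> B \<and> (\<forall>i<N. \<bar>pd i \<phi> x\<bar> \<le> B)"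
proof -
  obtain B0 where B0: "B0 > 0" "\<forall>x\<in>topspace (RN N). \<bar>\<phi> x\<bar> \<le> B0"
    using csupp_bounded[OF Cc_smooth_test(2,1)[OF assms]] by blast
  have "\<forall>i. \<exists>B. i < N \<longrightarrow> B > 0 \<and> (\<forall>x\<in>topspace (RN N). \<bar>pd i \<phi> x\<bar> \<le> B)"
    using csupp_bounded[OF Cc_smooth_test(5,4)[OF assms]] by blast
  then obtain B where B: "\<And>i. i < N \<Longrightarrow> B i > 0" "\<And>i x. i < N \<Longrightarrow> x \<in> topspace (RN N) \<Longrightarrow> \<bar>pd i \<phi> x\<bar> \<le> B i"
    by metis
  have s0: "0 \<le> (\<Sum>i<N. B i)" by (intro sum_nonneg) (use B(1) in \<open>simp add: less_imp_le\<close>)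
  have sB: "B i \<le> (\<Sum>i<N. B i)" if "i < N" for i
    using that B(1) by (intro member_le_sum) (auto simp: less_imp_le)
  show ?thesis
  proof (intro exI[of _ "B0 + (\<Sum>i<N. B i)"] conjI ballI allI impI)
    show "0 < B0 + (\<Sum>i<N. B i)" using B0 s0 by simp
    fix x assume x: "x \<in> topspace (RN N)"
    show "\<bar>\<phi> x\<bar> \<le> B0 + (\<Sum>i<N. B i)" using B0(2) x s0 by fastforce
    fix i assume i: "i < N"
    show "\<bar>pd i \<phi> x\<bar> \<le> B0 + (\<Sum>i<N. B i)" using B(2)[OF i x] sB[OF i] B0(1) by linarith
  qed
qed

text \<open>The product with a test function has compact support even if the function itself has
not, so the integral of its derivative vanishes. One continuous derivative suffices, which covers
the composition of a test function with psi.\<close>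

lemma has_weak_grad_classical:
  assumes c: "continuous_map (RN N) euclideanreal \<zeta>" "\<And>x. x \<in> topspace (RN N) \<Longrightarrow> \<bar>\<zeta> x\<bar> \<le> B"
    and g: "\<And>i. i < N \<Longrightarrow> pdiff N i \<zeta> (\<lambda>x. g x i)"
      "\<And>i. i < N \<Longrightarrow> continuous_map (RN N) euclideanreal (\<lambda>x. g x i)"
      "\<And>i x. i < N \<Longrightarrow> x \<in> topspace (RN N) \<Longrightarrow> \<bar>g x i\<bar> \<le> B"
  shows "has_weak_grad N \<Omega> \<zeta> g"
  unfolding has_weak_grad_def
proof (intro conjI allI impI)
  show li: "loc_integrable N \<Omega> \<zeta>"
    by (rule integrable_imp_loc_integrable[OF integrable_bounded_continuous[OF c]])
  show lg: "loc_integrable N \<Omega> (\<lambda>x. g x i)" if "i < N" for i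
    by (rule integrable_imp_loc_integrable[OF integrable_bounded_continuous[OF g(2,3)[OF that]]])
  fix \<phi> i assume \<phi>: "Cc_smooth N \<Omega> \<phi>" and i: "i < N"
  note t = Cc_smooth_test[OF \<phi>]
  have int: "integrable M (\<lambda>x. g x i * \<phi> x)" "integrable M (\<lambda>x. \<zeta> x * pd i \<phi> x)"
    by (rule loc_integrable_times_test[OF lg[OF i] t(1,2)]) (rule loc_integrable_times_test[OF li t(4,5)[OF i]])
  have "(LINT x|M. g x i * \<phi> x + \<zeta> x * pd i \<phi> x) = 0"
  proof (rule integral_pdiff_zero[OF i])
    show "csupp N \<Omega> (\<lambda>x. \<zeta> x * \<phi> x)" by (rule csupp_null[OF t(2)]) simp
    show "continuous_map (RN N) euclideanreal (\<lambda>x. g x i * \<phi> x + \<zeta> x * pd i \<phi> x)"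
      by (intro continuous_map_add continuous_map_real_mult c(1) g(2) t(1) t(4) i)
    show "pdiff N i (\<lambda>x. \<zeta> x * \<phi> x) (\<lambda>x. g x i * \<phi> x + \<zeta> x * pd i \<phi> x)"
      unfolding pdiff_def
    proof
      fix x assume x: "x \<in> topspace (RN N)"
      have "((\<lambda>t. \<zeta> (x(i := t)) * \<phi> (x(i := t))) has_real_derivative
          g x i * \<phi> (x(i := x i)) + pd i \<phi> x * \<zeta> (x(i := x i))) (at (x i))"
        using g(1)[OF i] t(3)[OF i] x unfolding pdiff_def by (intro DERIV_mult) auto
      then show "((\<lambda>t. \<zeta> (x(i := t)) * \<phi> (x(i := t))) has_real_derivative
          g x i * \<phi> x + \<zeta> x * pd i \<phi> x) (at (x i))" by (simp add: mult.commute)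
    qed
  qed
  then show "(LINT x|M. \<zeta> x * pd i \<phi> x) = - (LINT x|M. g x i * \<phi> x)"
    using int by simp
qed

lemma has_weak_grad_Cc_smooth:
  assumes "Cc_smooth N \<Omega> \<phi>" shows "has_weak_grad N \<Omega> \<phi> (\<lambda>x i. pd i \<phi> x)"
proof -
  obtain B where "\<forall>x\<in>topspace (RN N). \<bar>\<phi> x\<bar> \<le> B \<and> (\<forall>i<N. \<bar>pd i \<phi> x\<bar> \<le> B)"
    using Cc_smooth_bounded[OF assms] by blast
  then show ?thesis
    by (intro has_weak_grad_classical[of _ B] Cc_smooth_test[OF assms]) auto
qed

text \<open>A consequence of the fundamental lemma. It makes the chosen representative
\<^const>\<open>weak_grad\<close> interchangeable with any explicitly computed gradient.\<close>

lemma weak_grad_unique: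
  assumes g: "has_weak_grad N \<Omega> u g" and h: "has_weak_grad N \<Omega> v h" and uv: "AE x in M. u x = v x"
  shows "AE x in M. \<forall>i<N. g x i = h x i"
proof -
  have "AE x in M. g x i - h x i = 0" if i: "i < N" for i
  proof (rule fundamental_lemma)
    have lg: "loc_integrable N \<Omega> (\<lambda>x. g x i)" and lh: "loc_integrable N \<Omega> (\<lambda>x. h x i)"
      and lu: "loc_integrable N \<Omega> u" and lv: "loc_integrable N \<Omega> v"
      using g h i by (auto simp: has_weak_grad_def)
    show "loc_integrable N \<Omega> (\<lambda>x. g x i - h x i)"
      unfolding loc_integrable_def
    proof (intro allI impI)
      fix K assume "compactin (RN N) K \<and> K \<subseteq> \<Omega>"
      then have "set_integrable M K (\<lambda>x. g x i)" "set_integrable M K (\<lambda>x. h x i)"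
        using lg lh unfolding loc_integrable_def by simp_all
      then show "set_integrable M K (\<lambda>x. g x i - h x i)" by (rule set_integral_diff(1))
    qed
    fix \<phi> assume \<phi>: "Cc_smooth N \<Omega> \<phi>"
    note t = Cc_smooth_test[OF \<phi>]
    have ig: "integrable M (\<lambda>x. g x i * \<phi> x)" and ih: "integrable M (\<lambda>x. h x i * \<phi> x)"
      by (rule loc_integrable_times_test[OF lg t(1,2)]) (rule loc_integrable_times_test[OF lh t(1,2)])
    have iu: "integrable M (\<lambda>x. u x * pd i \<phi> x)" and iv: "integrable M (\<lambda>x. v x * pd i \<phi> x)"
      by (rule loc_integrable_times_test[OF lu t(4,5)[OF i]]) (rule loc_integrable_times_test[OF lv t(4,5)[OF i]])
    have "(LINT x|M. (g x i - h x i) * \<phi> x) = (LINT x|M. g x i * \<phi> x) - (LINT x|M. h x i * \<phi> x)"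
      using ig ih by (simp add: left_diff_distrib)
    also have "\<dots> = (LINT x|M. v x * pd i \<phi> x) - (LINT x|M. u x * pd i \<phi> x)"
      using g h \<phi> i unfolding has_weak_grad_def by simp
    also have "(LINT x|M. v x * pd i \<phi> x) = (LINT x|M. u x * pd i \<phi> x)"
      by (rule integral_cong_AE[OF borel_measurable_integrable[OF iv] borel_measurable_integrable[OF iu]])
        (use uv in eventually_elim, simp)
    finally show "(LINT x|M. (g x i - h x i) * \<phi> x) = 0" by simp
  qed
  then have "AE x in M. \<forall>i\<in>{..<N}. g x i - h x i = 0"
    by (intro AE_finite_allI) auto
  then show ?thesis by eventually_elim simp
qed

lemma weak_grad_eq:
  assumes "has_weak_grad N \<Omega> u g"
  shows "AE x in M. \<forall>i<N. weak_grad N \<Omega> u x i = g x i"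
proof -
  have "has_weak_grad N \<Omega> u (weak_grad N \<Omega> u)"
    unfolding weak_grad_def by (rule someI[of _ g]) (rule assms)
  from weak_grad_unique[OF this assms] show ?thesis by simp
qed

lemma loc_integrable_add: "loc_integrable N \<Omega> u \<Longrightarrow> loc_integrable N \<Omega> v \<Longrightarrow> loc_integrable N \<Omega> (\<lambda>x. u x + v x)"
  unfolding loc_integrable_def by (intro allI impI set_integral_add(1)) simp_all

lemma loc_integrable_cmult: "loc_integrable N \<Omega> u \<Longrightarrow> loc_integrable N \<Omega> (\<lambda>x. c * u x)"
  unfolding loc_integrable_def by simp

lemma has_weak_grad_lincomb:
  assumes g: "has_weak_grad N \<Omega> u g" and h: "has_weak_grad N \<Omega> v h"
  shows "has_weak_grad N \<Omega> (\<lambda>x. a * u x + b * v x) (\<lambda>x i. a * g x i + b * h x i)"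
  unfolding has_weak_grad_def
proof (intro conjI allI impI)
  have lg: "loc_integrable N \<Omega> (\<lambda>x. g x i)" and lh: "loc_integrable N \<Omega> (\<lambda>x. h x i)" if "i < N" for i
    using g h that by (auto simp: has_weak_grad_def)
  have lu: "loc_integrable N \<Omega> u" and lv: "loc_integrable N \<Omega> v"
    using g h by (auto simp: has_weak_grad_def)
  show "loc_integrable N \<Omega> (\<lambda>x. a * u x + b * v x)"
    by (intro loc_integrable_add loc_integrable_cmult lu lv)
  show "loc_integrable N \<Omega> (\<lambda>x. a * g x i + b * h x i)" if "i < N" for i
    by (intro loc_integrable_add loc_integrable_cmult lg lh that)
  fix \<phi> i assume \<phi>: "Cc_smooth N \<Omega> \<phi>" and i: "i < N"
  note t = Cc_smooth_test[OF \<phi>]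
  have ig: "integrable M (\<lambda>x. g x i * \<phi> x)" and ih: "integrable M (\<lambda>x. h x i * \<phi> x)"
    by (rule loc_integrable_times_test[OF lg[OF i] t(1,2)]) (rule loc_integrable_times_test[OF lh[OF i] t(1,2)])
  have iu: "integrable M (\<lambda>x. u x * pd i \<phi> x)" and iv: "integrable M (\<lambda>x. v x * pd i \<phi> x)"
    by (rule loc_integrable_times_test[OF lu t(4,5)[OF i]]) (rule loc_integrable_times_test[OF lv t(4,5)[OF i]])
  have "(LINT x|M. (a * u x + b * v x) * pd i \<phi> x) = (LINT x|M. a * (u x * pd i \<phi> x) + b * (v x * pd i \<phi> x))"
    by (simp add: algebra_simps)
  also have "\<dots> = a * (LINT x|M. u x * pd i \<phi> x) + b * (LINT x|M. v x * pd i \<phi> x)"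
    using iu iv by simp
  also have "\<dots> = - (a * (LINT x|M. g x i * \<phi> x) + b * (LINT x|M. h x i * \<phi> x))"
    using g h \<phi> i unfolding has_weak_grad_def by simp
  also have "\<dots> = - (LINT x|M. a * (g x i * \<phi> x) + b * (h x i * \<phi> x))"
    using ig ih by simp
  also have "\<dots> = - (LINT x|M. (a * g x i + b * h x i) * \<phi> x)" by (simp add: algebra_simps)
  finally show "(LINT x|M. (a * u x + b * v x) * pd i \<phi> x) = - (LINT x|M. (a * g x i + b * h x i) * \<phi> x)" .
qed

lemma L1_limit_times_bounded:
  assumes f: "\<And>n. integrable M (f n)" "integrable M h" "(\<lambda>n. LINT x|M. \<bar>f n x - h x\<bar>) \<longlonglongrightarrow> 0"
    and c: "continuous_map (RN N) euclideanreal \<phi>" "csupp N \<Omega> \<phi>"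
  shows "(\<lambda>n. LINT x|M. f n x * \<phi> x) \<longlonglongrightarrow> (LINT x|M. h x * \<phi> x)"
proof -
  obtain B where B: "B > 0" "\<forall>x\<in>topspace (RN N). \<bar>\<phi> x\<bar> \<le> B" using csupp_bounded[OF c(2,1)] by blast
  have int: "integrable M (\<lambda>x. f n x * \<phi> x)" "integrable M (\<lambda>x. h x * \<phi> x)" for n
    by (rule loc_integrable_times_test[OF integrable_imp_loc_integrable[OF f(1)] c])
      (rule loc_integrable_times_test[OF integrable_imp_loc_integrable[OF f(2)] c])
  have "\<bar>(LINT x|M. f n x * \<phi> x) - (LINT x|M. h x * \<phi> x)\<bar> \<le> B * (LINT x|M. \<bar>f n x - h x\<bar>)" for n
  proof -
    have "\<bar>(LINT x|M. f n x * \<phi> x) - (LINT x|M. h x * \<phi> x)\<bar> \<le> (LINT x|M. \<bar>f n x * \<phi> x - h x * \<phi> x\<bar>)"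
      unfolding Bochner_Integration.integral_diff[OF int, symmetric] by (rule integral_abs_bound)
    also have "\<dots> \<le> (LINT x|M. B * \<bar>f n x - h x\<bar>)"
    proof (rule integral_mono)
      show "integrable M (\<lambda>x. \<bar>f n x * \<phi> x - h x * \<phi> x\<bar>)" using int by simp
      show "integrable M (\<lambda>x. B * \<bar>f n x - h x\<bar>)" using f(1)[of n] f(2) by simp
      fix x assume "x \<in> space M"
      then have "\<bar>\<phi> x\<bar> \<le> B" using B(2) \<Omega>_subset by auto
      then have "\<bar>\<phi> x\<bar> * \<bar>f n x - h x\<bar> \<le> B * \<bar>f n x - h x\<bar>" by (rule mult_right_mono) simp
      moreover have "\<bar>f n x * \<phi> x - h x * \<phi> x\<bar> = \<bar>\<phi> x\<bar> * \<bar>f n x - h x\<bar>"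
        unfolding abs_mult[symmetric] by (simp add: algebra_simps)
      ultimately show "\<bar>f n x * \<phi> x - h x * \<phi> x\<bar> \<le> B * \<bar>f n x - h x\<bar>" by simp
    qed
    also have "\<dots> = B * (LINT x|M. \<bar>f n x - h x\<bar>)" by (rule integral_mult_right_zero)
    finally show ?thesis .
  qed
  then have "eventually (\<lambda>n. norm ((LINT x|M. f n x * \<phi> x) - (LINT x|M. h x * \<phi> x))
      \<le> B * (LINT x|M. \<bar>f n x - h x\<bar>)) sequentially"
    unfolding real_norm_def by (intro always_eventually allI)
  then have "(\<lambda>n. (LINT x|M. f n x * \<phi> x) - (LINT x|M. h x * \<phi> x)) \<longlonglongrightarrow> 0"
    by (rule Lim_null_comparison) (rule tendsto_mult_right_zero[OF f(3)])
  then show ?thesis by (rule LIM_zero_cancel)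
qed

text \<open>Both sides of the integration by parts formula pass to the limit, as the test function
and its derivatives are bounded.\<close>

lemma has_weak_grad_limit:
  assumes w: "\<And>n. has_weak_grad N \<Omega> (f n) (g n)"
    and f: "\<And>n. integrable M (f n)" "integrable M u" "(\<lambda>n. LINT x|M. \<bar>f n x - u x\<bar>) \<longlonglongrightarrow> 0"
    and g: "\<And>n i. i < N \<Longrightarrow> integrable M (\<lambda>x. g n x i)" "\<And>i. i < N \<Longrightarrow> integrable M (\<lambda>x. h x i)"
      "\<And>i. i < N \<Longrightarrow> (\<lambda>n. LINT x|M. \<bar>g n x i - h x i\<bar>) \<longlonglongrightarrow> 0"
  shows "has_weak_grad N \<Omega> u h"
  unfolding has_weak_grad_def
proof (intro conjI allI impI)
  show "loc_integrable N \<Omega> u" by (rule integrable_imp_loc_integrable[OF f(2)])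
  show "loc_integrable N \<Omega> (\<lambda>x. h x i)" if "i < N" for i by (rule integrable_imp_loc_integrable[OF g(2)[OF that]])
  fix \<phi> i assume \<phi>: "Cc_smooth N \<Omega> \<phi>" and i: "i < N"
  note t = Cc_smooth_test[OF \<phi>]
  have "(\<lambda>n. LINT x|M. f n x * pd i \<phi> x) \<longlonglongrightarrow> (LINT x|M. u x * pd i \<phi> x)"
    by (rule L1_limit_times_bounded[OF f t(4,5)[OF i]])
  moreover have "(\<lambda>n. LINT x|M. g n x i * \<phi> x) \<longlonglongrightarrow> (LINT x|M. h x i * \<phi> x)"
    by (rule L1_limit_times_bounded[OF g(1)[OF i] g(2)[OF i] g(3)[OF i] t(1,2)])
  then have "(\<lambda>n. - (LINT x|M. g n x i * \<phi> x)) \<longlonglongrightarrow> - (LINT x|M. h x i * \<phi> x)"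
    by (rule tendsto_minus)
  moreover have "(LINT x|M. f n x * pd i \<phi> x) = - (LINT x|M. g n x i * \<phi> x)" for n
    using w[of n] \<phi> i unfolding has_weak_grad_def by blast
  ultimately have "(\<lambda>n. - (LINT x|M. g n x i * \<phi> x)) \<longlonglongrightarrow> (LINT x|M. u x * pd i \<phi> x)" by simp
  then show "(LINT x|M. u x * pd i \<phi> x) = - (LINT x|M. h x i * \<phi> x)"
    by (rule LIMSEQ_unique) fact
qed

end

section \<open>Convergence to zero in Lebesgue spaces\<close>

text \<open>Convergence to zero is tracked by the integral of the power itself and not by the norm:
this form is stable under sums and domination without Minkowski's inequality.\<close>

definition Lq_null :: "'a measure \<Rightarrow> real \<Rightarrow> (nat \<Rightarrow> 'a \<Rightarrow> real) \<Rightarrow> bool" where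
  "Lq_null M q f \<longleftrightarrow> (\<forall>n. Lp M q (f n)) \<and> (\<lambda>n. LINT x|M. \<bar>f n x\<bar> powr q) \<longlonglongrightarrow> 0"

lemma inverse_Suc_null: "(\<lambda>n. 1 / real (Suc n)) \<longlonglongrightarrow> 0"
  using LIMSEQ_inverse_real_of_nat by (simp add: inverse_eq_divide)

lemma small_factor:
  fixes B r :: real
  assumes "B \<ge> 0" "r > 0" obtains \<delta> where "\<delta> > 0" "\<delta> * B \<le> r / 2"
proof
  show "r / (2 * (B + 1)) > 0" using assms by simp
  have "r / (2 * (B + 1)) * B \<le> r / (2 * (B + 1)) * (B + 1)"
    using assms by (intro mult_left_mono) simp_all
  also have "\<dots> = r / 2" using assms(1) by (simp add: field_simps)
  finally show "r / (2 * (B + 1)) * B \<le> r / 2" .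
qed

lemma powr_abs_add_le:
  fixes a b q :: real
  assumes "q > 0" shows "\<bar>a + b\<bar> powr q \<le> 2 powr q * (\<bar>a\<bar> powr q + \<bar>b\<bar> powr q)"
proof -
  have "\<bar>a + b\<bar> \<le> 2 * max \<bar>a\<bar> \<bar>b\<bar>" by linarith
  then have "\<bar>a + b\<bar> powr q \<le> (2 * max \<bar>a\<bar> \<bar>b\<bar>) powr q" using assms by (intro powr_mono2) auto
  also have "\<dots> = 2 powr q * max \<bar>a\<bar> \<bar>b\<bar> powr q" by (simp add: powr_mult)
  also have "max \<bar>a\<bar> \<bar>b\<bar> powr q \<le> \<bar>a\<bar> powr q + \<bar>b\<bar> powr q" by (auto simp: max_def)
  finally show ?thesis by simp
qed

lemma Lp_measurable: "Lp M q f \<Longrightarrow> f \<in> borel_measurable M"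
  by (simp add: Lp_def)

lemma Lp_bound:
  assumes "Lp M q g" "f \<in> borel_measurable M" "AE x in M. \<bar>f x\<bar> \<le> \<bar>g x\<bar>" "q > 0"
  shows "Lp M q f" and "(LINT x|M. \<bar>f x\<bar> powr q) \<le> (LINT x|M. \<bar>g x\<bar> powr q)"
proof -
  have g: "integrable M (\<lambda>x. \<bar>g x\<bar> powr q)" using assms(1) by (simp add: Lp_def)
  have le: "AE x in M. \<bar>f x\<bar> powr q \<le> \<bar>g x\<bar> powr q"
    using assms(3) by eventually_elim (use assms(4) in \<open>intro powr_mono2, simp_all\<close>)
  have f: "integrable M (\<lambda>x. \<bar>f x\<bar> powr q)"
  proof (rule Bochner_Integration.integrable_bound[OF g])
    show "(\<lambda>x. \<bar>f x\<bar> powr q) \<in> borel_measurable M" using assms(2) by measurable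
    show "AE x in M. norm (\<bar>f x\<bar> powr q) \<le> norm (\<bar>g x\<bar> powr q)" using le by eventually_elim simp
  qed
  show "Lp M q f" using assms(2) f by (simp add: Lp_def)
  show "(LINT x|M. \<bar>f x\<bar> powr q) \<le> (LINT x|M. \<bar>g x\<bar> powr q)"
    by (rule integral_mono_AE[OF f g le])
qed

lemma Lp_add:
  assumes "Lp M q f" "Lp M q g" "q > 0"
  shows "Lp M q (\<lambda>x. f x + g x)"
    and "(LINT x|M. \<bar>f x + g x\<bar> powr q) \<le> 2 powr q * ((LINT x|M. \<bar>f x\<bar> powr q) + (LINT x|M. \<bar>g x\<bar> powr q))"
proof -
  have i: "integrable M (\<lambda>x. \<bar>f x\<bar> powr q)" "integrable M (\<lambda>x. \<bar>g x\<bar> powr q)"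
    and m[measurable]: "f \<in> borel_measurable M" "g \<in> borel_measurable M"
    using assms by (simp_all add: Lp_def)
  have b: "integrable M (\<lambda>x. 2 powr q * (\<bar>f x\<bar> powr q + \<bar>g x\<bar> powr q))" using i by simp
  have s: "integrable M (\<lambda>x. \<bar>f x + g x\<bar> powr q)"
  proof (rule Bochner_Integration.integrable_bound[OF b])
    show "AE x in M. norm (\<bar>f x + g x\<bar> powr q) \<le> norm (2 powr q * (\<bar>f x\<bar> powr q + \<bar>g x\<bar> powr q))"
    proof (rule AE_I2)
      fix x
      have "0 \<le> 2 powr q * (\<bar>f x\<bar> powr q + \<bar>g x\<bar> powr q)" by simp
      then show "norm (\<bar>f x + g x\<bar> powr q) \<le> norm (2 powr q * (\<bar>f x\<bar> powr q + \<bar>g x\<bar> powr q))"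
        using powr_abs_add_le[OF assms(3), of "f x" "g x"] by (simp only: real_norm_def abs_of_nonneg powr_ge_zero)
    qed
  qed measurable
  then show "Lp M q (\<lambda>x. f x + g x)" by (simp add: Lp_def)
  have "(LINT x|M. \<bar>f x + g x\<bar> powr q) \<le> (LINT x|M. 2 powr q * (\<bar>f x\<bar> powr q + \<bar>g x\<bar> powr q))"
    by (rule integral_mono[OF s b]) (rule powr_abs_add_le[OF assms(3)])
  also have "\<dots> = 2 powr q * ((LINT x|M. \<bar>f x\<bar> powr q) + (LINT x|M. \<bar>g x\<bar> powr q))"
    using i by simp
  finally show "(LINT x|M. \<bar>f x + g x\<bar> powr q) \<le> 2 powr q * ((LINT x|M. \<bar>f x\<bar> powr q) + (LINT x|M. \<bar>g x\<bar> powr q))" .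
qed

lemma Lp_cmult: 
  assumes "Lp M q f" shows "Lp M q (\<lambda>x. c * f x)"
    and "(LINT x|M. \<bar>c * f x\<bar> powr q) = \<bar>c\<bar> powr q * (LINT x|M. \<bar>f x\<bar> powr q)"
  using assms by (auto simp: Lp_def abs_mult powr_mult)

lemma Lp_diff: "Lp M q f \<Longrightarrow> Lp M q g \<Longrightarrow> q > 0 \<Longrightarrow> Lp M q (\<lambda>x. f x - g x)"
  using Lp_add(1)[of M q f "\<lambda>x. -1 * g x"] Lp_cmult(1)[of M q g "-1"] by simp

lemma Lp_zero: "q > 0 \<Longrightarrow> Lp M q (\<lambda>x. 0)"
  by (simp add: Lp_def)

lemma Lp_abs: "Lp M q f \<Longrightarrow> Lp M q (\<lambda>x. \<bar>f x\<bar>)"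
  by (auto simp: Lp_def)

lemma Lp_sum: "finite I \<Longrightarrow> (\<And>i. i \<in> I \<Longrightarrow> Lp M q (f i)) \<Longrightarrow> q > 0 \<Longrightarrow> Lp M q (\<lambda>x. \<Sum>i\<in>I. f i x)"
  by (induction I rule: finite_induct) (simp_all add: Lp_zero Lp_add(1))

lemma (in finite_measure) Lp_const: "Lp M q (\<lambda>x. c)"
  by (simp add: Lp_def)

lemma (in finite_measure) Lp_bounded:
  assumes "f \<in> borel_measurable M" "AE x in M. \<bar>f x\<bar> \<le> c" "q > 0" shows "Lp M q f"
proof (rule Lp_bound(1)[OF Lp_const[of q c] assms(1) _ assms(3)])
  show "AE x in M. \<bar>f x\<bar> \<le> \<bar>c\<bar>" using assms(2) by eventually_elim simp
qed

lemma Lq_null_Lp: "Lq_null M q f \<Longrightarrow> Lp M q (f n)"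
  by (simp add: Lq_null_def)

lemma squeeze_null:
  fixes f g :: "nat \<Rightarrow> real"
  assumes "\<And>n. 0 \<le> f n" "\<And>n. f n \<le> g n" "g \<longlonglongrightarrow> 0" shows "f \<longlonglongrightarrow> 0"
  by (rule tendsto_sandwich[OF _ _ tendsto_const assms(3)]) (simp_all add: assms)

lemma powr_integral_nonneg: "0 \<le> (LINT x|M. \<bar>f x :: real\<bar> powr q)"
  by (rule integral_nonneg_AE) simp

lemma Lq_null_bound:
  assumes "Lq_null M q g" "\<And>n. f n \<in> borel_measurable M" "\<And>n. AE x in M. \<bar>f n x\<bar> \<le> \<bar>g n x\<bar>" "q > 0"
  shows "Lq_null M q f"
  unfolding Lq_null_def
proof (intro conjI allI)
  note b = Lp_bound[OF Lq_null_Lp[OF assms(1)] assms(2) assms(3) assms(4)]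
  show "Lp M q (f n)" for n by (rule b(1))
  have g: "(\<lambda>n. LINT x|M. \<bar>g n x\<bar> powr q) \<longlonglongrightarrow> 0" using assms(1) by (simp add: Lq_null_def)
  show "(\<lambda>n. LINT x|M. \<bar>f n x\<bar> powr q) \<longlonglongrightarrow> 0"
    by (rule squeeze_null[OF powr_integral_nonneg b(2) g])
qed

lemma Lq_null_add:
  assumes "Lq_null M q f" "Lq_null M q g" "q > 0" shows "Lq_null M q (\<lambda>n x. f n x + g n x)"
  unfolding Lq_null_def
proof (intro conjI allI)
  note b = Lp_add[OF Lq_null_Lp[OF assms(1)] Lq_null_Lp[OF assms(2)] assms(3)]
  show "Lp M q (\<lambda>x. f n x + g n x)" for n by (rule b(1))
  have "(\<lambda>n. LINT x|M. \<bar>f n x\<bar> powr q) \<longlonglongrightarrow> 0" "(\<lambda>n. LINT x|M. \<bar>g n x\<bar> powr q) \<longlonglongrightarrow> 0"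
    using assms by (simp_all add: Lq_null_def)
  then have "(\<lambda>n. 2 powr q * ((LINT x|M. \<bar>f n x\<bar> powr q) + (LINT x|M. \<bar>g n x\<bar> powr q))) \<longlonglongrightarrow> 0"
    by (intro tendsto_mult_right_zero tendsto_add_zero)
  then show "(\<lambda>n. LINT x|M. \<bar>f n x + g n x\<bar> powr q) \<longlonglongrightarrow> 0"
    by (rule squeeze_null[OF powr_integral_nonneg b(2)])
qed

lemma Lq_null_cmult:
  assumes "Lq_null M q f" shows "Lq_null M q (\<lambda>n x. c * f n x)"
  unfolding Lq_null_def
proof (intro conjI allI)
  note b = Lp_cmult[OF Lq_null_Lp[OF assms(1)]]
  show "Lp M q (\<lambda>x. c * f n x)" for n by (rule b(1))
  have "(\<lambda>n. LINT x|M. \<bar>f n x\<bar> powr q) \<longlonglongrightarrow> 0"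
    using assms by (simp add: Lq_null_def)
  then show "(\<lambda>n. LINT x|M. \<bar>c * f n x\<bar> powr q) \<longlonglongrightarrow> 0"
    unfolding b(2) by (rule tendsto_mult_right_zero)
qed

lemma Lq_null_zero: "q > 0 \<Longrightarrow> Lq_null M q (\<lambda>n x. 0)"
  by (simp add: Lq_null_def Lp_zero)

lemma Lq_null_abs: "Lq_null M q f \<Longrightarrow> Lq_null M q (\<lambda>n x. \<bar>f n x\<bar>)"
  by (simp add: Lq_null_def Lp_abs)

lemma Lq_null_sum:
  "finite I \<Longrightarrow> (\<And>i. i \<in> I \<Longrightarrow> Lq_null M q (f i)) \<Longrightarrow> q > 0 \<Longrightarrow> Lq_null M q (\<lambda>n x. \<Sum>i\<in>I. f i n x)"
  by (induction I rule: finite_induct) (simp_all add: Lq_null_zero Lq_null_add)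

lemma Lq_null_subseq:
  assumes "Lq_null M q f" "strict_mono r" shows "Lq_null M q (\<lambda>n. f (r n))"
proof -
  have "(\<lambda>n. LINT x|M. \<bar>f n x\<bar> powr q) \<longlonglongrightarrow> 0" using assms by (simp add: Lq_null_def)
  from LIMSEQ_subseq_LIMSEQ[OF this assms(2)] show ?thesis
    using assms(1) by (simp add: Lq_null_def comp_def)
qed

lemma Lq_null_dominated:
  assumes "\<And>n. f n \<in> borel_measurable M" "AE x in M. (\<lambda>n. f n x) \<longlonglongrightarrow> 0"
    "\<And>n. AE x in M. \<bar>f n x\<bar> \<le> \<bar>w x\<bar>" "Lp M q w" "q > 0"
  shows "Lq_null M q f"
  unfolding Lq_null_def
proof (intro conjI allI)
  note [measurable] = assms(1)
  show "Lp M q (f n)" for n by (rule Lp_bound(1)[OF assms(4,1,3,5)])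
  have "(\<lambda>n. LINT x|M. \<bar>f n x\<bar> powr q) \<longlonglongrightarrow> (LINT x|M. 0)"
  proof (rule integral_dominated_convergence[where w = "\<lambda>x. \<bar>w x\<bar> powr q"])
    show "integrable M (\<lambda>x. \<bar>w x\<bar> powr q)" using assms(4) by (simp add: Lp_def)
    show "AE x in M. (\<lambda>n. \<bar>f n x\<bar> powr q) \<longlonglongrightarrow> 0"
      using assms(2)
    proof eventually_elim
      case (elim x)
      have "(\<lambda>n. \<bar>f n x\<bar> powr q) \<longlonglongrightarrow> \<bar>0\<bar> powr q"
        by (rule tendsto_powr2[OF tendsto_rabs[OF elim] tendsto_const]) (use assms(5) in simp_all)
      then show ?case by simp
    qed
    show "AE x in M. norm (\<bar>f n x\<bar> powr q) \<le> \<bar>w x\<bar> powr q" for n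
      using assms(3)[of n]
    proof eventually_elim
      case (elim x)
      then have "\<bar>f n x\<bar> powr q \<le> \<bar>w x\<bar> powr q" using assms(5) by (intro powr_mono2) simp_all
      then show ?case by simp
    qed
  qed measurable
  then show "(\<lambda>n. LINT x|M. \<bar>f n x\<bar> powr q) \<longlonglongrightarrow> 0" by simp
qed

text \<open>Replaces Hoelder's inequality on a finite measure space: with \<delta> small, the
constant costs little and the power carries a fixed factor.\<close>

lemma le_const_plus_powr:
  fixes t \<delta> q :: real
  assumes "t \<ge> 0" "\<delta> > 0" "q \<ge> 1"
  shows "t \<le> \<delta> + \<delta> powr (1 - q) * t powr q"
proof (cases "t \<le> \<delta>")
  case True
  moreover have "0 \<le> \<delta> powr (1 - q) * t powr q" by simp
  ultimately show ?thesis by linarith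
next
  case False
  then have t: "t > 0" "\<delta> \<le> t" using assms by auto
  have "t powr (1 - q) \<le> \<delta> powr (1 - q)" using t assms by (intro powr_mono2') auto
  then have "t powr (1 - q) * t powr q \<le> \<delta> powr (1 - q) * t powr q" by (rule mult_right_mono) simp
  moreover have "t powr (1 - q) * t powr q = t" using t by (simp add: powr_add[symmetric])
  ultimately show ?thesis using assms by linarith
qed

context finite_measure
begin

lemma Lp_imp_integrable:
  assumes "Lp M q f" "q \<ge> 1" shows "integrable M f"
proof (rule Bochner_Integration.integrable_bound)
  show "integrable M (\<lambda>x. 1 + \<bar>f x\<bar> powr q)" using assms by (simp add: Lp_def)
  show "f \<in> borel_measurable M" using assms by (simp add: Lp_def)
  show "AE x in M. norm (f x) \<le> norm (1 + \<bar>f x\<bar> powr q)"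
    by (rule AE_I2) (use le_const_plus_powr[of _ 1 q] assms(2) in simp)
qed

lemma Lq_null_imp_L1:
  assumes "Lq_null M q f" "q \<ge> 1" shows "(\<lambda>n. LINT x|M. \<bar>f n x\<bar>) \<longlonglongrightarrow> 0"
proof (rule LIMSEQ_I)
  fix r :: real assume r: "r > 0"
  define \<mu> where "\<mu> = measure M (space M)"
  have \<mu>: "\<mu> \<ge> 0" by (simp add: \<mu>_def)
  obtain \<delta> where \<delta>: "\<delta> > 0" and \<delta>\<mu>: "\<delta> * \<mu> \<le> r / 2"
    by (rule small_factor[OF \<mu> r]) (rule that)
  have lim: "(\<lambda>n. LINT x|M. \<bar>f n x\<bar> powr q) \<longlonglongrightarrow> 0" using assms(1) by (simp add: Lq_null_def)
  have "(\<lambda>n. \<delta> powr (1 - q) * (LINT x|M. \<bar>f n x\<bar> powr q)) \<longlonglongrightarrow> 0"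
    by (rule tendsto_mult_right_zero[OF lim])
  from order_tendstoD(2)[OF this, of "r / 2"] r
  have "eventually (\<lambda>n. \<delta> powr (1 - q) * (LINT x|M. \<bar>f n x\<bar> powr q) < r / 2) sequentially" by simp
  then obtain n0 where n0: "\<And>n. n \<ge> n0 \<Longrightarrow> \<delta> powr (1 - q) * (LINT x|M. \<bar>f n x\<bar> powr q) < r / 2"
    unfolding eventually_sequentially by auto
  show "\<exists>no. \<forall>n\<ge>no. norm ((LINT x|M. \<bar>f n x\<bar>) - 0) < r"
  proof (intro exI[of _ n0] allI impI)
    fix n assume n: "n \<ge> n0"
    have L: "Lp M q (f n)" by (rule Lq_null_Lp[OF assms(1)])
    have i: "integrable M (\<lambda>x. \<bar>f n x\<bar> powr q)" using L by (simp add: Lp_def)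
    have "(LINT x|M. \<bar>f n x\<bar>) \<le> (LINT x|M. \<delta> + \<delta> powr (1 - q) * \<bar>f n x\<bar> powr q)"
      using Lp_imp_integrable[OF L assms(2)] i \<delta> assms(2)
      by (intro integral_mono le_const_plus_powr) simp_all
    also have "\<dots> = \<delta> * \<mu> + \<delta> powr (1 - q) * (LINT x|M. \<bar>f n x\<bar> powr q)"
      using i by (simp add: \<mu>_def)
    also have "\<dots> < r" using \<delta>\<mu> n0[OF n] by linarith
    finally have "(LINT x|M. \<bar>f n x\<bar>) < r" .
    moreover have "0 \<le> (LINT x|M. \<bar>f n x\<bar>)" by simp
    ultimately show "norm ((LINT x|M. \<bar>f n x\<bar>) - 0) < r" by simp
  qed
qed

lemma Lq_null_AE_subseq:
  assumes "Lq_null M q f" "q \<ge> 1"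
  shows "\<exists>r. strict_mono r \<and> (AE x in M. (\<lambda>n. f (r n) x) \<longlonglongrightarrow> 0)"
proof (rule tendsto_L1_AE_subseq)
  show "integrable M (f n)" for n by (rule Lp_imp_integrable[OF Lq_null_Lp[OF assms(1)] assms(2)])
  show "(\<lambda>n. LINT x|M. norm (f n x)) \<longlonglongrightarrow> 0"
    unfolding real_norm_def by (rule Lq_null_imp_L1[OF assms])
qed

end

lemma Lp_norm_tendsto_0_iff:
  assumes "q > 0"
  shows "(\<lambda>n. Lp_norm M q (f n)) \<longlonglongrightarrow> 0 \<longleftrightarrow> (\<lambda>n. LINT x|M. \<bar>f n x\<bar> powr q) \<longlonglongrightarrow> 0"
proof
  assume l: "(\<lambda>n. Lp_norm M q (f n)) \<longlonglongrightarrow> 0"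
  have "(\<lambda>n. Lp_norm M q (f n) powr q) \<longlonglongrightarrow> 0 powr q"
    by (rule tendsto_powr2[OF l tendsto_const]) (use assms in \<open>simp_all add: Lp_norm_def\<close>)
  moreover have "Lp_norm M q (f n) powr q = (LINT x|M. \<bar>f n x\<bar> powr q)" for n
    using assms powr_integral_nonneg[of M "f n" q] by (simp add: Lp_norm_def powr_powr)
  ultimately show "(\<lambda>n. LINT x|M. \<bar>f n x\<bar> powr q) \<longlonglongrightarrow> 0" by simp
next
  assume l: "(\<lambda>n. LINT x|M. \<bar>f n x\<bar> powr q) \<longlonglongrightarrow> 0"
  have "(\<lambda>n. (LINT x|M. \<bar>f n x\<bar> powr q) powr (1 / q)) \<longlonglongrightarrow> 0 powr (1 / q)"
    by (rule tendsto_powr2[OF l tendsto_const]) (use assms in \<open>simp_all add: powr_integral_nonneg\<close>)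
  then show "(\<lambda>n. Lp_norm M q (f n)) \<longlonglongrightarrow> 0" by (simp add: Lp_norm_def)
qed

section \<open>Sobolev functions vanishing on the boundary\<close>

context open_domain
begin

text \<open>Membership in \<^const>\<open>W10\<close> together with a witness for the weak gradient,
and with the convergence of the approximating test functions stated for each partial derivative. The
chain rule can then be expressed through the gradient it computes.\<close>

definition W10g :: "real \<Rightarrow> (rvec \<Rightarrow> real) \<Rightarrow> (rvec \<Rightarrow> rvec) \<Rightarrow> bool" where
  "W10g q u g \<longleftrightarrow> Lp M q u \<and> has_weak_grad N \<Omega> u g \<and> (\<forall>i<N. Lp M q (\<lambda>x. g x i)) \<and>
     (\<exists>\<phi>. (\<forall>n. Cc_smooth N \<Omega> (\<phi> n)) \<and> Lq_null M q (\<lambda>n x. \<phi> n x - u x) \<and>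
       (\<forall>i<N. Lq_null M q (\<lambda>n x. pd i (\<phi> n) x - g x i)))"

text \<open>Local integrability yields measurability on each compact box, and countably many of them
cover the set.\<close>

lemma loc_integrable_measurable:
  assumes "loc_integrable N \<Omega> f" shows "f \<in> borel_measurable M"
proof -
  obtain C where C: "countable C" "\<forall>(a,b)\<in>C. clbox N a b \<subseteq> \<Omega>" "\<Omega> = (\<Union>(a,b)\<in>C. obox N a b)"
    using open_rational_boxes[OF open_\<Omega>] by (elim exE conjE) (rule that)
  let ?K = "(\<lambda>c. clbox N (fst c) (snd c)) ` C"
  have K: "K \<subseteq> \<Omega> \<and> K \<inter> space M \<in> sets M \<and> compactin (RN N) K" if "K \<in> ?K" for K
  proof -
    from that obtain c where c': "K = clbox N (fst c) (snd c)" "c \<in> C" by (rule imageE)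
    note c = c'(2,1)
    then have "K \<subseteq> \<Omega>" using C(2) by (simp add: case_prod_beta)
    moreover have "K \<inter> space M \<in> sets M" unfolding c(2) space_M by (rule sets_PN_M[OF clbox_sets])
    ultimately show ?thesis using compactin_clbox c(2) by simp
  qed
  show ?thesis
  proof (rule measurable_piecewise_restrict[of ?K])
    show "countable ?K" using C(1) by simp
    show "K \<inter> space M \<in> sets M" if "K \<in> ?K" for K using K[OF that] by simp
    show "space M \<subseteq> \<Union> ?K"
    proof
      fix x assume "x \<in> space M"
      then have "x \<in> (\<Union>(a,b)\<in>C. obox N a b)" by (subst C(3)[symmetric]) simp
      then obtain c where "c \<in> C" "x \<in> obox N (fst c) (snd c)" by (auto simp: case_prod_beta)
      then show "x \<in> \<Union> ?K" using obox_subset_clbox[of N "fst c" "snd c"] by auto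
    qed
    show "f \<in> borel_measurable (restrict_space M K)" if "K \<in> ?K" for K
    proof (subst borel_measurable_restrict_space_iff)
      show "K \<inter> space M \<in> sets M" using K[OF that] by simp
      have "set_integrable M K f" using assms K[OF that] unfolding loc_integrable_def by simp
      then show "(\<lambda>x. indicator K x *\<^sub>R f x) \<in> borel_measurable M"
        unfolding set_integrable_def by (rule borel_measurable_integrable)
    qed
  qed
qed

lemma has_weak_grad_measurable:
  assumes "has_weak_grad N \<Omega> u g"
  shows "u \<in> borel_measurable M" "i < N \<Longrightarrow> (\<lambda>x. g x i) \<in> borel_measurable M"
  using assms by (auto simp: has_weak_grad_def intro: loc_integrable_measurable)

lemma normN_measurable:
  assumes "\<And>i. i < N \<Longrightarrow> (\<lambda>x. g x i) \<in> borel_measurable M"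
  shows "(\<lambda>x. normN N (g x)) \<in> borel_measurable M"
proof -
  have "sqrt \<in> borel_measurable borel"
    by (intro borel_measurable_continuous_onI continuous_on_real_sqrt continuous_on_id)
  moreover have "(\<lambda>x. dotN N (g x) (g x)) \<in> borel_measurable M"
    unfolding dotN_def by (intro borel_measurable_sum borel_measurable_times assms) simp_all
  ultimately show ?thesis unfolding normN_def by (rule measurable_compose[rotated])
qed

lemma dotN_cong: "(\<And>i. i < N \<Longrightarrow> v i = v' i) \<Longrightarrow> (\<And>i. i < N \<Longrightarrow> w i = w' i) \<Longrightarrow> dotN N v w = dotN N v' w'"
  unfolding dotN_def by (intro sum.cong) auto

lemma normN_cong: "(\<And>i. i < N \<Longrightarrow> v i = w i) \<Longrightarrow> normN N v = normN N w"
  unfolding normN_def using dotN_cong[of v w v w] by simp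

lemma has_weak_grad_weak_grad:
  assumes "has_weak_grad N \<Omega> u g" shows "has_weak_grad N \<Omega> u (weak_grad N \<Omega> u)"
  unfolding weak_grad_def by (rule someI[of _ g]) (rule assms)

lemma Cc_smooth_Lp:
  assumes "Cc_smooth N \<Omega> \<phi>" "q > 0"
  shows "Lp M q \<phi>" "i < N \<Longrightarrow> Lp M q (pd i \<phi>)"
proof -
  obtain B where B: "\<forall>x\<in>topspace (RN N). \<bar>\<phi> x\<bar> \<le> B \<and> (\<forall>i<N. \<bar>pd i \<phi> x\<bar> \<le> B)"
    using Cc_smooth_bounded[OF assms(1)] by auto
  have top: "x \<in> topspace (RN N)" if "x \<in> space M" for x using that \<Omega>_subset by auto
  note t = Cc_smooth_test[OF assms(1)]
  show "Lp M q \<phi>"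
    by (rule Lp_bounded[OF borel_M_of_continuous[OF t(1)] _ assms(2), of B]) (rule AE_I2, use B top in simp)
  show "Lp M q (pd i \<phi>)" if "i < N"
    by (rule Lp_bounded[OF borel_M_of_continuous[OF t(4)[OF that]] _ assms(2), of B]) (rule AE_I2, use B top that in simp)
qed

lemma W10gD:
  assumes "W10g q u g"
  shows "Lp M q u" "has_weak_grad N \<Omega> u g" "i < N \<Longrightarrow> Lp M q (\<lambda>x. g x i)"
  using assms by (simp_all add: W10g_def)

lemma W10g_approx:
  assumes "W10g q u g"
  obtains \<phi> where "\<And>n. Cc_smooth N \<Omega> (\<phi> n)" "Lq_null M q (\<lambda>n x. \<phi> n x - u x)"
    "\<And>i. i < N \<Longrightarrow> Lq_null M q (\<lambda>n x. pd i (\<phi> n) x - g x i)"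
  using assms unfolding W10g_def by auto

lemma weak_grad_test_diff:
  assumes "has_weak_grad N \<Omega> u g" "Cc_smooth N \<Omega> \<phi>"
  shows "has_weak_grad N \<Omega> (\<lambda>x. \<phi> x - u x) (\<lambda>x i. pd i \<phi> x - g x i)"
  using has_weak_grad_lincomb[OF has_weak_grad_Cc_smooth[OF assms(2)] assms(1), of 1 "-1"] by simp

text \<open>Uniqueness of weak gradients identifies the gradient inside the norm with the difference
of the partial derivative and the given gradient.\<close>

lemma W10_imp_W10g:
  assumes "W10 N \<Omega> q u" "q > 0" shows "\<exists>g. W10g q u g"
proof -
  obtain g where g: "has_weak_grad N \<Omega> u g" "\<forall>i<N. Lp M q (\<lambda>x. g x i)" and u: "Lp M q u"
    using assms(1) unfolding W10_def W1_def by auto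
  obtain \<phi> where \<phi>: "\<And>n. Cc_smooth N \<Omega> (\<phi> n)" "(\<lambda>n. W1_norm N \<Omega> q (\<lambda>x. \<phi> n x - u x)) \<longlonglongrightarrow> 0"
    using assms(1) unfolding W10_def by auto
  let ?w = "\<lambda>n. weak_grad N \<Omega> (\<lambda>x. \<phi> n x - u x)"
  have nn: "0 \<le> Lp_norm M q f" for f :: "rvec \<Rightarrow> real" by (simp add: Lp_norm_def)
  have "(\<lambda>n. Lp_norm M q (\<lambda>x. \<phi> n x - u x)) \<longlonglongrightarrow> 0"
    by (rule squeeze_null[OF nn _ \<phi>(2)]) (simp add: W1_norm_def nn)
  then have l1: "(\<lambda>n. LINT x|M. \<bar>\<phi> n x - u x\<bar> powr q) \<longlonglongrightarrow> 0"
    by (simp only: Lp_norm_tendsto_0_iff[OF assms(2)])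
  have "(\<lambda>n. Lp_norm M q (\<lambda>x. normN N (?w n x))) \<longlonglongrightarrow> 0"
    by (rule squeeze_null[OF nn _ \<phi>(2)]) (simp add: W1_norm_def nn)
  then have l2: "(\<lambda>n. LINT x|M. \<bar>normN N (?w n x)\<bar> powr q) \<longlonglongrightarrow> 0"
    by (simp only: Lp_norm_tendsto_0_iff[OF assms(2)])
  have d: "Lp M q (\<lambda>x. \<phi> n x - u x)" for n
    by (rule Lp_diff[OF Cc_smooth_Lp(1)[OF \<phi>(1) assms(2)] u assms(2)])
  have dg: "Lp M q (\<lambda>x. pd i (\<phi> n) x - g x i)" if "i < N" for n i
    by (rule Lp_diff[OF Cc_smooth_Lp(2)[OF \<phi>(1) assms(2) that] _ assms(2)]) (use g(2) that in simp)
  have wd: "has_weak_grad N \<Omega> (\<lambda>x. \<phi> n x - u x) (\<lambda>x i. pd i (\<phi> n) x - g x i)" for n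
    by (rule weak_grad_test_diff[OF g(1) \<phi>(1)])
  have wm: "(\<lambda>x. normN N (?w n x)) \<in> borel_measurable M" for n
    by (rule normN_measurable) (rule has_weak_grad_measurable(2)[OF has_weak_grad_weak_grad[OF wd]])
  have we: "AE x in M. \<forall>i<N. ?w n x i = pd i (\<phi> n) x - g x i" for n
    by (rule weak_grad_eq[OF wd])
  have "Lp M q (\<lambda>x. normN N (?w n x))" for n
  proof (rule Lp_bound(1)[OF _ wm _ assms(2)])
    show "Lp M q (\<lambda>x. \<Sum>i<N. \<bar>pd i (\<phi> n) x - g x i\<bar>)"
      by (intro Lp_sum Lp_abs dg assms(2)) simp_all
    show "AE x in M. \<bar>normN N (?w n x)\<bar> \<le> \<bar>\<Sum>i<N. \<bar>pd i (\<phi> n) x - g x i\<bar>\<bar>"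
      using we[of n]
    proof eventually_elim
      case (elim x)
      have "normN N (?w n x) \<le> (\<Sum>i<N. \<bar>?w n x i\<bar>)" by (rule normN_le_sum)
      also have "\<dots> = (\<Sum>i<N. \<bar>pd i (\<phi> n) x - g x i\<bar>)" by (rule sum.cong) (use elim in auto)
      finally show ?case using normN_nonneg[of N "?w n x"] by simp
    qed
  qed
  then have n2: "Lq_null M q (\<lambda>n x. normN N (?w n x))" using l2 by (simp add: Lq_null_def)
  have "Lq_null M q (\<lambda>n x. pd i (\<phi> n) x - g x i)" if i: "i < N" for i
  proof (rule Lq_null_bound[OF n2 Lp_measurable[OF dg[OF i]] _ assms(2)])
    show "AE x in M. \<bar>pd i (\<phi> n) x - g x i\<bar> \<le> \<bar>normN N (?w n x)\<bar>" for n
      using we[of n]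
    proof eventually_elim
      case (elim x)
      then show ?case using abs_le_normN[OF i, of "?w n x"] i by simp
    qed
  qed
  moreover have "Lq_null M q (\<lambda>n x. \<phi> n x - u x)" using d l1 by (simp add: Lq_null_def)
  ultimately have "W10g q u g" unfolding W10g_def using u g \<phi>(1) by auto
  then show ?thesis by (intro exI[of _ g])
qed

lemma W10g_imp_W10:
  assumes "W10g q u g" "q > 0" shows "W10 N \<Omega> q u"
proof -
  note D = W10gD[OF assms(1)]
  obtain \<phi> where \<phi>: "\<And>n. Cc_smooth N \<Omega> (\<phi> n)" "Lq_null M q (\<lambda>n x. \<phi> n x - u x)"
    "\<And>i. i < N \<Longrightarrow> Lq_null M q (\<lambda>n x. pd i (\<phi> n) x - g x i)" using W10g_approx[OF assms(1)] by blast
  let ?w = "\<lambda>n. weak_grad N \<Omega> (\<lambda>x. \<phi> n x - u x)"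
  have wd: "has_weak_grad N \<Omega> (\<lambda>x. \<phi> n x - u x) (\<lambda>x i. pd i (\<phi> n) x - g x i)" for n
    by (rule weak_grad_test_diff[OF D(2) \<phi>(1)])
  have wm: "(\<lambda>x. normN N (?w n x)) \<in> borel_measurable M" for n
    by (rule normN_measurable) (rule has_weak_grad_measurable(2)[OF has_weak_grad_weak_grad[OF wd]])
  have we: "AE x in M. \<forall>i<N. ?w n x i = pd i (\<phi> n) x - g x i" for n
    by (rule weak_grad_eq[OF wd])
  have "Lq_null M q (\<lambda>n x. \<Sum>i<N. \<bar>pd i (\<phi> n) x - g x i\<bar>)"
    by (intro Lq_null_sum Lq_null_abs \<phi>(3) assms(2)) simp_all
  then have n: "Lq_null M q (\<lambda>n x. normN N (?w n x))"
  proof (rule Lq_null_bound[OF _ wm _ assms(2)])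
    show "AE x in M. \<bar>normN N (?w n x)\<bar> \<le> \<bar>\<Sum>i<N. \<bar>pd i (\<phi> n) x - g x i\<bar>\<bar>" for n
      using we[of n]
    proof eventually_elim
      case (elim x)
      have "normN N (?w n x) \<le> (\<Sum>i<N. \<bar>?w n x i\<bar>)" by (rule normN_le_sum)
      also have "\<dots> = (\<Sum>i<N. \<bar>pd i (\<phi> n) x - g x i\<bar>)" by (rule sum.cong) (use elim in auto)
      finally show ?case using normN_nonneg[of N "?w n x"] by simp
    qed
  qed
  have "(\<lambda>n. Lp_norm M q (\<lambda>x. \<phi> n x - u x)) \<longlonglongrightarrow> 0" "(\<lambda>n. Lp_norm M q (\<lambda>x. normN N (?w n x))) \<longlonglongrightarrow> 0"
    using \<phi>(2) n unfolding Lp_norm_tendsto_0_iff[OF assms(2)] by (simp_all add: Lq_null_def)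
  then have "(\<lambda>n. W1_norm N \<Omega> q (\<lambda>x. \<phi> n x - u x)) \<longlonglongrightarrow> 0"
    unfolding W1_norm_def by (rule tendsto_add_zero)
  moreover have "W1 N \<Omega> q u" unfolding W1_def using D by auto
  ultimately show ?thesis unfolding W10_def using \<phi>(1) by auto
qed

lemma W10g_Cc_smooth:
  assumes "Cc_smooth N \<Omega> \<phi>" "q > 0" shows "W10g q \<phi> (\<lambda>x i. pd i \<phi> x)"
  unfolding W10g_def
proof (intro conjI allI impI exI[of _ "\<lambda>_. \<phi>"])
  show "has_weak_grad N \<Omega> \<phi> (\<lambda>x i. pd i \<phi> x)" by (rule has_weak_grad_Cc_smooth[OF assms(1)])
qed (use Cc_smooth_Lp[OF assms] assms in \<open>simp_all add: Lq_null_zero\<close>)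

lemma pd_lincomb:
  assumes "Cc_smooth N \<Omega> \<phi>" "Cc_smooth N \<Omega> \<eta>" "i < N" "x \<in> topspace (RN N)"
  shows "pd i (\<lambda>x. a * \<phi> x + b * \<eta> x) x = a * pd i \<phi> x + b * pd i \<eta> x"
proof -
  have "pdiff N i (\<lambda>x. a * \<phi> x + b * \<eta> x) (\<lambda>x. a * pd i \<phi> x + b * pd i \<eta> x)"
    using Cc_smooth_test(3)[OF assms(1,3)] Cc_smooth_test(3)[OF assms(2,3)] unfolding pdiff_def
    by (auto intro!: DERIV_add DERIV_cmult)
  from pdiff_pd[OF this assms(4)] show ?thesis .
qed

lemma W10g_lincomb:
  assumes "W10g q u g" "W10g q v h" "q > 0"
  shows "W10g q (\<lambda>x. a * u x + b * v x) (\<lambda>x i. a * g x i + b * h x i)"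
proof -
  note U = W10gD[OF assms(1)] and V = W10gD[OF assms(2)]
  obtain \<phi> where \<phi>: "\<And>n. Cc_smooth N \<Omega> (\<phi> n)" "Lq_null M q (\<lambda>n x. \<phi> n x - u x)"
    "\<And>i. i < N \<Longrightarrow> Lq_null M q (\<lambda>n x. pd i (\<phi> n) x - g x i)" using W10g_approx[OF assms(1)] by blast
  obtain \<eta> where \<eta>: "\<And>n. Cc_smooth N \<Omega> (\<eta> n)" "Lq_null M q (\<lambda>n x. \<eta> n x - v x)"
    "\<And>i. i < N \<Longrightarrow> Lq_null M q (\<lambda>n x. pd i (\<eta> n) x - h x i)" using W10g_approx[OF assms(2)] by blast
  let ?\<theta> = "\<lambda>n x. a * \<phi> n x + b * \<eta> n x"
  have c: "Cc_smooth N \<Omega> (?\<theta> n)" for n by (intro Cc_smooth_add Cc_smooth_cmult \<phi>(1) \<eta>(1))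
  show ?thesis unfolding W10g_def
  proof (intro conjI allI impI exI[of _ ?\<theta>])
    show "Lp M q (\<lambda>x. a * u x + b * v x)" by (intro Lp_add Lp_cmult U(1) V(1) assms(3))
    show "has_weak_grad N \<Omega> (\<lambda>x. a * u x + b * v x) (\<lambda>x i. a * g x i + b * h x i)"
      by (rule has_weak_grad_lincomb[OF U(2) V(2)])
    show "Lp M q (\<lambda>x. a * g x i + b * h x i)" if "i < N" for i
      by (intro Lp_add Lp_cmult U(3) V(3) assms(3) that)
    show "Cc_smooth N \<Omega> (?\<theta> n)" for n by (rule c)
    have "Lq_null M q (\<lambda>n x. a * (\<phi> n x - u x) + b * (\<eta> n x - v x))"
      by (intro Lq_null_add Lq_null_cmult \<phi>(2) \<eta>(2) assms(3))
    then show "Lq_null M q (\<lambda>n x. ?\<theta> n x - (a * u x + b * v x))" by (simp add: algebra_simps)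
    fix i assume i: "i < N"
    have "Lq_null M q (\<lambda>n x. a * (pd i (\<phi> n) x - g x i) + b * (pd i (\<eta> n) x - h x i))"
      by (intro Lq_null_add Lq_null_cmult \<phi>(3) \<eta>(3) i assms(3))
    then show "Lq_null M q (\<lambda>n x. pd i (?\<theta> n) x - (a * g x i + b * h x i))"
    proof (rule Lq_null_bound[OF _ _ _ assms(3)])
      show "(\<lambda>x. pd i (?\<theta> n) x - (a * g x i + b * h x i)) \<in> borel_measurable M" for n
        by (intro borel_measurable_diff borel_M_of_continuous[OF Cc_smooth_test(4)[OF c i]]
          Lp_measurable[of _ q] Lp_add Lp_cmult U(3) V(3) assms(3) i)
      show "AE x in M. \<bar>pd i (?\<theta> n) x - (a * g x i + b * h x i)\<bar>
          \<le> \<bar>a * (pd i (\<phi> n) x - g x i) + b * (pd i (\<eta> n) x - h x i)\<bar>" for n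
      proof (rule AE_I2)
        fix x assume "x \<in> space M"
        then have x: "x \<in> topspace (RN N)" using \<Omega>_subset by auto
        show "\<bar>pd i (?\<theta> n) x - (a * g x i + b * h x i)\<bar>
          \<le> \<bar>a * (pd i (\<phi> n) x - g x i) + b * (pd i (\<eta> n) x - h x i)\<bar>"
          unfolding pd_lincomb[OF \<phi>(1) \<eta>(1) i x] by (simp add: algebra_simps)
      qed
    qed
  qed
qed

text \<open>A diagonal choice of test functions, one for each member of the sequence, approximates
the limit.\<close>

lemma W10g_limit:
  assumes f: "\<And>n. W10g q (f n) (g n)" and u: "Lp M q u" "\<And>i. i < N \<Longrightarrow> Lp M q (\<lambda>x. h x i)"
    and l: "Lq_null M q (\<lambda>n x. f n x - u x)" "\<And>i. i < N \<Longrightarrow> Lq_null M q (\<lambda>n x. g n x i - h x i)"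
    and q: "q \<ge> 1"
  shows "W10g q u h"
proof -
  have q0: "q > 0" using q by simp
  note F = W10gD[OF f]
  have "\<exists>\<psi>. Cc_smooth N \<Omega> \<psi> \<and> (LINT x|M. \<bar>\<psi> x - f n x\<bar> powr q) \<le> 1 / real (Suc n) \<and>
     (\<forall>i<N. (LINT x|M. \<bar>pd i \<psi> x - g n x i\<bar> powr q) \<le> 1 / real (Suc n))" for n
  proof -
    obtain \<phi> where \<phi>: "\<And>n. Cc_smooth N \<Omega> (\<phi> n)" "Lq_null M q (\<lambda>m x. \<phi> m x - f n x)"
      "\<And>i. i < N \<Longrightarrow> Lq_null M q (\<lambda>m x. pd i (\<phi> m) x - g n x i)" using W10g_approx[OF f[of n]] by blast
    have e: "0 < 1 / real (Suc n)" by simp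
    have l1: "(\<lambda>m. LINT x|M. \<bar>\<phi> m x - f n x\<bar> powr q) \<longlonglongrightarrow> 0" using \<phi>(2) by (simp add: Lq_null_def)
    have l2: "(\<lambda>m. LINT x|M. \<bar>pd i (\<phi> m) x - g n x i\<bar> powr q) \<longlonglongrightarrow> 0" if "i < N" for i
      using \<phi>(3)[OF that] by (simp add: Lq_null_def)
    have e1: "eventually (\<lambda>m. (LINT x|M. \<bar>\<phi> m x - f n x\<bar> powr q) < 1 / real (Suc n)) sequentially"
      by (rule order_tendstoD(2)[OF l1 e])
    have "\<forall>i\<in>{..<N}. eventually (\<lambda>m. (LINT x|M. \<bar>pd i (\<phi> m) x - g n x i\<bar> powr q) < 1 / real (Suc n)) sequentially"
      using order_tendstoD(2)[OF l2 e] by simp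
    then have e2: "eventually (\<lambda>m. \<forall>i\<in>{..<N}. (LINT x|M. \<bar>pd i (\<phi> m) x - g n x i\<bar> powr q) < 1 / real (Suc n)) sequentially"
      by (simp add: eventually_ball_finite_distrib)
    obtain m where "(LINT x|M. \<bar>\<phi> m x - f n x\<bar> powr q) < 1 / real (Suc n)"
      "\<forall>i\<in>{..<N}. (LINT x|M. \<bar>pd i (\<phi> m) x - g n x i\<bar> powr q) < 1 / real (Suc n)"
      using eventually_happens'[OF sequentially_bot eventually_conj[OF e1 e2]] by auto
    then show ?thesis using \<phi>(1)[of m] by (intro exI[of _ "\<phi> m"]) (simp add: less_imp_le)
  qed
  then have "\<exists>\<psi>. \<forall>n. Cc_smooth N \<Omega> (\<psi> n) \<and> (LINT x|M. \<bar>\<psi> n x - f n x\<bar> powr q) \<le> 1 / real (Suc n) \<and>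
     (\<forall>i<N. (LINT x|M. \<bar>pd i (\<psi> n) x - g n x i\<bar> powr q) \<le> 1 / real (Suc n))"
    by (intro choice allI)
  then obtain \<psi> where \<psi>: "\<And>n. Cc_smooth N \<Omega> (\<psi> n)"
    "\<And>n. (LINT x|M. \<bar>\<psi> n x - f n x\<bar> powr q) \<le> 1 / real (Suc n)"
    "\<And>n i. i < N \<Longrightarrow> (LINT x|M. \<bar>pd i (\<psi> n) x - g n x i\<bar> powr q) \<le> 1 / real (Suc n)" by auto
  note inv = inverse_Suc_null
  have n1: "Lq_null M q (\<lambda>n x. \<psi> n x - f n x)"
    unfolding Lq_null_def
    by (intro conjI allI Lp_diff Cc_smooth_Lp(1)[OF \<psi>(1) q0] F(1) q0 squeeze_null[OF powr_integral_nonneg \<psi>(2) inv])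
  have n2: "Lq_null M q (\<lambda>n x. pd i (\<psi> n) x - g n x i)" if "i < N" for i
    unfolding Lq_null_def
    by (intro conjI allI Lp_diff Cc_smooth_Lp(2)[OF \<psi>(1) q0] F(3) q0 that squeeze_null[OF powr_integral_nonneg \<psi>(3) inv])
  show ?thesis unfolding W10g_def
  proof (intro conjI allI impI exI[of _ \<psi>])
    show "Lp M q u" by (rule u(1))
    show "Lp M q (\<lambda>x. h x i)" if "i < N" for i by (rule u(2)[OF that])
    show "Cc_smooth N \<Omega> (\<psi> n)" for n by (rule \<psi>(1))
    show "has_weak_grad N \<Omega> u h"
      by (rule has_weak_grad_limit[OF F(2)])
        (rule Lp_imp_integrable[OF F(1) q] Lp_imp_integrable[OF u(1) q] Lq_null_imp_L1[OF l(1) q]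
          Lp_imp_integrable[OF F(3) q] Lp_imp_integrable[OF u(2) q] Lq_null_imp_L1[OF l(2) q] | assumption)+
    have "Lq_null M q (\<lambda>n x. (\<psi> n x - f n x) + (f n x - u x))" by (rule Lq_null_add[OF n1 l(1) q0])
    then show "Lq_null M q (\<lambda>n x. \<psi> n x - u x)" by simp
    fix i assume i: "i < N"
    have "Lq_null M q (\<lambda>n x. (pd i (\<psi> n) x - g n x i) + (g n x i - h x i))"
      by (rule Lq_null_add[OF n2[OF i] l(2)[OF i] q0])
    then show "Lq_null M q (\<lambda>n x. pd i (\<psi> n) x - h x i)" by simp
  qed
qed

end

section \<open>The chain rule and truncation\<close>

lemma lipschitz_of_deriv:
  fixes G :: "real \<Rightarrow> real"
  assumes "\<And>s. (G has_real_derivative G' s) (at s)" "\<And>s. \<bar>G' s\<bar> \<le> L"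
  shows "\<bar>G a - G b\<bar> \<le> L * \<bar>a - b\<bar>"
  using field_differentiable_bound[of UNIV G G' L a b] assms by simp

context open_domain
begin

lemma borel_compose_continuous:
  fixes G :: "real \<Rightarrow> real"
  assumes "continuous_on UNIV G" "u \<in> borel_measurable M" shows "(\<lambda>x. G (u x)) \<in> borel_measurable M"
  using borel_measurable_continuous_onI[OF assms(1)] assms(2) by (rule measurable_compose[rotated])

text \<open>Test functions that converge to the given function may be taken to converge almost
everywhere. The error of the gradients then splits into the outer derivative times the error of the
inner gradients, and the increment of the outer derivative times a fixed gradient; the second part
tends to zero by dominated convergence. This yields the weak gradient for any outer function that
vanishes at 0 and has a bounded continuous derivative.\<close>

lemma chain_rule_approximation:
  assumes W: "W10g q u g" and q: "q \<ge> 1"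
    and G: "\<And>s. (G has_real_derivative G' s) (at s)" "continuous_on UNIV G'" "\<And>s. \<bar>G' s\<bar> \<le> L" "G 0 = 0"
  obtains \<phi> where "\<And>n. Cc_smooth N \<Omega> (\<phi> n)"
    "Lp M q (\<lambda>x. G (u x))" "\<And>i. i < N \<Longrightarrow> Lp M q (\<lambda>x. G' (u x) * g x i)"
    "Lq_null M q (\<lambda>n x. G (\<phi> n x) - G (u x))"
    "\<And>i. i < N \<Longrightarrow> Lq_null M q (\<lambda>n x. G' (\<phi> n x) * pd i (\<phi> n) x - G' (u x) * g x i)"
    "has_weak_grad N \<Omega> (\<lambda>x. G (u x)) (\<lambda>x i. G' (u x) * g x i)"
proof -
  have q0: "q > 0" using q by simp
  have L0: "L \<ge> 0" using G(3)[of 0] by linarith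
  note U = W10gD[OF W]
  obtain \<phi>0 where \<phi>0: "\<And>n. Cc_smooth N \<Omega> (\<phi>0 n)" "Lq_null M q (\<lambda>n x. \<phi>0 n x - u x)"
    "\<And>i. i < N \<Longrightarrow> Lq_null M q (\<lambda>n x. pd i (\<phi>0 n) x - g x i)" using W10g_approx[OF W] by blast
  obtain r where r: "strict_mono r" "AE x in M. (\<lambda>n. \<phi>0 (r n) x - u x) \<longlonglongrightarrow> 0"
    using Lq_null_AE_subseq[OF \<phi>0(2) q] by blast
  define \<phi> where "\<phi> n = \<phi>0 (r n)" for n
  have \<phi>: "\<And>n. Cc_smooth N \<Omega> (\<phi> n)" "Lq_null M q (\<lambda>n x. \<phi> n x - u x)"
    "\<And>i. i < N \<Longrightarrow> Lq_null M q (\<lambda>n x. pd i (\<phi> n) x - g x i)"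
    unfolding \<phi>_def using \<phi>0(1) Lq_null_subseq[OF \<phi>0(2) r(1)] Lq_null_subseq[OF \<phi>0(3) r(1)] by simp_all
  have ae: "AE x in M. (\<lambda>n. \<phi> n x) \<longlonglongrightarrow> u x"
    using r(2) unfolding \<phi>_def by eventually_elim (rule LIM_zero_cancel)
  have cG: "continuous_on UNIV G"
    using G(1) DERIV_isCont by (intro continuous_at_imp_continuous_on ballI) blast
  have mu: "u \<in> borel_measurable M" by (rule Lp_measurable[OF U(1)])
  have mg: "(\<lambda>x. g x i) \<in> borel_measurable M" if "i < N" for i by (rule Lp_measurable[OF U(3)[OF that]])
  have m\<phi>: "\<phi> n \<in> borel_measurable M" "i < N \<Longrightarrow> pd i (\<phi> n) \<in> borel_measurable M" for n i
    using Cc_smooth_test(1,4)[OF \<phi>(1)] by (simp_all add: borel_M_of_continuous)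
  note mG = borel_compose_continuous[OF cG] and mG' = borel_compose_continuous[OF G(2)]
  have lip: "\<bar>G a - G b\<bar> \<le> L * \<bar>a - b\<bar>" for a b by (rule lipschitz_of_deriv[OF G(1,3)])
  have lip0: "\<bar>G a\<bar> \<le> L * \<bar>a\<bar>" for a using lip[of a 0] G(4) by simp
  have mult_le: "\<bar>G' s * t\<bar> \<le> L * \<bar>t\<bar>" for s t
    unfolding abs_mult using G(3) by (intro mult_right_mono) simp_all
  have LG: "Lp M q (\<lambda>x. G (u x))"
    by (rule Lp_bound(1)[OF Lp_cmult(1)[OF U(1), of L] mG[OF mu] _ q0])
      (rule AE_I2, use lip0 L0 in \<open>simp add: abs_mult\<close>)
  have LG': "Lp M q (\<lambda>x. G' (u x) * g x i)" if i: "i < N" for i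
    by (rule Lp_bound(1)[OF Lp_cmult(1)[OF U(3)[OF i], of L] borel_measurable_times[OF mG'[OF mu] mg[OF i]] _ q0])
      (rule AE_I2, use mult_le L0 in \<open>simp add: abs_mult\<close>)
  have n1: "Lq_null M q (\<lambda>n x. G (\<phi> n x) - G (u x))"
    by (rule Lq_null_bound[OF Lq_null_cmult[OF \<phi>(2), of L] borel_measurable_diff[OF mG[OF m\<phi>(1)] mG[OF mu]] _ q0])
      (rule AE_I2, use lip L0 in \<open>simp add: abs_mult\<close>)
  have n2: "Lq_null M q (\<lambda>n x. G' (\<phi> n x) * pd i (\<phi> n) x - G' (u x) * g x i)" if i: "i < N" for i
  proof -
    have a: "Lq_null M q (\<lambda>n x. G' (\<phi> n x) * (pd i (\<phi> n) x - g x i))"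
      by (rule Lq_null_bound[OF Lq_null_cmult[OF \<phi>(3)[OF i], of L]
            borel_measurable_times[OF mG'[OF m\<phi>(1)] borel_measurable_diff[OF m\<phi>(2)[OF i] mg[OF i]]] _ q0])
        (rule AE_I2, use mult_le L0 in \<open>simp add: abs_mult\<close>)
    have b: "Lq_null M q (\<lambda>n x. (G' (\<phi> n x) - G' (u x)) * g x i)"
    proof (rule Lq_null_dominated[OF _ _ _ Lp_cmult(1)[OF U(3)[OF i], of "2 * L"] q0])
      show "(\<lambda>x. (G' (\<phi> n x) - G' (u x)) * g x i) \<in> borel_measurable M" for n
        by (intro borel_measurable_times borel_measurable_diff mG' mu m\<phi>(1) mg i)
      show "AE x in M. (\<lambda>n. (G' (\<phi> n x) - G' (u x)) * g x i) \<longlonglongrightarrow> 0"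
        using ae
      proof eventually_elim
        case (elim x)
        have "isCont G' (u x)" using G(2) by (simp add: continuous_on_eq_continuous_at)
        then have "(\<lambda>n. G' (\<phi> n x)) \<longlonglongrightarrow> G' (u x)" using elim by (rule isCont_tendsto_compose)
        then have "(\<lambda>n. G' (\<phi> n x) - G' (u x)) \<longlonglongrightarrow> 0" by (rule LIM_zero)
        then show ?case by (rule tendsto_mult_left_zero)
      qed
      show "AE x in M. \<bar>(G' (\<phi> n x) - G' (u x)) * g x i\<bar> \<le> \<bar>2 * L * g x i\<bar>" for n
      proof (rule AE_I2)
        fix x
        have "\<bar>G' (\<phi> n x) - G' (u x)\<bar> \<le> 2 * L" using G(3)[of "\<phi> n x"] G(3)[of "u x"] by linarith
        then have "\<bar>G' (\<phi> n x) - G' (u x)\<bar> * \<bar>g x i\<bar> \<le> (2 * L) * \<bar>g x i\<bar>" by (rule mult_right_mono) simp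
        then show "\<bar>(G' (\<phi> n x) - G' (u x)) * g x i\<bar> \<le> \<bar>2 * L * g x i\<bar>" using L0 by (simp add: abs_mult)
      qed
    qed
    have "Lq_null M q (\<lambda>n x. G' (\<phi> n x) * (pd i (\<phi> n) x - g x i) + (G' (\<phi> n x) - G' (u x)) * g x i)"
      by (rule Lq_null_add[OF a b q0])
    then show ?thesis by (simp add: algebra_simps)
  qed
  \<comment> \<open>For fixed n the composite is continuously differentiable in the classical sense.\<close>
  have wg: "has_weak_grad N \<Omega> (\<lambda>x. G (\<phi> n x)) (\<lambda>x i. G' (\<phi> n x) * pd i (\<phi> n) x)" for n
  proof -
    obtain B where B: "B > 0" "\<forall>x\<in>topspace (RN N). \<bar>\<phi> n x\<bar> \<le> B \<and> (\<forall>i<N. \<bar>pd i (\<phi> n) x\<bar> \<le> B)"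
      using Cc_smooth_bounded[OF \<phi>(1)] by blast
    note t = Cc_smooth_test[OF \<phi>(1)[of n]]
    have comp: "continuous_map (RN N) euclideanreal (\<lambda>x. H (\<phi> n x))" if "continuous_on UNIV H" for H :: "real \<Rightarrow> real"
      using continuous_map_compose[OF t(1), of euclideanreal H] that by (simp add: comp_def)
    show ?thesis
    proof (rule has_weak_grad_classical[of _ "L * B"])
      show "continuous_map (RN N) euclideanreal (\<lambda>x. G (\<phi> n x))" by (rule comp[OF cG])
      show "\<bar>G (\<phi> n x)\<bar> \<le> L * B" if "x \<in> topspace (RN N)" for x
      proof -
        have "\<bar>\<phi> n x\<bar> \<le> B" using B(2) that by simp
        then have "L * \<bar>\<phi> n x\<bar> \<le> L * B" using L0 by (rule mult_left_mono)
        then show ?thesis using lip0[of "\<phi> n x"] by linarith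
      qed
      show "pdiff N i (\<lambda>x. G (\<phi> n x)) (\<lambda>x. G' (\<phi> n x) * pd i (\<phi> n) x)" if "i < N" for i
        unfolding pdiff_def
      proof
        fix x assume "x \<in> topspace (RN N)"
        then have *: "((\<lambda>t. \<phi> n (x(i := t))) has_real_derivative pd i (\<phi> n) x) (at (x i))"
          using t(3)[OF that] unfolding pdiff_def by simp
        have "(G has_real_derivative G' (\<phi> n x)) (at (\<phi> n (x(i := x i))))" using G(1) by simp
        from DERIV_chain2[OF this *]
        show "((\<lambda>t. G (\<phi> n (x(i := t)))) has_real_derivative G' (\<phi> n x) * pd i (\<phi> n) x) (at (x i))" .
      qed
      show "continuous_map (RN N) euclideanreal (\<lambda>x. G' (\<phi> n x) * pd i (\<phi> n) x)" if "i < N" for i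
        by (rule continuous_map_real_mult[OF comp[OF G(2)] t(4)[OF that]])
      show "\<bar>G' (\<phi> n x) * pd i (\<phi> n) x\<bar> \<le> L * B" if "i < N" "x \<in> topspace (RN N)" for i x
      proof -
        have "\<bar>pd i (\<phi> n) x\<bar> \<le> B" using B(2) that by simp
        then have "L * \<bar>pd i (\<phi> n) x\<bar> \<le> L * B" using L0 by (rule mult_left_mono)
        then show ?thesis using mult_le[of "\<phi> n x" "pd i (\<phi> n) x"] by linarith
      qed
    qed
  qed
  have LGn: "Lp M q (\<lambda>x. G (\<phi> n x))" for n
    using Lp_add(1)[OF Lq_null_Lp[OF n1] LG q0] by simp
  have LGn': "Lp M q (\<lambda>x. G' (\<phi> n x) * pd i (\<phi> n) x)" if "i < N" for n i
    using Lp_add(1)[OF Lq_null_Lp[OF n2[OF that]] LG'[OF that] q0] by simp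
  have "has_weak_grad N \<Omega> (\<lambda>x. G (u x)) (\<lambda>x i. G' (u x) * g x i)"
    by (rule has_weak_grad_limit[OF wg])
      (rule Lp_imp_integrable[OF LGn q] Lp_imp_integrable[OF LG q] Lq_null_imp_L1[OF n1 q]
        Lp_imp_integrable[OF LGn' q] Lp_imp_integrable[OF LG' q] Lq_null_imp_L1[OF n2 q] | assumption)+
  with \<phi>(1) LG LG' n1 n2 show thesis by (rule that)
qed

text \<open>A smooth outer function vanishing at 0 maps test functions to test functions, so
boundary values are preserved.\<close>

lemma chain_rule_smooth:
  assumes W: "W10g q u g" and q: "q \<ge> 1"
    and G: "\<And>s. (G has_real_derivative G' s) (at s)" "continuous_on UNIV G'" "\<And>s. \<bar>G' s\<bar> \<le> L" "G 0 = 0"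
    and sm: "smooth1 G"
  shows "W10g q (\<lambda>x. G (u x)) (\<lambda>x i. G' (u x) * g x i)"
proof -
  have q0: "q > 0" using q by simp
  obtain \<phi> where \<phi>: "\<And>n. Cc_smooth N \<Omega> (\<phi> n)"
    "Lp M q (\<lambda>x. G (u x))" "\<And>i. i < N \<Longrightarrow> Lp M q (\<lambda>x. G' (u x) * g x i)"
    "Lq_null M q (\<lambda>n x. G (\<phi> n x) - G (u x))"
    "\<And>i. i < N \<Longrightarrow> Lq_null M q (\<lambda>n x. G' (\<phi> n x) * pd i (\<phi> n) x - G' (u x) * g x i)"
    "has_weak_grad N \<Omega> (\<lambda>x. G (u x)) (\<lambda>x i. G' (u x) * g x i)"
    by (rule chain_rule_approximation[OF W q G]) auto
  have c: "Cc_smooth N \<Omega> (\<lambda>x. G (\<phi> n x))" for n by (rule Cc_smooth_compose[OF \<phi>(1) sm G(4)])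
  have pd: "pd i (\<lambda>x. G (\<phi> n x)) x = G' (\<phi> n x) * pd i (\<phi> n) x" if "i < N" "x \<in> topspace (RN N)" for i n x
  proof -
    have *: "((\<lambda>t. \<phi> n (x(i := t))) has_real_derivative pd i (\<phi> n) x) (at (x i))"
      using Cc_smooth_test(3)[OF \<phi>(1) that(1)] that(2) unfolding pdiff_def by simp
    have "(G has_real_derivative G' (\<phi> n x)) (at (\<phi> n (x(i := x i))))" using G(1) by simp
    from DERIV_imp_deriv[OF DERIV_chain2[OF this *]] show ?thesis by (simp add: pd_def)
  qed
  show ?thesis unfolding W10g_def
  proof (intro conjI allI impI exI[of _ "\<lambda>n x. G (\<phi> n x)"])
    fix i assume i: "i < N"
    show "Lp M q (\<lambda>x. G' (u x) * g x i)" by (rule \<phi>(3)[OF i])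
    show "Lq_null M q (\<lambda>n x. pd i (\<lambda>x. G (\<phi> n x)) x - G' (u x) * g x i)"
    proof (rule Lq_null_bound[OF \<phi>(5)[OF i] _ _ q0])
      show "(\<lambda>x. pd i (\<lambda>x. G (\<phi> n x)) x - G' (u x) * g x i) \<in> borel_measurable M" for n
        by (intro borel_measurable_diff borel_M_of_continuous[OF Cc_smooth_test(4)[OF c i]] Lp_measurable[OF \<phi>(3)[OF i]])
      show "AE x in M. \<bar>pd i (\<lambda>x. G (\<phi> n x)) x - G' (u x) * g x i\<bar> \<le> \<bar>G' (\<phi> n x) * pd i (\<phi> n) x - G' (u x) * g x i\<bar>" for n
      proof (rule AE_I2)
        fix x assume "x \<in> space M"
        then have x: "x \<in> topspace (RN N)" using \<Omega>_subset by auto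
        show "\<bar>pd i (\<lambda>x. G (\<phi> n x)) x - G' (u x) * g x i\<bar> \<le> \<bar>G' (\<phi> n x) * pd i (\<phi> n) x - G' (u x) * g x i\<bar>"
          unfolding pd[OF i x] by simp
      qed
    qed
  qed (use \<phi> c in simp_all)
qed

text \<open>Convergence everywhere, and not merely almost everywhere, is what matters: the inner
function may take a single value on a set of positive measure.\<close>

lemma chain_rule_pointwise_limit:
  assumes W: "W10g q u g" and q: "q \<ge> 1"
    and F: "\<And>n. W10g q (\<lambda>x. F n (u x)) (\<lambda>x i. \<gamma> n (u x) * g x i)"
    and b: "\<And>n s. \<bar>F n s\<bar> \<le> \<bar>s\<bar>" "\<And>n s. \<bar>\<gamma> n s\<bar> \<le> 1"
    and l: "\<And>s. (\<lambda>n. F n s) \<longlonglongrightarrow> F' s" "\<And>s. (\<lambda>n. \<gamma> n s) \<longlonglongrightarrow> \<gamma>' s"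
  shows "W10g q (\<lambda>x. F' (u x)) (\<lambda>x i. \<gamma>' (u x) * g x i)"
proof -
  have q0: "q > 0" using q by simp
  note U = W10gD[OF W] and Fn = W10gD[OF F]
  have mF: "(\<lambda>x. F n (u x)) \<in> borel_measurable M" for n by (rule Lp_measurable[OF Fn(1)])
  have mg: "(\<lambda>x. \<gamma> n (u x) * g x i) \<in> borel_measurable M" if "i < N" for n i
    by (rule Lp_measurable[OF Fn(3)[OF that]])
  have mF': "(\<lambda>x. F' (u x)) \<in> borel_measurable M"
    by (rule borel_measurable_LIMSEQ_real[OF _ mF]) (rule l(1))
  have mg': "(\<lambda>x. \<gamma>' (u x) * g x i) \<in> borel_measurable M" if "i < N" for i
    by (rule borel_measurable_LIMSEQ_real[OF _ mg[OF that]]) (rule tendsto_mult_right[OF l(2)])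
  have b1: "\<bar>F' s\<bar> \<le> \<bar>s\<bar>" for s
    by (rule LIMSEQ_le_const2[OF tendsto_rabs[OF l(1)]]) (use b(1) in auto)
  have b2: "\<bar>\<gamma>' s\<bar> \<le> 1" for s
    by (rule LIMSEQ_le_const2[OF tendsto_rabs[OF l(2)]]) (use b(2) in auto)
  have m1: "\<bar>c * t\<bar> \<le> \<bar>t\<bar>" if "\<bar>c\<bar> \<le> 1" for c t :: real
    unfolding abs_mult using mult_right_mono[OF that, of "\<bar>t\<bar>"] by simp
  show ?thesis
  proof (rule W10g_limit[OF F _ _ _ _ q])
    show "Lp M q (\<lambda>x. F' (u x))"
      by (rule Lp_bound(1)[OF U(1) mF' _ q0]) (rule AE_I2, rule b1)
    show "Lp M q (\<lambda>x. \<gamma>' (u x) * g x i)" if "i < N" for i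
      by (rule Lp_bound(1)[OF U(3)[OF that] mg'[OF that] _ q0]) (rule AE_I2, rule m1[OF b2])
    show "Lq_null M q (\<lambda>n x. F n (u x) - F' (u x))"
    proof (rule Lq_null_dominated[OF borel_measurable_diff[OF mF mF'] _ _ Lp_cmult(1)[OF U(1), of 2] q0])
      show "AE x in M. (\<lambda>n. F n (u x) - F' (u x)) \<longlonglongrightarrow> 0" by (rule AE_I2) (rule LIM_zero[OF l(1)])
      show "AE x in M. \<bar>F n (u x) - F' (u x)\<bar> \<le> \<bar>2 * u x\<bar>" for n
      proof (rule AE_I2)
        fix x show "\<bar>F n (u x) - F' (u x)\<bar> \<le> \<bar>2 * u x\<bar>" using b(1)[of n "u x"] b1[of "u x"] by linarith
      qed
    qed
    fix i assume i: "i < N"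
    show "Lq_null M q (\<lambda>n x. \<gamma> n (u x) * g x i - \<gamma>' (u x) * g x i)"
    proof (rule Lq_null_dominated[OF borel_measurable_diff[OF mg[OF i] mg'[OF i]] _ _ Lp_cmult(1)[OF U(3)[OF i], of 2] q0])
      show "AE x in M. (\<lambda>n. \<gamma> n (u x) * g x i - \<gamma>' (u x) * g x i) \<longlonglongrightarrow> 0"
        by (rule AE_I2) (rule LIM_zero[OF tendsto_mult_right[OF l(2)]])
      show "AE x in M. \<bar>\<gamma> n (u x) * g x i - \<gamma>' (u x) * g x i\<bar> \<le> \<bar>2 * g x i\<bar>" for n
      proof (rule AE_I2)
        fix x show "\<bar>\<gamma> n (u x) * g x i - \<gamma>' (u x) * g x i\<bar> \<le> \<bar>2 * g x i\<bar>"
          using m1[OF b(2)[of n "u x"], of "g x i"] m1[OF b2[of "u x"], of "g x i"] by linarith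
      qed
    qed
  qed
qed

end

subsection \<open>Truncation\<close>

text \<open>Truncation at level k is half the difference of \<bar>s + k\<bar> and \<bar>s - k\<bar>;
here both absolute values are smoothed. The derivative stays between -1 and 1.\<close>

definition soft_trunc :: "real \<Rightarrow> real \<Rightarrow> real \<Rightarrow> real" where
  "soft_trunc \<delta> k s = (sqrt ((s + k)\<^sup>2 + \<delta>) - sqrt ((s - k)\<^sup>2 + \<delta>)) / 2"

definition soft_trunc_deriv :: "real \<Rightarrow> real \<Rightarrow> real \<Rightarrow> real" where
  "soft_trunc_deriv \<delta> k s = ((s + k) / sqrt ((s + k)\<^sup>2 + \<delta>) - (s - k) / sqrt ((s - k)\<^sup>2 + \<delta>)) / 2"

lemma sqrt_pos_arg: "\<delta> > 0 \<Longrightarrow> 0 < sqrt ((t::real)\<^sup>2 + \<delta>)"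
  by (simp add: add_nonneg_pos)

lemma DERIV_sqrt_shift:
  assumes "\<delta> > 0" shows "((\<lambda>s. sqrt ((s + c)\<^sup>2 + \<delta>)) has_real_derivative (s + c) / sqrt ((s + c)\<^sup>2 + \<delta>)) (at s)"
proof -
  have p: "(s + c)\<^sup>2 + \<delta> > 0" using assms by (simp add: add_nonneg_pos)
  have 1: "((\<lambda>s. (s + c)\<^sup>2 + \<delta>) has_real_derivative 2 * (s + c)) (at s)"
    by (auto intro!: derivative_eq_intros)
  have e: "inverse r / 2 * (2 * t) = t / r" for r t :: real
    by (cases "r = 0") (simp_all add: field_simps)
  show ?thesis
    using DERIV_chain2[OF DERIV_real_sqrt[OF p] 1] by (simp only: e)
qed

lemma smooth1_soft_trunc:
  assumes d: "\<delta> > 0" shows "smooth1 (soft_trunc \<delta> k)"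
proof -
  define F where "F c s = sqrt ((s + c)\<^sup>2 + \<delta>)" for c s :: real
  define B where "B = (range (\<lambda>c s. s + c) \<union> range F) \<union> range (\<lambda>c s. inverse (F c s))"
  have DF: "(F c has_real_derivative (s + c) * inverse (F c s)) (at s)" for c s
    using DERIV_sqrt_shift[OF d, of c s] unfolding F_def[abs_def] divide_inverse .
  have Fne: "F c s \<noteq> 0" for c s using sqrt_pos_arg[OF d, of "s + c"] by (simp add: F_def)
  have 1: "(\<lambda>s. s + c) \<in> range (\<lambda>c s. s + c)" for c :: real by (rule rangeI[of "\<lambda>c s. s + c" c])
  have 2: "F c \<in> range F" for c by (rule rangeI[of F c])
  have 3: "(\<lambda>s. inverse (F c s)) \<in> range (\<lambda>c s. inverse (F c s))" for c
    by (rule rangeI[of "\<lambda>c s. inverse (F c s)" c])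
  have a1: "(\<lambda>s. s + c) \<in> alg B" for c by (rule alg_base) (unfold B_def, rule UnI1[OF UnI1[OF 1]])
  have a2: "F c \<in> alg B" for c by (rule alg_base) (unfold B_def, rule UnI1[OF UnI2[OF 2]])
  have a3: "(\<lambda>s. inverse (F c s)) \<in> alg B" for c by (rule alg_base) (unfold B_def, rule UnI2[OF 3])
  have "soft_trunc \<delta> k \<in> alg B"
  proof -
    have "(\<lambda>s. (1/2) * (F k s - F (-k) s)) \<in> alg B" by (rule alg_cmult[OF alg_diff[OF a2 a2]])
    moreover have "(\<lambda>s. (1/2) * (F k s - F (-k) s)) = soft_trunc \<delta> k"
      by (rule ext) (simp add: soft_trunc_def F_def)
    ultimately show ?thesis by simp
  qed
  moreover have "\<exists>g'\<in>alg B. \<forall>x. (g has_real_derivative g' x) (at x)" if "g \<in> B" for g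
  proof -
    from that consider c where "g = (\<lambda>s. s + c)" | c where "g = F c" | c where "g = (\<lambda>s. inverse (F c s))"
      unfolding B_def by auto
    then show ?thesis
    proof cases
      case (1 c)
      then show ?thesis by (intro bexI[of _ "\<lambda>_. 1"] alg_const allI) (auto intro!: derivative_eq_intros)
    next
      case (2 c)
      show ?thesis unfolding 2
        by (rule bexI[of _ "\<lambda>s. (s + c) * inverse (F c s)"], rule allI, rule DF, rule alg_mult[OF a1 a3])
    next
      case (3 c)
      have "((\<lambda>s. inverse (F c s)) has_real_derivative
          - (inverse (F c s) * ((s + c) * inverse (F c s)) * inverse (F c s))) (at s)" for s
        by (rule DERIV_inverse'[OF DF Fne])
      then have "((\<lambda>s. inverse (F c s)) has_real_derivative
          (-1) * (inverse (F c s) * ((s + c) * inverse (F c s)) * inverse (F c s))) (at s)" for s by simp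
      moreover have "(\<lambda>s. (-1) * (inverse (F c s) * ((s + c) * inverse (F c s)) * inverse (F c s))) \<in> alg B"
        by (rule alg_cmult[OF alg_mult[OF alg_mult[OF a3 alg_mult[OF a1 a3]] a3]])
      ultimately show ?thesis unfolding 3
        by (intro bexI[of _ "\<lambda>s. (-1) * (inverse (F c s) * ((s + c) * inverse (F c s)) * inverse (F c s))"] allI)
    qed
  qed
  ultimately show ?thesis by (rule smooth1_alg[rotated])
qed

lemma DERIV_soft_trunc:
  assumes "\<delta> > 0" shows "(soft_trunc \<delta> k has_real_derivative soft_trunc_deriv \<delta> k s) (at s)"
proof -
  have "((\<lambda>s. (sqrt ((s + k)\<^sup>2 + \<delta>) - sqrt ((s + -k)\<^sup>2 + \<delta>)) / 2) has_real_derivative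
     ((s + k) / sqrt ((s + k)\<^sup>2 + \<delta>) - (s + -k) / sqrt ((s + -k)\<^sup>2 + \<delta>)) / 2) (at s)"
    by (intro DERIV_cdivide DERIV_diff DERIV_sqrt_shift assms)
  then show ?thesis unfolding soft_trunc_def[abs_def] soft_trunc_deriv_def by (simp only: add_uminus_conv_diff)
qed

lemma abs_over_sqrt_le:
  assumes "\<delta> > 0" shows "\<bar>t / sqrt (t\<^sup>2 + \<delta>)\<bar> \<le> 1"
proof -
  have "\<bar>t\<bar> \<le> sqrt (t\<^sup>2 + \<delta>)" using assms by (intro real_le_rsqrt) simp
  moreover have "\<bar>t / sqrt (t\<^sup>2 + \<delta>)\<bar> = \<bar>t\<bar> / sqrt (t\<^sup>2 + \<delta>)"
    unfolding abs_divide using sqrt_pos_arg[OF assms, of t] by (simp only: abs_of_pos)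
  ultimately show ?thesis using sqrt_pos_arg[OF assms, of t] by (simp only: divide_le_eq_1_pos)
qed

lemma soft_trunc_deriv_le:
  assumes "\<delta> > 0" shows "\<bar>soft_trunc_deriv \<delta> k s\<bar> \<le> 1"
proof -
  have "\<bar>(a - b) / 2\<bar> \<le> 1" if "\<bar>a\<bar> \<le> 1" "\<bar>b\<bar> \<le> 1" for a b :: real
  proof -
    have "\<bar>a - b\<bar> \<le> 2" using that by linarith
    then show ?thesis by simp
  qed
  then show ?thesis unfolding soft_trunc_deriv_def using abs_over_sqrt_le[OF assms] by simp
qed

lemma soft_trunc_deriv_continuous:
  assumes "\<delta> > 0" shows "continuous_on UNIV (soft_trunc_deriv \<delta> k)"
  unfolding soft_trunc_deriv_def
  using sqrt_pos_arg[OF assms] by (intro continuous_intros) (simp_all add: less_imp_neq[symmetric])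

lemma Trunc_alt: "k > 0 \<Longrightarrow> Trunc k s = (\<bar>s + k\<bar> - \<bar>s - k\<bar>) / 2"
  by (auto simp: Trunc_def sign_def min_def)

lemma soft_trunc_limit:
  assumes "k > 0" shows "(\<lambda>n. soft_trunc (1 / real (Suc n)) k s) \<longlonglongrightarrow> Trunc k s"
proof -
  note inv = inverse_Suc_null
  have "(\<lambda>n. sqrt (t\<^sup>2 + 1 / real (Suc n))) \<longlonglongrightarrow> \<bar>t\<bar>" for t :: real
    using tendsto_real_sqrt[OF tendsto_add[OF tendsto_const[of "t\<^sup>2"] inv]] by simp
  then have "(\<lambda>n. soft_trunc (1 / real (Suc n)) k s) \<longlonglongrightarrow> (\<bar>s + k\<bar> - \<bar>s - k\<bar>) / 2"
    unfolding soft_trunc_def by (intro tendsto_divide tendsto_diff tendsto_const) simp_all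
  then show ?thesis by (simp only: Trunc_alt[OF assms])
qed

lemma soft_trunc_deriv_limit:
  "(\<lambda>n. soft_trunc_deriv (1 / real (Suc n)) k s) \<longlonglongrightarrow> (sgn (s + k) - sgn (s - k)) / 2"
proof -
  note inv = inverse_Suc_null
  have "(\<lambda>n. t / sqrt (t\<^sup>2 + 1 / real (Suc n))) \<longlonglongrightarrow> sgn t" for t :: real
  proof (cases "t = 0")
    case False
    have "(\<lambda>n. sqrt (t\<^sup>2 + 1 / real (Suc n))) \<longlonglongrightarrow> \<bar>t\<bar>"
      using tendsto_real_sqrt[OF tendsto_add[OF tendsto_const[of "t\<^sup>2"] inv]] by simp
    then have "(\<lambda>n. t / sqrt (t\<^sup>2 + 1 / real (Suc n))) \<longlonglongrightarrow> t / \<bar>t\<bar>"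
      using False by (intro tendsto_divide tendsto_const) simp_all
    then show ?thesis by (simp only: real_sgn_eq)
  qed simp
  then show ?thesis unfolding soft_trunc_deriv_def
    by (intro tendsto_divide tendsto_diff tendsto_const) simp_all
qed

lemma abs_Trunc_le: "k > 0 \<Longrightarrow> \<bar>Trunc k s\<bar> \<le> \<bar>s\<bar>" "k > 0 \<Longrightarrow> \<bar>Trunc k s\<bar> \<le> k"
  by (auto simp: Trunc_def sign_def min_def)

lemma continuous_Trunc: "k > 0 \<Longrightarrow> continuous_on UNIV (Trunc k)"
proof -
  assume k: "k > 0"
  have "continuous_on UNIV (\<lambda>s. (\<bar>s + k\<bar> - \<bar>s - k\<bar>) / 2)" by (intro continuous_intros) simp
  moreover have "Trunc k = (\<lambda>s. (\<bar>s + k\<bar> - \<bar>s - k\<bar>) / 2)" by (rule ext) (rule Trunc_alt[OF k])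
  ultimately show ?thesis by simp
qed

context open_domain
begin

text \<open>The smoothed truncations produce the factor 1/2 on the level sets \<bar>u\<bar> = k.
Truncating at levels that increase strictly to k replaces this value by 0, so that the factor
becomes an indicator function. In particular the gradient vanishes almost everywhere on the level
sets.\<close>

theorem W10g_Trunc:
  assumes W: "W10g q u g" and q: "q \<ge> 1" and k: "k > 0"
  shows "W10g q (\<lambda>x. Trunc k (u x)) (\<lambda>x i. of_bool (\<bar>u x\<bar> < k) * g x i)"
proof -
  define \<gamma> where "\<gamma> k s = (sgn (s + k) - sgn (s - k)) / 2" for k s :: real
  have half: "W10g q (\<lambda>x. Trunc k (u x)) (\<lambda>x i. \<gamma> k (u x) * g x i)" if k: "k > 0" for k
  proof (rule chain_rule_pointwise_limit[OF W q])
    fix n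
    have d: "1 / real (Suc n) > 0" by simp
    have 0: "soft_trunc (1 / real (Suc n)) k 0 = 0" by (simp add: soft_trunc_def)
    show "W10g q (\<lambda>x. soft_trunc (1 / real (Suc n)) k (u x)) (\<lambda>x i. soft_trunc_deriv (1 / real (Suc n)) k (u x) * g x i)"
      by (rule chain_rule_smooth[OF W q DERIV_soft_trunc[OF d] soft_trunc_deriv_continuous[OF d]
           soft_trunc_deriv_le[OF d] 0 smooth1_soft_trunc[OF d]])
    show "\<bar>soft_trunc (1 / real (Suc n)) k s\<bar> \<le> \<bar>s\<bar>" for s
      using lipschitz_of_deriv[OF DERIV_soft_trunc[OF d] soft_trunc_deriv_le[OF d], of k s 0] 0 by simp
    show "\<bar>soft_trunc_deriv (1 / real (Suc n)) k s\<bar> \<le> 1" for s by (rule soft_trunc_deriv_le[OF d])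
  next
    show "(\<lambda>n. soft_trunc (1 / real (Suc n)) k s) \<longlonglongrightarrow> Trunc k s" for s by (rule soft_trunc_limit[OF k])
    show "(\<lambda>n. soft_trunc_deriv (1 / real (Suc n)) k s) \<longlonglongrightarrow> \<gamma> k s" for s
      unfolding \<gamma>_def by (rule soft_trunc_deriv_limit)
  qed
  \<comment> \<open>The shift by two keeps the levels positive.\<close>
  define K where "K n = k * (1 - 1 / real (Suc (Suc n)))" for n
  have "1 / real (Suc (Suc n)) < 1" "0 < 1 / real (Suc (Suc n))" for n by simp_all
  then have K: "0 < K n" "K n < k" for n
    unfolding K_def using k by (simp_all add: mult_less_cancel_left_pos[of k _ 1, simplified])
  have inv: "(\<lambda>n. 1 / real (Suc (Suc n))) \<longlonglongrightarrow> 0"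
    using LIMSEQ_Suc[OF LIMSEQ_inverse_real_of_nat] by (simp add: inverse_eq_divide)
  have Kl: "K \<longlonglongrightarrow> k"
    using tendsto_mult[OF tendsto_const[of k] tendsto_diff[OF tendsto_const[of 1] inv]] by (simp add: K_def[abs_def])
  show ?thesis
  proof (rule chain_rule_pointwise_limit[OF W q half[OF K(1)]])
    show "\<bar>Trunc (K n) s\<bar> \<le> \<bar>s\<bar>" for n s by (rule abs_Trunc_le(1)[OF K(1)])
    show "\<bar>\<gamma> (K n) s\<bar> \<le> 1" for n s by (auto simp: \<gamma>_def sgn_if)
    show "(\<lambda>n. Trunc (K n) s) \<longlonglongrightarrow> Trunc k s" for s
      unfolding Trunc_def by (intro tendsto_mult tendsto_min tendsto_const Kl)
    show "(\<lambda>n. \<gamma> (K n) s) \<longlonglongrightarrow> of_bool (\<bar>s\<bar> < k)" for s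
    proof (cases "\<bar>s\<bar> < k")
      case True
      have "eventually (\<lambda>n. \<bar>s\<bar> < K n) sequentially" by (rule order_tendstoD(1)[OF Kl True])
      then have "eventually (\<lambda>n. \<gamma> (K n) s = 1) sequentially"
        by eventually_elim (auto simp: \<gamma>_def sgn_if)
      then show ?thesis using True by (simp add: tendsto_eventually)
    next
      case False
      have "\<gamma> (K n) s = 0" for n using K[of n] False by (auto simp: \<gamma>_def sgn_if)
      then show ?thesis using False by simp
    qed
  qed
qed

end

subsection \<open>The function psi\<close>

definition psi_deriv :: "real \<Rightarrow> real" where
  "psi_deriv s = 1 / ((1 + \<bar>s\<bar>) * (1 + ln (1 + \<bar>s\<bar>))\<^sup>2)"

lemma one_plus_ln_ge: "1 \<le> 1 + ln (1 + \<bar>s :: real\<bar>)"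
  by simp

lemma psi_deriv_bound: "\<bar>psi_deriv s\<bar> \<le> 1"
proof -
  have "1 * 1 \<le> (1 + \<bar>s\<bar>) * (1 + ln (1 + \<bar>s\<bar>))\<^sup>2"
    using one_plus_ln_ge[of s] by (intro mult_mono one_le_power) simp_all
  then show ?thesis unfolding psi_deriv_def by (simp add: divide_le_eq)
qed

lemma psi_deriv_continuous: "continuous_on UNIV psi_deriv"
proof -
  have "1 + ln (1 + \<bar>s\<bar>) \<noteq> 0" "1 + \<bar>s\<bar> \<noteq> 0" for s :: real using one_plus_ln_ge[of s] by linarith+
  then show ?thesis unfolding psi_deriv_def
    by (intro continuous_intros) simp_all
qed

lemma DERIV_psi_pos:
  assumes "t > -1" "1 + ln (1 + t) \<noteq> 0"
  shows "((\<lambda>t. ln (1 + t) / (1 + ln (1 + t))) has_real_derivative 1 / ((1 + t) * (1 + ln (1 + t))\<^sup>2)) (at t)"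
  using assms
  by (auto intro!: derivative_eq_intros simp: field_simps power2_eq_square)

text \<open>At 0 the difference quotient of the odd function psi is even in the increment, and hence
is the one of its restriction to the right half line.\<close>

lemma DERIV_psi: "(psi has_real_derivative psi_deriv s) (at s)"
proof -
  define p where "p t = ln (1 + t) / (1 + ln (1 + t))" for t :: real
  have Dp: "(p has_real_derivative psi_deriv t) (at t)" if "t \<ge> 0" for t
  proof -
    have "1 \<le> 1 + ln (1 + t)" using that by simp
    then have "1 + ln (1 + t) \<noteq> 0" by linarith
    then show ?thesis using DERIV_psi_pos[of t] that unfolding p_def[abs_def] psi_deriv_def by simp
  qed
  consider "s > 0" | "s < 0" | "s = 0" by linarith
  then show ?thesis
  proof cases
    case 1
    have "eventually (\<lambda>t. t \<in> {0<..}) (nhds s)" using 1 by (intro eventually_nhds_in_open) auto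
    then have "eventually (\<lambda>t. p t = psi t) (nhds s)"
      by eventually_elim (simp add: psi_def p_def sign_def)
    from DERIV_cong_ev[OF refl this refl] show ?thesis using Dp[of s] 1 by simp
  next
    case 2
    have "((\<lambda>t. - t) has_real_derivative -1) (at s)" by (auto intro!: derivative_eq_intros)
    moreover have "(p has_real_derivative psi_deriv (- s)) (at (- s))" using Dp[of "- s"] 2 by simp
    ultimately have "((\<lambda>t. p (- t)) has_real_derivative psi_deriv (- s) * -1) (at s)"
      by (rule DERIV_chain2[rotated])
    then have "((\<lambda>t. - p (- t)) has_real_derivative - (psi_deriv (- s) * -1)) (at s)" by (rule DERIV_minus)
    then have *: "((\<lambda>t. - p (- t)) has_real_derivative psi_deriv s) (at s)" by (simp add: psi_deriv_def)
    have "eventually (\<lambda>t. t \<in> {..<0}) (nhds s)" using 2 by (intro eventually_nhds_in_open) auto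
    then have "eventually (\<lambda>t. - p (- t) = psi t) (nhds s)"
      by eventually_elim (simp add: psi_def p_def sign_def)
    from DERIV_cong_ev[OF refl this refl] show ?thesis using * by simp
  next
    case 3
    have "((\<lambda>h. (p (0 + h) - p 0) / h) \<longlongrightarrow> 1) (at 0)"
      using Dp[of 0] by (simp add: DERIV_def psi_deriv_def)
    then have "((\<lambda>h. p h / h) \<longlongrightarrow> 1) (at 0)" by (simp add: p_def)
    moreover have "filterlim (\<lambda>h::real. \<bar>h\<bar>) (at 0) (at 0)"
      unfolding filterlim_at
      by (auto simp: eventually_at_filter intro!: tendsto_rabs_zero tendsto_ident_at)
    ultimately have "((\<lambda>h. p \<bar>h\<bar> / \<bar>h\<bar>) \<longlongrightarrow> 1) (at 0)" by (rule filterlim_compose)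
    moreover have "p \<bar>h\<bar> / \<bar>h\<bar> = psi h / h" for h
      by (simp add: psi_def p_def sign_def)
    ultimately have "((\<lambda>h. psi h / h) \<longlongrightarrow> 1) (at 0)" by simp
    then show ?thesis using 3 by (simp add: DERIV_def psi_deriv_def psi_def)
  qed
qed

context open_domain
begin

lemma weak_grad_psi:
  assumes "W10g q u g" "q \<ge> 1"
  shows "has_weak_grad N \<Omega> (\<lambda>x. psi (u x)) (\<lambda>x i. psi_deriv (u x) * g x i)"
proof -
  have "psi 0 = 0" by (simp add: psi_def)
  from chain_rule_approximation[OF assms DERIV_psi psi_deriv_continuous psi_deriv_bound this]
  show ?thesis by blast
qed

end

section \<open>Weak compactness through midpoint hulls\<close>

lemma Lp_2_iff: "Lp M 2 f \<longleftrightarrow> f \<in> borel_measurable M \<and> integrable M (\<lambda>x. (f x)\<^sup>2)"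
  by (simp add: Lp_def)

text \<open>Young's inequality with a weight; it takes the place of the Cauchy-Schwarz inequality.\<close>

lemma abs_mult_le_weighted:
  fixes a b \<delta> :: real
  assumes "\<delta> > 0" shows "\<bar>a * b\<bar> \<le> \<delta> * a\<^sup>2 + b\<^sup>2 / \<delta>"
proof -
  have "0 \<le> (\<delta> * \<bar>a\<bar> - \<bar>b\<bar>)\<^sup>2" by simp
  then have "2 * \<delta> * \<bar>a\<bar> * \<bar>b\<bar> \<le> \<delta>\<^sup>2 * a\<^sup>2 + b\<^sup>2"
    by (simp add: power2_diff power_mult_distrib algebra_simps)
  moreover have "0 \<le> \<delta> * (\<bar>a\<bar> * \<bar>b\<bar>)" using assms by simp
  ultimately have "\<delta> * \<bar>a * b\<bar> \<le> \<delta>\<^sup>2 * a\<^sup>2 + b\<^sup>2" by (simp add: abs_mult)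
  also have "\<dots> = \<delta> * (\<delta> * a\<^sup>2 + b\<^sup>2 / \<delta>)" using assms by (simp add: field_simps power2_eq_square)
  finally show ?thesis using assms by (simp only: mult_le_cancel_left_pos)
qed

lemma L2_mult_integrable:
  assumes "Lp M 2 f" "Lp M 2 g" shows "integrable M (\<lambda>x. f x * g x :: real)"
proof (rule Bochner_Integration.integrable_bound)
  have m: "f \<in> borel_measurable M" "g \<in> borel_measurable M" using assms by (simp_all add: Lp_def)
  show "integrable M (\<lambda>x. (f x)\<^sup>2 + (g x)\<^sup>2)" using assms by (simp add: Lp_2_iff)
  show "(\<lambda>x. f x * g x) \<in> borel_measurable M" by (rule borel_measurable_times[OF m])
  show "AE x in M. norm (f x * g x) \<le> norm ((f x)\<^sup>2 + (g x)\<^sup>2)"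
    by (rule AE_I2) (use abs_mult_le_weighted[of 1] in simp)
qed

lemma L2_pairing_null:
  assumes b: "Lp M 2 b" and f: "Lq_null M 2 f"
  shows "(\<lambda>n. LINT x|M. b x * f n x :: real) \<longlonglongrightarrow> 0"
proof (rule LIMSEQ_I)
  fix e :: real assume e: "e > 0"
  define B where "B = (LINT x|M. (b x)\<^sup>2)"
  have B: "B \<ge> 0" by (simp add: B_def)
  obtain \<delta> where \<delta>: "\<delta> > 0" and \<delta>B: "\<delta> * B \<le> e / 2"
    by (rule small_factor[OF B e]) (rule that)
  have "(\<lambda>n. LINT x|M. (f n x)\<^sup>2) \<longlonglongrightarrow> 0" using f by (simp add: Lq_null_def)
  then have "(\<lambda>n. (LINT x|M. (f n x)\<^sup>2) / \<delta>) \<longlonglongrightarrow> 0" using tendsto_divide_zero by blast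
  from order_tendstoD(2)[OF this, of "e / 2"] e
  obtain n0 where n0: "\<And>n. n \<ge> n0 \<Longrightarrow> (LINT x|M. (f n x)\<^sup>2) / \<delta> < e / 2"
    unfolding eventually_sequentially by auto
  show "\<exists>no. \<forall>n\<ge>no. norm ((LINT x|M. b x * f n x) - 0) < e"
  proof (intro exI[of _ n0] allI impI)
    fix n assume n: "n \<ge> n0"
    have fn: "Lp M 2 (f n)" by (rule Lq_null_Lp[OF f])
    have ib: "integrable M (\<lambda>x. (b x)\<^sup>2)" and "integrable M (\<lambda>x. (f n x)\<^sup>2)"
      using b fn by (simp_all add: Lp_2_iff)
    then have i: "integrable M (\<lambda>x. \<delta> * (b x)\<^sup>2 + (f n x)\<^sup>2 / \<delta>)" by simp
    have "\<bar>LINT x|M. b x * f n x\<bar> \<le> (LINT x|M. \<bar>b x * f n x\<bar>)" by (rule integral_abs_bound)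
    also have "\<dots> \<le> (LINT x|M. \<delta> * (b x)\<^sup>2 + (f n x)\<^sup>2 / \<delta>)"
      by (rule integral_mono[OF integrable_abs[OF L2_mult_integrable[OF b fn]] i]) (rule abs_mult_le_weighted[OF \<delta>])
    also have "\<dots> = \<delta> * B + (LINT x|M. (f n x)\<^sup>2) / \<delta>"
      using \<open>integrable M (\<lambda>x. (f n x)\<^sup>2)\<close> ib by (simp add: B_def)
    also have "\<dots> < e" using \<delta>B n0[OF n] by linarith
    finally show "norm ((LINT x|M. b x * f n x) - 0) < e" by simp
  qed
qed

text \<open>A Cauchy sequence in the quadratic mean is Cauchy in the mean, hence converges almost
everywhere along a subsequence. Fatou's lemma turns the Cauchy estimate into an estimate for the
limit.\<close>

lemma (in finite_measure) L2_complete: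
  fixes f :: "nat \<Rightarrow> 'a \<Rightarrow> real"
  assumes f: "\<And>n. Lp M 2 (f n)" and c: "\<And>m l. m \<le> l \<Longrightarrow> (LINT x|M. (f m x - f l x)\<^sup>2) \<le> \<rho> m" and \<rho>: "\<rho> \<longlonglongrightarrow> 0"
  obtains h where "Lp M 2 h" "\<And>m. (LINT x|M. (f m x - h x)\<^sup>2) \<le> \<rho> m"
proof -
  have d: "Lp M 2 (\<lambda>x. f m x - f l x)" for m l by (rule Lp_diff[OF f f]) simp
  have id: "integrable M (\<lambda>x. (f m x - f l x)\<^sup>2)" for m l using d[of m l] by (simp add: Lp_2_iff)
  have i: "integrable M (f n)" for n by (rule Lp_imp_integrable[OF f]) simp
  have mf[measurable]: "f n \<in> borel_measurable M" for n using f by (simp add: Lp_def)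
  have \<rho>0: "\<rho> m \<ge> 0" for m using c[of m m] by simp
  have L1: "\<exists>n. \<forall>i\<ge>n. \<forall>j\<ge>n. (LINT x|M. norm (f i x - f j x)) < e" if e: "e > 0" for e
  proof -
    define \<mu> where "\<mu> = measure M (space M)"
    have \<mu>: "\<mu> \<ge> 0" by (simp add: \<mu>_def)
    obtain \<delta> where \<delta>: "\<delta> > 0" and \<delta>\<mu>: "\<delta> * \<mu> \<le> e / 2"
      by (rule small_factor[OF \<mu> e]) (rule that)
    have "(\<lambda>n. \<rho> n / \<delta>) \<longlonglongrightarrow> 0" using tendsto_divide_zero[OF \<rho>] by blast
    from order_tendstoD(2)[OF this, of "e / 2"] e
    obtain n0 where n0: "\<And>n. n \<ge> n0 \<Longrightarrow> \<rho> n / \<delta> < e / 2"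
      unfolding eventually_sequentially by auto
    have le: "(LINT x|M. norm (f i x - f j x)) < e" if "n0 \<le> i" "i \<le> j" for i j
    proof -
      have "(LINT x|M. norm (f i x - f j x)) \<le> (LINT x|M. \<delta> + (f i x - f j x)\<^sup>2 / \<delta>)"
      proof (rule integral_mono)
        show "integrable M (\<lambda>x. norm (f i x - f j x))" using i by simp
        show "integrable M (\<lambda>x. \<delta> + (f i x - f j x)\<^sup>2 / \<delta>)" using id by simp
        show "norm (f i x - f j x) \<le> \<delta> + (f i x - f j x)\<^sup>2 / \<delta>" for x
          using abs_mult_le_weighted[OF \<delta>, of 1 "f i x - f j x"] by simp
      qed
      also have "\<dots> = \<delta> * \<mu> + (LINT x|M. (f i x - f j x)\<^sup>2) / \<delta>" using id by (simp add: \<mu>_def)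
      also have "\<dots> \<le> \<delta> * \<mu> + \<rho> i / \<delta>" using c[OF that(2)] \<delta> by (simp add: divide_right_mono)
      also have "\<dots> < e" using n0[OF that(1)] \<delta>\<mu> by linarith
      finally show ?thesis .
    qed
    show ?thesis
    proof (intro exI[of _ n0] allI impI)
      fix i j assume "n0 \<le> i" "n0 \<le> j"
      show "(LINT x|M. norm (f i x - f j x)) < e"
      proof (cases "i \<le> j")
        case True then show ?thesis using le \<open>n0 \<le> i\<close> by blast
      next
        case False
        then have "(LINT x|M. norm (f j x - f i x)) < e" using le[of j i] \<open>n0 \<le> j\<close> by simp
        then show ?thesis by (subst norm_minus_commute)
      qed
    qed
  qed
  obtain r where r: "strict_mono r" "AE x in M. Cauchy (\<lambda>i. f (r i) x)"
    using cauchy_L1_AE_cauchy_subseq[OF i L1] by blast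
  define h where "h x = lim (\<lambda>j. f (r j) x)" for x
  have mh[measurable]: "h \<in> borel_measurable M" unfolding h_def by measurable
  have conv: "AE x in M. (\<lambda>j. f (r j) x) \<longlonglongrightarrow> h x"
    using r(2) by eventually_elim (simp add: h_def Cauchy_convergent_iff convergent_LIMSEQ_iff)
  have nn: "(\<integral>\<^sup>+x. ennreal ((f m x - h x)\<^sup>2) \<partial>M) \<le> ennreal (\<rho> m)" for m
  proof -
    have "(\<integral>\<^sup>+x. ennreal ((f m x - h x)\<^sup>2) \<partial>M) = (\<integral>\<^sup>+x. liminf (\<lambda>j. ennreal ((f m x - f (r j) x)\<^sup>2)) \<partial>M)"
    proof (rule nn_integral_cong_AE)
      show "AE x in M. ennreal ((f m x - h x)\<^sup>2) = liminf (\<lambda>j. ennreal ((f m x - f (r j) x)\<^sup>2))"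
        using conv
      proof eventually_elim
        case (elim x)
        have "(\<lambda>j. ennreal ((f m x - f (r j) x)\<^sup>2)) \<longlonglongrightarrow> ennreal ((f m x - h x)\<^sup>2)"
          by (intro tendsto_ennrealI tendsto_power tendsto_diff tendsto_const elim)
        from lim_imp_Liminf[OF sequentially_bot this] show ?case by simp
      qed
    qed
    also have "\<dots> \<le> liminf (\<lambda>j. \<integral>\<^sup>+x. ennreal ((f m x - f (r j) x)\<^sup>2) \<partial>M)"
      by (rule nn_integral_liminf) measurable
    also have "\<dots> \<le> ennreal (\<rho> m)"
    proof (rule Liminf_le[OF sequentially_bot])
      show "eventually (\<lambda>j. (\<integral>\<^sup>+x. ennreal ((f m x - f (r j) x)\<^sup>2) \<partial>M) \<le> ennreal (\<rho> m)) sequentially"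
        unfolding eventually_sequentially
      proof (intro exI[of _ m] allI impI)
        fix j assume "m \<le> j"
        then have "m \<le> r j" using seq_suble[OF r(1), of j] by simp
        then have "(LINT x|M. (f m x - f (r j) x)\<^sup>2) \<le> \<rho> m" by (rule c)
        moreover have "(\<integral>\<^sup>+x. ennreal ((f m x - f (r j) x)\<^sup>2) \<partial>M) = ennreal (LINT x|M. (f m x - f (r j) x)\<^sup>2)"
          by (rule nn_integral_eq_integral[OF id]) simp
        ultimately show "(\<integral>\<^sup>+x. ennreal ((f m x - f (r j) x)\<^sup>2) \<partial>M) \<le> ennreal (\<rho> m)"
          by (simp add: ennreal_leI)
      qed
    qed
    finally show ?thesis .
  qed
  have ih: "integrable M (\<lambda>x. (f m x - h x)\<^sup>2)" for m
  proof (rule integrableI_nonneg)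
    show "(\<integral>\<^sup>+x. ennreal ((f m x - h x)\<^sup>2) \<partial>M) < \<infinity>"
      using nn[of m] by (rule le_less_trans) simp
    show "(\<lambda>x. (f m x - h x)\<^sup>2) \<in> borel_measurable M" by measurable
    show "AE x in M. 0 \<le> (f m x - h x)\<^sup>2" by simp
  qed
  have "Lp M 2 (\<lambda>x. f 0 x - h x)" unfolding Lp_2_iff using ih by simp
  from Lp_diff[OF f[of 0] this] have "Lp M 2 h" by simp
  moreover have "(LINT x|M. (f m x - h x)\<^sup>2) \<le> \<rho> m" for m
  proof -
    have "(\<integral>\<^sup>+x. ennreal ((f m x - h x)\<^sup>2) \<partial>M) = ennreal (LINT x|M. (f m x - h x)\<^sup>2)"
      by (rule nn_integral_eq_integral[OF ih]) simp
    then show ?thesis using nn[of m] \<rho>0 by simp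
  qed
  ultimately show thesis by (rule that)
qed

text \<open>Functions paired with their gradients, obtained from the tail of a sequence by taking
midpoints repeatedly. Midpoints alone suffice for the parallelogram argument, and rule induction on
them is simpler than arbitrary convex combinations.\<close>

inductive mid_hull :: "(nat \<Rightarrow> 'a \<Rightarrow> real) \<Rightarrow> (nat \<Rightarrow> 'a \<Rightarrow> rvec) \<Rightarrow> nat \<Rightarrow> ('a \<Rightarrow> real) \<Rightarrow> ('a \<Rightarrow> rvec) \<Rightarrow> bool"
  for z g m where
  mid_hull_base: "m \<le> n \<Longrightarrow> mid_hull z g m (z n) (g n)"
| mid_hull_mid: "mid_hull z g m w h \<Longrightarrow> mid_hull z g m w' h' \<Longrightarrow>
    mid_hull z g m (\<lambda>x. (1/2) * w x + (1/2) * w' x) (\<lambda>x i. (1/2) * h x i + (1/2) * h' x i)"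

lemma mid_hull_mono:
  assumes "mid_hull z g l w h" "m \<le> l" shows "mid_hull z g m w h"
  using assms(1)
proof induction
  case (mid_hull_base n) then show ?case using assms(2) by (intro mid_hull.mid_hull_base) simp
next
  case (mid_hull_mid w h w' h') then show ?case by (intro mid_hull.mid_hull_mid)
qed

lemma mid_hull_close:
  assumes "mid_hull z g m w h" "\<And>n. m \<le> n \<Longrightarrow> \<bar>z n x - c\<bar> \<le> e" shows "\<bar>w x - c\<bar> \<le> e"
  using assms(1)
proof induction
  case (mid_hull_base n) then show ?case using assms(2) by simp
next
  case (mid_hull_mid w h w' h')
  have "(1/2) * w x + (1/2) * w' x - c = ((w x - c) + (w' x - c)) / 2" by (simp add: field_simps)
  moreover have "\<bar>(w x - c) + (w' x - c)\<bar> \<le> 2 * e" using mid_hull_mid by linarith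
  ultimately show ?case by simp
qed

text \<open>The parallelogram identity.\<close>

lemma dotN_midpoint:
  "dotN N (\<lambda>i. (1/2) * a i + (1/2) * b i) (\<lambda>i. (1/2) * a i + (1/2) * b i) =
   (1/2) * dotN N a a + (1/2) * dotN N b b - (1/4) * dotN N (\<lambda>i. a i - b i) (\<lambda>i. a i - b i)"
proof -
  have "((1/2) * a i + (1/2) * b i) * ((1/2) * a i + (1/2) * b i) =
     (1/2) * (a i * a i) + (1/2) * (b i * b i) - (1/4) * ((a i - b i) * (a i - b i))" for i
    by (simp add: field_simps)
  then show ?thesis unfolding dotN_def
    by (simp only: sum.distrib sum_subtractf sum_distrib_left)
qed

lemma dotN_lin_right: "dotN N b (\<lambda>i. c * u i + d * v i) = c * dotN N b u + d * dotN N b v"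
proof -
  have "b i * (c * u i + d * v i) = c * (b i * u i) + d * (b i * v i)" for i by (simp add: algebra_simps)
  then show ?thesis unfolding dotN_def by (simp only: sum.distrib sum_distrib_left)
qed

lemma dotN_nonneg: "0 \<le> dotN N v v"
  unfolding dotN_def by (intro sum_nonneg) simp

lemma dotN_le_half: "dotN N a b \<le> (1/2) * dotN N a a + (1/2) * dotN N b b"
proof -
  have "a i * b i \<le> (1/2) * (a i * a i) + (1/2) * (b i * b i)" for i
    using sum_squares_bound[of "a i" "b i"] by (simp add: power2_eq_square)
  then have "(\<Sum>i<N. a i * b i) \<le> (\<Sum>i<N. (1/2) * (a i * a i) + (1/2) * (b i * b i))" by (rule sum_mono)
  then show ?thesis unfolding dotN_def by (simp only: sum.distrib sum_distrib_left)
qed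

context open_domain
begin

definition L2field :: "(rvec \<Rightarrow> rvec) \<Rightarrow> bool" where
  "L2field g \<longleftrightarrow> (\<forall>i<N. Lp M 2 (\<lambda>x. g x i))"

definition energy :: "(rvec \<Rightarrow> rvec) \<Rightarrow> real" where
  "energy g = (LINT x|M. dotN N (g x) (g x))"

lemma dotN_integrable: "L2field a \<Longrightarrow> L2field b \<Longrightarrow> integrable M (\<lambda>x. dotN N (a x) (b x))"
  unfolding dotN_def L2field_def by (intro Bochner_Integration.integrable_sum L2_mult_integrable) simp_all

lemma L2field_lincomb: "L2field a \<Longrightarrow> L2field b \<Longrightarrow> L2field (\<lambda>x i. c * a x i + d * b x i)"
  unfolding L2field_def by (intro allI impI Lp_add(1) Lp_cmult(1)) simp_all

lemma L2field_diff: "L2field a \<Longrightarrow> L2field b \<Longrightarrow> L2field (\<lambda>x i. a x i - b x i)"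
  using L2field_lincomb[of a b 1 "-1"] by simp

lemma W10g_L2field: "W10g 2 u g \<Longrightarrow> L2field g"
  unfolding L2field_def using W10gD(3) by blast

lemma energy_nonneg: "0 \<le> energy g"
  unfolding energy_def by (rule integral_nonneg_AE) (simp add: dotN_nonneg)

lemma energy_midpoint:
  assumes "L2field a" "L2field b"
  shows "energy (\<lambda>x i. (1/2) * a x i + (1/2) * b x i) =
    (1/2) * energy a + (1/2) * energy b - (1/4) * energy (\<lambda>x i. a x i - b x i)"
proof -
  have i: "integrable M (\<lambda>x. dotN N (a x) (a x))" "integrable M (\<lambda>x. dotN N (b x) (b x))"
    "integrable M (\<lambda>x. dotN N (\<lambda>i. a x i - b x i) (\<lambda>i. a x i - b x i))"
    using dotN_integrable[OF assms(1,1)] dotN_integrable[OF assms(2,2)]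
      dotN_integrable[OF L2field_diff[OF assms] L2field_diff[OF assms]] by simp_all
  then show ?thesis unfolding energy_def dotN_midpoint by simp
qed

lemma component_le_energy:
  assumes "L2field g" "i < N" shows "(LINT x|M. (g x i)\<^sup>2) \<le> energy g"
  unfolding energy_def
proof (rule integral_mono)
  show "integrable M (\<lambda>x. (g x i)\<^sup>2)" using assms by (simp add: L2field_def Lp_2_iff)
  show "integrable M (\<lambda>x. dotN N (g x) (g x))" by (rule dotN_integrable[OF assms(1,1)])
  show "(g x i)\<^sup>2 \<le> dotN N (g x) (g x)" for x
    unfolding dotN_def power2_eq_square using assms(2)
    by (intro member_le_sum[of i "{..<N}" "\<lambda>i. g x i * g x i"]) simp_all
qed

lemma mid_hull_W10g:
  assumes "\<And>n. W10g 2 (z n) (g n)" "mid_hull z g m w h" shows "W10g 2 w h"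
  using assms(2)
proof induction
  case (mid_hull_base n) then show ?case using assms(1) by simp
next
  case (mid_hull_mid w h w' h') then show ?case by (intro W10g_lincomb) simp_all
qed

lemma mid_hull_pairing:
  assumes W: "\<And>n. W10g 2 (z n) (g n)" and b: "L2field b" and "mid_hull z g m w h"
    and c: "\<And>n. m \<le> n \<Longrightarrow> (LINT x|M. dotN N (b x) (g n x)) \<le> c"
  shows "(LINT x|M. dotN N (b x) (h x)) \<le> c"
  using assms(3)
proof induction
  case (mid_hull_base n) then show ?case using c by simp
next
  case (mid_hull_mid w h w' h')
  have "L2field h" "L2field h'"
    using mid_hull_W10g[OF W mid_hull_mid(1)] mid_hull_W10g[OF W mid_hull_mid(2)] W10g_L2field by auto
  then have i: "integrable M (\<lambda>x. dotN N (b x) (h x))" "integrable M (\<lambda>x. dotN N (b x) (h' x))"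
    using dotN_integrable[OF b] by auto
  have "(LINT x|M. dotN N (b x) (\<lambda>i. (1/2) * h x i + (1/2) * h' x i)) =
     (1/2) * (LINT x|M. dotN N (b x) (h x)) + (1/2) * (LINT x|M. dotN N (b x) (h' x))"
    unfolding dotN_lin_right using i by simp
  then show ?case using mid_hull_mid by simp
qed

text \<open>The infimum of the energy over the hull of a tail increases with the tail. For two
elements of nearly minimal energy, the midpoint cannot have much smaller energy, so the
parallelogram identity forces them to be close.\<close>

lemma mid_hull_cauchy:
  assumes W: "\<And>n. W10g 2 (z n) (g n)" and R: "\<And>n. energy (g n) \<le> R"
  obtains w h \<rho> where "\<And>m. mid_hull z g m (w m) (h m)" "\<rho> \<longlonglongrightarrow> 0"
    "\<And>m l. m \<le> l \<Longrightarrow> energy (\<lambda>x i. h m x i - h l x i) \<le> \<rho> m"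
proof -
  define S where "S m = {energy h | w h. mid_hull z g m w h}" for m
  define d where "d m = Inf (S m)" for m
  have ne: "S m \<noteq> {}" for m using mid_hull_base[of m m z g] unfolding S_def by blast
  have bd: "bdd_below (S m)" for m
    by (rule bdd_belowI[of _ 0]) (use energy_nonneg in \<open>auto simp: S_def\<close>)
  have d_le: "d m \<le> energy h" if "mid_hull z g m w h" for m w h
    unfolding d_def by (rule cInf_lower[OF _ bd]) (use that in \<open>auto simp: S_def\<close>)
  have mono: "d m \<le> d l" if "m \<le> l" for m l
    unfolding d_def[of l] 
  proof (rule cInf_greatest[OF ne])
    fix e assume "e \<in> S l"
    then obtain w h where "e = energy h" "mid_hull z g l w h" unfolding S_def by blast
    then show "d m \<le> e" using d_le[OF mid_hull_mono[OF _ that]] by simp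
  qed
  have dR: "d m \<le> R" for m
    using d_le[OF mid_hull_base[of m m z g]] R[of m] by simp
  obtain D where D: "d \<longlonglongrightarrow> D" "\<And>m. d m \<le> D"
    using incseq_convergent[of d R] mono dR unfolding incseq_def by blast
  have "\<exists>p. mid_hull z g m (fst p) (snd p) \<and> energy (snd p) < d m + 1 / real (Suc m)" for m
  proof -
    have "Inf (S m) < d m + 1 / real (Suc m)" unfolding d_def by simp
    then obtain e where "e \<in> S m" "e < d m + 1 / real (Suc m)"
      using cInf_lessD[OF ne] by blast
    then obtain w h where "mid_hull z g m w h" "energy h < d m + 1 / real (Suc m)" unfolding S_def by blast
    then show ?thesis by (intro exI[of _ "(w, h)"]) simp
  qed
  then obtain p where p: "\<And>m. mid_hull z g m (fst (p m)) (snd (p m))"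
    "\<And>m. energy (snd (p m)) < d m + 1 / real (Suc m)" by metis
  \<comment> \<open>Four times the deviation of the midpoint from the minimum, with d l bounded by its limit
    D.\<close>
  define \<rho> where "\<rho> m = 2 * (D - d m) + 4 * (1 / real (Suc m))" for m
  show thesis
  proof (rule that[of "\<lambda>m. fst (p m)" "\<lambda>m. snd (p m)" \<rho>])
    show "mid_hull z g m (fst (p m)) (snd (p m))" for m by (rule p(1))
    note inv = inverse_Suc_null
    have "(\<lambda>m. 2 * (D - d m) + 4 * (1 / real (Suc m))) \<longlonglongrightarrow> 2 * (D - D) + 4 * 0"
      by (intro tendsto_add tendsto_mult tendsto_diff tendsto_const D(1) inv)
    then show "\<rho> \<longlonglongrightarrow> 0" by (simp add: \<rho>_def[abs_def])
    fix m l :: nat assume ml: "m \<le> l"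
    have hm: "L2field (snd (p m))" "L2field (snd (p l))"
      using mid_hull_W10g[OF W p(1)] W10g_L2field by auto
    have "mid_hull z g m (\<lambda>x. (1/2) * fst (p m) x + (1/2) * fst (p l) x)
        (\<lambda>x i. (1/2) * snd (p m) x i + (1/2) * snd (p l) x i)"
      by (rule mid_hull_mid[OF p(1) mid_hull_mono[OF p(1) ml]])
    from d_le[OF this] have "d m \<le> (1/2) * energy (snd (p m)) + (1/2) * energy (snd (p l))
        - (1/4) * energy (\<lambda>x i. snd (p m) x i - snd (p l) x i)"
      unfolding energy_midpoint[OF hm] .
    moreover have "1 / real (Suc l) \<le> 1 / real (Suc m)" using ml by (simp add: frac_le)
    moreover have "E \<le> 2 * (D - dm) + 4 * a" if "dm \<le> (1/2) * A + (1/2) * B - (1/4) * E" "b \<le> a"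
      "A < dm + a" "B < dl + b" "dl \<le> D" for E dm dl a b A B :: real
      using that by (simp add: field_simps)
    ultimately show "energy (\<lambda>x i. snd (p m) x i - snd (p l) x i) \<le> \<rho> m"
      using p(2)[of m] p(2)[of l] D(2)[of l] unfolding \<rho>_def by blast
  qed
qed

text \<open>Plays the role of weak sequential compactness of bounded sets in a Hilbert space:
midpoints of the tails converge strongly, and their limit must be the pointwise one. Bounds that
hold for the pairing with the gradients of the sequence are inherited by midpoints and hence by the
limit, so no subsequence has to be chosen. The bound on the energy is the case where the pairing is
with the limiting gradient itself.\<close>

theorem weak_closure:
  assumes W: "\<And>n. W10g 2 (z n) (g n)" and R: "\<And>n. energy (g n) \<le> R"
    and k: "\<And>n x. x \<in> \<Omega> \<Longrightarrow> \<bar>z n x\<bar> \<le> k"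
    and lim: "AE x in M. (\<lambda>n. z n x) \<longlonglongrightarrow> u x" and mu: "u \<in> borel_measurable M"
  obtains G where "W10g 2 u G" "energy G \<le> R"
    "\<And>b c c0. L2field b \<Longrightarrow> (\<And>n. (LINT x|M. dotN N (b x) (g n x)) \<le> c n) \<Longrightarrow> c \<longlonglongrightarrow> c0 \<Longrightarrow>
       (LINT x|M. dotN N (b x) (G x)) \<le> c0"
proof -
  obtain w h \<rho> where H: "\<And>m. mid_hull z g m (w m) (h m)" and \<rho>: "\<rho> \<longlonglongrightarrow> 0"
    and C: "\<And>m l. m \<le> l \<Longrightarrow> energy (\<lambda>x i. h m x i - h l x i) \<le> \<rho> m"
    by (rule mid_hull_cauchy[of z g R, OF W R]) (rule that)
  have Wm: "W10g 2 (w m) (h m)" for m by (rule mid_hull_W10g[OF W H])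
  have hf: "L2field (h m)" for m by (rule W10g_L2field[OF Wm])
  have ex: "\<exists>f. Lp M 2 f \<and> (\<forall>m. (LINT x|M. (h m x i - f x)\<^sup>2) \<le> \<rho> m)" if i: "i < N" for i
  proof -
    have a: "(LINT x|M. (h m x i - h l x i)\<^sup>2) \<le> \<rho> m" if "m \<le> l" for m l
      using component_le_energy[OF L2field_diff[OF hf hf] i, of m l] C[OF that] by (rule order_trans)
    have b: "Lp M 2 (\<lambda>x. h m x i)" for m using hf i by (simp add: L2field_def)
    obtain f where "Lp M 2 f" "\<And>m. (LINT x|M. (h m x i - f x)\<^sup>2) \<le> \<rho> m"
      by (rule L2_complete[OF b a \<rho>]) (assumption, rule that)
    then show ?thesis by (intro exI[of _ f] conjI allI)
  qed
  define F where "F i = (SOME f. Lp M 2 f \<and> (\<forall>m. (LINT x|M. (h m x i - f x)\<^sup>2) \<le> \<rho> m))" for i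
  have F: "Lp M 2 (F i)" "(LINT x|M. (h m x i - F i x)\<^sup>2) \<le> \<rho> m" if "i < N" for i m
    using someI_ex[OF ex[OF that]] unfolding F_def[symmetric] by simp_all
  define G where "G x i = F i x" for x i
  have G: "L2field G" unfolding L2field_def G_def using F(1) by simp
  have n2: "Lq_null M 2 (\<lambda>m x. h m x i - G x i)" if i: "i < N" for i
    unfolding Lq_null_def
  proof (intro conjI allI)
    show "Lp M 2 (\<lambda>x. h m x i - G x i)" for m
      using L2field_diff[OF hf G] i by (simp add: L2field_def)
    have "(LINT x|M. \<bar>h m x i - G x i\<bar> powr 2) \<le> \<rho> m" for m
      using F(2)[OF i, of m] by (simp add: G_def)
    then show "(\<lambda>m. LINT x|M. \<bar>h m x i - G x i\<bar> powr 2) \<longlonglongrightarrow> 0"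
      by (rule squeeze_null[OF powr_integral_nonneg _ \<rho>])
  qed
  have uk: "AE x in M. \<bar>u x\<bar> \<le> k"
    using lim AE_space
  proof eventually_elim
    case (elim x)
    then show ?case using k by (intro LIMSEQ_le_const2[OF tendsto_rabs]) auto
  qed
  have mw: "w m \<in> borel_measurable M" for m by (rule Lp_measurable[OF W10gD(1)[OF Wm]])
  have n1: "Lq_null M 2 (\<lambda>m x. w m x - u x)"
  proof (rule Lq_null_dominated[OF borel_measurable_diff[OF mw mu] _ _ Lp_const[of 2 "2 * k"]])
    show "AE x in M. (\<lambda>m. w m x - u x) \<longlonglongrightarrow> 0"
      using lim
    proof eventually_elim
      case (elim x)
      show ?case
      proof (rule LIMSEQ_I)
        fix e :: real assume "e > 0"
        then obtain m0 where m0: "\<And>n. m0 \<le> n \<Longrightarrow> \<bar>z n x - u x\<bar> < e / 2"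
          using LIMSEQ_D[OF elim, of "e / 2"] by auto
        have "\<bar>w m x - u x\<bar> \<le> e / 2" if "m0 \<le> m" for m
        proof (rule mid_hull_close[OF H])
          show "\<bar>z n x - u x\<bar> \<le> e / 2" if "m \<le> n" for n
            using m0[of n] that \<open>m0 \<le> m\<close> by simp
        qed
        then show "\<exists>no. \<forall>n\<ge>no. norm (w n x - u x - 0) < e"
          using \<open>e > 0\<close> by (intro exI[of _ m0]) fastforce
      qed
    qed
    show "AE x in M. \<bar>w m x - u x\<bar> \<le> \<bar>2 * k\<bar>" for m
      using uk AE_space
    proof eventually_elim
      case (elim x)
      have "\<bar>w m x - 0\<bar> \<le> k" by (rule mid_hull_close[OF H]) (use k elim in simp)
      then show ?case using elim by simp
    qed
  qed simp
  have Lu: "Lp M 2 u" by (rule Lp_bounded[OF mu uk]) simp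
  have WG: "W10g 2 u G"
    by (rule W10g_limit[OF Wm Lu _ n1 n2]) (use G in \<open>simp_all add: L2field_def\<close>)
  have pair: "(LINT x|M. dotN N (b x) (G x)) \<le> c0"
    if b: "L2field b" and c: "\<And>n. (LINT x|M. dotN N (b x) (g n x)) \<le> c n" "c \<longlonglongrightarrow> c0" for b c c0
  proof -
    have "(\<lambda>m. LINT x|M. b x i * (h m x i - G x i)) \<longlonglongrightarrow> 0" if "i < N" for i
      using b that by (intro L2_pairing_null n2) (simp_all add: L2field_def)
    then have "(\<lambda>m. \<Sum>i<N. LINT x|M. b x i * (h m x i - G x i)) \<longlonglongrightarrow> 0"
      by (intro tendsto_null_sum) simp
    moreover have "(\<Sum>i<N. LINT x|M. b x i * (h m x i - G x i)) =
        (LINT x|M. dotN N (b x) (h m x)) - (LINT x|M. dotN N (b x) (G x))" for m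
    proof -
      have "(\<Sum>i<N. LINT x|M. b x i * (h m x i - G x i)) = (LINT x|M. dotN N (b x) (\<lambda>i. h m x i - G x i))"
        unfolding dotN_def
        by (rule Bochner_Integration.integral_sum[symmetric])
          (use b L2field_diff[OF hf G, of m] in \<open>auto simp: L2field_def intro!: L2_mult_integrable\<close>)
      also have "\<dots> = (LINT x|M. dotN N (b x) (h m x) - dotN N (b x) (G x))"
        unfolding dotN_def by (simp only: right_diff_distrib sum_subtractf)
      also have "\<dots> = (LINT x|M. dotN N (b x) (h m x)) - (LINT x|M. dotN N (b x) (G x))"
        by (rule Bochner_Integration.integral_diff[OF dotN_integrable[OF b hf] dotN_integrable[OF b G]])
      finally show ?thesis .
    qed
    ultimately have l: "(\<lambda>m. LINT x|M. dotN N (b x) (h m x)) \<longlonglongrightarrow> (LINT x|M. dotN N (b x) (G x))"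
      by (simp only: LIM_zero_iff)
    show ?thesis
    proof (rule field_le_epsilon)
      fix e :: real assume "e > 0"
      then obtain m0 where m0: "\<And>n. m0 \<le> n \<Longrightarrow> \<bar>c n - c0\<bar> < e"
        using LIMSEQ_D[OF c(2), of e] by auto
      have "(LINT x|M. dotN N (b x) (h m x)) \<le> c0 + e" if "m0 \<le> m" for m
      proof (rule mid_hull_pairing[OF W b H])
        show "(LINT x|M. dotN N (b x) (g n x)) \<le> c0 + e" if "m \<le> n" for n
          using c(1)[of n] m0[of n] that \<open>m0 \<le> m\<close> by linarith
      qed
      then show "(LINT x|M. dotN N (b x) (G x)) \<le> c0 + e"
        by (intro LIMSEQ_le_const2[OF l]) auto
    qed
  qed
  have "(LINT x|M. dotN N (G x) (G x)) \<le> (1/2) * energy G + (1/2) * R"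
  proof (rule pair[OF G _ tendsto_const])
    fix n
    have gn: "L2field (g n)" by (rule W10g_L2field[OF W])
    have "(LINT x|M. dotN N (G x) (g n x)) \<le> (LINT x|M. (1/2) * dotN N (G x) (G x) + (1/2) * dotN N (g n x) (g n x))"
      using dotN_integrable[OF G G] dotN_integrable[OF gn gn]
      by (intro integral_mono dotN_integrable[OF G gn] dotN_le_half) simp_all
    also have "\<dots> = (1/2) * energy G + (1/2) * energy (g n)"
      unfolding energy_def using dotN_integrable[OF G G] dotN_integrable[OF gn gn] by simp
    finally show "(LINT x|M. dotN N (G x) (g n x)) \<le> (1/2) * energy G + (1/2) * R" using R[of n] by simp
  qed
  then have "energy G \<le> R" unfolding energy_def by simp
  with WG show thesis by (rule that) (rule pair)
qed

end

section \<open>The regularised equations\<close>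

lemma powr_const_measurable:
  fixes f :: "'a \<Rightarrow> real"
  assumes [measurable]: "f \<in> borel_measurable M" shows "(\<lambda>x. f x powr c) \<in> borel_measurable M"
  by measurable

lemma Lp_mult_Linf:
  assumes a: "Linf M a" and f: "Lp M q f" and q: "q > 0"
  shows "Lp M q (\<lambda>x. a x * f x)"
proof -
  obtain B where B: "AE x in M. \<bar>a x\<bar> \<le> B" and ma: "a \<in> borel_measurable M" using a by (auto simp: Linf_def)
  show ?thesis
  proof (rule Lp_bound(1)[OF Lp_cmult(1)[OF f, of B] borel_measurable_times[OF ma Lp_measurable[OF f]] _ q])
    show "AE x in M. \<bar>a x * f x\<bar> \<le> \<bar>B * f x\<bar>"
      using B
    proof eventually_elim
      case (elim x)
      then have "\<bar>a x\<bar> \<le> \<bar>B\<bar>" by simp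
      then show ?case unfolding abs_mult by (rule mult_right_mono) simp
    qed
  qed
qed

lemma powr_le_one_plus:
  fixes t q p :: real
  assumes "0 \<le> t" "0 < q" "q \<le> p" shows "t powr q \<le> 1 + t powr p"
proof (cases "t \<le> 1")
  case True
  then have "t powr q \<le> 1 powr q" using assms by (intro powr_mono2) simp_all
  then have "t powr q \<le> 1" by simp
  then show ?thesis using powr_ge_zero[of t p] by linarith
next
  case False
  then have "t powr q \<le> t powr p" using assms by (intro powr_mono) simp_all
  then show ?thesis by simp
qed

context finite_measure
begin

lemma Lp_mono_exponent:
  assumes f: "Lp M p f" and q: "0 < q" "q \<le> p" shows "Lp M q f"
proof -
  have m[measurable]: "f \<in> borel_measurable M" by (rule Lp_measurable[OF f])
  have "integrable M (\<lambda>x. \<bar>f x\<bar> powr q)"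
  proof (rule Bochner_Integration.integrable_bound)
    show "integrable M (\<lambda>x. 1 + \<bar>f x\<bar> powr p)" using f by (simp add: Lp_def)
    show "AE x in M. norm (\<bar>f x\<bar> powr q) \<le> norm (1 + \<bar>f x\<bar> powr p)"
      by (rule AE_I2) (use powr_le_one_plus[OF _ q] in simp)
  qed measurable
  then show ?thesis using m by (simp add: Lp_def)
qed

text \<open>The power q of the functions tends to zero with exponent p/q, hence in mean.\<close>

lemma Lq_null_mono_exponent:
  assumes f: "Lq_null M p f" and q: "0 < q" "q \<le> p" shows "Lq_null M q f"
  unfolding Lq_null_def
proof (intro conjI allI)
  show "Lp M q (f n)" for n by (rule Lp_mono_exponent[OF Lq_null_Lp[OF f] q])
  have e: "\<bar>\<bar>t\<bar> powr q\<bar> powr (p / q) = \<bar>t\<bar> powr p" for t :: real using q by (simp add: powr_powr)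
  have "Lq_null M (p / q) (\<lambda>n x. \<bar>f n x\<bar> powr q)"
    using f unfolding Lq_null_def Lp_def e by (auto intro!: measurable)
  from Lq_null_imp_L1[OF this] q show "(\<lambda>n. LINT x|M. \<bar>f n x\<bar> powr q) \<longlonglongrightarrow> 0" by simp
qed

end

lemma dotN_mult_right: "dotN N a (\<lambda>i. c * b i) = c * dotN N a b"
  unfolding dotN_def by (simp add: sum_distrib_left algebra_simps)

lemma dotN_mult_left: "dotN N (\<lambda>i. c * a i) b = c * dotN N a b"
  unfolding dotN_def by (simp add: sum_distrib_left algebra_simps)

lemma dotN_diff_right: "dotN N a (\<lambda>i. b i - c i) = dotN N a b - dotN N a c"
  unfolding dotN_def by (simp add: right_diff_distrib sum_subtractf)

lemma dotN_commute: "dotN N a b = dotN N b a"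
  unfolding dotN_def by (simp add: mult.commute)

lemma matvecN_diff: "matvecN N A (\<lambda>i. v i - w i) = (\<lambda>i. matvecN N A v i - matvecN N A w i)"
  unfolding matvecN_def by (simp add: right_diff_distrib sum_subtractf)

lemma matvecN_mult: "matvecN N A (\<lambda>i. c * v i) = (\<lambda>i. c * matvecN N A v i)"
  unfolding matvecN_def by (rule ext) (simp add: sum_distrib_left algebra_simps)

lemma matvecN_cong: "(\<And>j. j < N \<Longrightarrow> v j = w j) \<Longrightarrow> matvecN N A v i = matvecN N A w i"
  unfolding matvecN_def by (intro sum.cong) auto

lemma dotN_matvecN_symmetric:
  assumes "\<forall>i<N. \<forall>j<N. A i j = A j i"
  shows "dotN N (matvecN N A v) w = dotN N (matvecN N A w) v"
proof -
  have "dotN N (matvecN N A v) w = (\<Sum>i<N. \<Sum>j<N. A i j * v j * w i)"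
    unfolding dotN_def matvecN_def by (simp add: sum_distrib_right)
  also have "\<dots> = (\<Sum>j<N. \<Sum>i<N. A i j * v j * w i)" by (rule sum.swap)
  also have "\<dots> = (\<Sum>j<N. \<Sum>i<N. A j i * w i * v j)"
  proof (intro sum.cong refl)
    fix i j assume "j \<in> {..<N}" "i \<in> {..<N}"
    then have "A i j = A j i" using assms by simp
    then show "A i j * v j * w i = A j i * w i * v j" by simp
  qed
  also have "\<dots> = dotN N (matvecN N A w) v"
    unfolding dotN_def matvecN_def by (simp add: sum_distrib_right)
  finally show ?thesis .
qed

lemma normN_scale: "normN N (\<lambda>i. c * v i) = \<bar>c\<bar> * normN N v"
  unfolding normN_def dotN_mult_left dotN_mult_right
  by (simp add: real_sqrt_mult[symmetric] power2_eq_square[symmetric] mult.assoc[symmetric] real_sqrt_mult)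

context open_domain
begin

lemma W10g_mono_exponent:
  assumes W: "W10g p u g" and q: "0 < q" "q \<le> p" shows "W10g q u g"
proof -
  obtain \<phi> where \<phi>: "\<And>n. Cc_smooth N \<Omega> (\<phi> n)" "Lq_null M p (\<lambda>n x. \<phi> n x - u x)"
    "\<And>i. i < N \<Longrightarrow> Lq_null M p (\<lambda>n x. pd i (\<phi> n) x - g x i)" using W10g_approx[OF W] by blast
  note U = W10gD[OF W]
  show ?thesis unfolding W10g_def
    by (intro conjI allI impI exI[of _ \<phi>] \<phi>(1) Lq_null_mono_exponent[OF \<phi>(2) q] Lq_null_mono_exponent[OF \<phi>(3) q]
      Lp_mono_exponent[OF U(1) q] Lp_mono_exponent[OF U(3) q] U(2))
qed

lemma W10g_diff_Cc_smooth:
  assumes "W10g q u g" "Cc_smooth N \<Omega> \<phi>" "q > 0"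
  shows "W10g q (\<lambda>x. u x - \<phi> x) (\<lambda>x i. g x i - pd i \<phi> x)"
  using W10g_lincomb[OF assms(1) W10g_Cc_smooth[OF assms(2,3)] assms(3), of 1 "-1"] by simp

lemma dotN_measurable:
  assumes "\<And>i. i < N \<Longrightarrow> (\<lambda>x. a x i) \<in> borel_measurable M" "\<And>i. i < N \<Longrightarrow> (\<lambda>x. b x i) \<in> borel_measurable M"
  shows "(\<lambda>x. dotN N (a x) (b x)) \<in> borel_measurable M"
  unfolding dotN_def by (intro borel_measurable_sum borel_measurable_times assms) simp_all

lemma normN_Lp:
  assumes "\<And>i. i < N \<Longrightarrow> Lp M q (\<lambda>x. g x i)" "q > 0" shows "Lp M q (\<lambda>x. normN N (g x))"
proof (rule Lp_bound(1)[OF _ _ _ assms(2)])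
  show "Lp M q (\<lambda>x. \<Sum>i<N. \<bar>g x i\<bar>)" by (intro Lp_sum Lp_abs assms) simp_all
  show "(\<lambda>x. normN N (g x)) \<in> borel_measurable M" by (rule normN_measurable) (rule Lp_measurable[OF assms(1)])
  show "AE x in M. \<bar>normN N (g x)\<bar> \<le> \<bar>\<Sum>i<N. \<bar>g x i\<bar>\<bar>"
  proof (rule AE_I2)
    fix x show "\<bar>normN N (g x)\<bar> \<le> \<bar>\<Sum>i<N. \<bar>g x i\<bar>\<bar>"
      using normN_le_sum[of N "g x"] normN_nonneg[of N "g x"] by linarith
  qed
qed

end

locale elliptic_domain = open_domain +
  fixes lo hi :: real and \<Lambda> :: "rvec \<Rightarrow> nat \<Rightarrow> nat \<Rightarrow> real"
  assumes elliptic: "elliptic_coeff N \<Omega> lo hi \<Lambda>"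
begin

lemma lo_pos: "lo > 0" using elliptic by (simp add: elliptic_coeff_def)

lemma \<Lambda>_Linf: "i < N \<Longrightarrow> j < N \<Longrightarrow> Linf M (\<lambda>x. \<Lambda> x i j)"
  using elliptic by (simp add: elliptic_coeff_def)

lemma \<Lambda>_symmetric: "AE x in M. \<forall>i<N. \<forall>j<N. \<Lambda> x i j = \<Lambda> x j i"
  using elliptic by (simp add: elliptic_coeff_def)

lemma \<Lambda>_coercive: "AE x in M. \<forall>\<xi>. lo * dotN N \<xi> \<xi> \<le> dotN N (matvecN N (\<Lambda> x) \<xi>) \<xi>"
proof -
  have "AE x in M. \<forall>\<xi>. lo * (normN N \<xi>)\<^sup>2 \<le> dotN N (matvecN N (\<Lambda> x) \<xi>) \<xi> \<and>
        dotN N (matvecN N (\<Lambda> x) \<xi>) \<xi> \<le> hi * (normN N \<xi>)\<^sup>2"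
    using elliptic by (simp add: elliptic_coeff_def)
  then show ?thesis by eventually_elim (simp add: dotN_self)
qed

lemma \<Lambda>_measurable: "i < N \<Longrightarrow> j < N \<Longrightarrow> (\<lambda>x. \<Lambda> x i j) \<in> borel_measurable M"
  using \<Lambda>_Linf by (simp add: Linf_def)

lemma matvecN_measurable:
  assumes "\<And>i. i < N \<Longrightarrow> (\<lambda>x. v x i) \<in> borel_measurable M" "i < N"
  shows "(\<lambda>x. matvecN N (\<Lambda> x) (v x) i) \<in> borel_measurable M"
  unfolding matvecN_def by (intro borel_measurable_sum borel_measurable_times assms(1) \<Lambda>_measurable assms(2)) simp_all

lemma matvecN_L2field:
  assumes "L2field v" shows "L2field (\<lambda>x. matvecN N (\<Lambda> x) (v x))"
  unfolding L2field_def matvecN_def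
proof (intro allI impI Lp_sum)
  fix i j assume "i < N" "j \<in> {..<N}"
  then show "Lp M 2 (\<lambda>x. \<Lambda> x i j * v x j)"
    using assms by (intro Lp_mult_Linf \<Lambda>_Linf) (simp_all add: L2field_def)
qed simp_all

text \<open>Uniqueness of weak gradients and the chain rule for psi make every gradient in the
equation explicit, including the one in the weight.\<close>

lemma regularised_equation:
  assumes R: "regularised_solution N \<Omega> p \<Lambda> f e u" and u: "W10g p u g" and w: "W10g p w h" and p: "p \<ge> 1"
  shows "(LINT x|M. dotN N (matvecN N (\<Lambda> x) (g x)) (h x)) +
     e * (LINT x|M. normN N (\<lambda>i. psi_deriv (u x) * g x i) powr (p - 2) * dotN N (g x) (h x)) = (LINT x|M. f x * w x)"
proof -
  have p0: "p > 0" using p by simp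
  let ?gu = "weak_grad N \<Omega> u" and ?gw = "weak_grad N \<Omega> w" and ?gp = "weak_grad N \<Omega> (\<lambda>y. psi (u y))"
  note U = W10gD(2)[OF u] and V = W10gD(2)[OF w] and P = weak_grad_psi[OF u p]
  note mU = has_weak_grad_measurable(2)[OF U] has_weak_grad_measurable(2)[OF has_weak_grad_weak_grad[OF U]]
  note mV = has_weak_grad_measurable(2)[OF V] has_weak_grad_measurable(2)[OF has_weak_grad_weak_grad[OF V]]
  note mP = has_weak_grad_measurable(2)[OF P] has_weak_grad_measurable(2)[OF has_weak_grad_weak_grad[OF P]]
  note eU = weak_grad_eq[OF U] and eV = weak_grad_eq[OF V] and eP = weak_grad_eq[OF P]
  have "(LINT x|M. dotN N (matvecN N (\<Lambda> x) (?gu x)) (?gw x)) = (LINT x|M. dotN N (matvecN N (\<Lambda> x) (g x)) (h x))"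
  proof (rule integral_cong_AE)
    show "(\<lambda>x. dotN N (matvecN N (\<Lambda> x) (?gu x)) (?gw x)) \<in> borel_measurable M"
      by (intro dotN_measurable matvecN_measurable mU(2) mV(2))
    show "(\<lambda>x. dotN N (matvecN N (\<Lambda> x) (g x)) (h x)) \<in> borel_measurable M"
      by (intro dotN_measurable matvecN_measurable mU(1) mV(1))
    show "AE x in M. dotN N (matvecN N (\<Lambda> x) (?gu x)) (?gw x) = dotN N (matvecN N (\<Lambda> x) (g x)) (h x)"
      using eU eV
    proof eventually_elim
      case (elim x)
      show ?case by (intro dotN_cong matvecN_cong) (use elim in simp_all)
    qed
  qed
  moreover have "(LINT x|M. normN N (?gp x) powr (p - 2) * dotN N (?gu x) (?gw x)) =
     (LINT x|M. normN N (\<lambda>i. psi_deriv (u x) * g x i) powr (p - 2) * dotN N (g x) (h x))"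
  proof (rule integral_cong_AE)
    show "(\<lambda>x. normN N (?gp x) powr (p - 2) * dotN N (?gu x) (?gw x)) \<in> borel_measurable M"
      by (intro borel_measurable_times powr_const_measurable normN_measurable dotN_measurable mU(2) mV(2) mP(2))
    show "(\<lambda>x. normN N (\<lambda>i. psi_deriv (u x) * g x i) powr (p - 2) * dotN N (g x) (h x)) \<in> borel_measurable M"
      by (intro borel_measurable_times powr_const_measurable normN_measurable dotN_measurable mU(1) mV(1) mP(1))
    show "AE x in M. normN N (?gp x) powr (p - 2) * dotN N (?gu x) (?gw x) =
       normN N (\<lambda>i. psi_deriv (u x) * g x i) powr (p - 2) * dotN N (g x) (h x)"
      using eU eV eP
    proof eventually_elim
      case (elim x)
      have "normN N (?gp x) = normN N (\<lambda>i. psi_deriv (u x) * g x i)" by (rule normN_cong) (use elim in simp)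
      moreover have "dotN N (?gu x) (?gw x) = dotN N (g x) (h x)" by (rule dotN_cong) (use elim in simp_all)
      ultimately show ?case by simp
    qed
  qed
  moreover have "W10 N \<Omega> p w" by (rule W10g_imp_W10[OF w p0])
  then have "(LINT x|M. dotN N (matvecN N (\<Lambda> x) (?gu x)) (?gw x)) +
     e * (LINT x|M. normN N (?gp x) powr (p - 2) * dotN N (?gu x) (?gw x)) = (LINT x|M. f x * w x)"
    using R unfolding regularised_solution_def by simp
  ultimately show ?thesis by simp
qed

lemma weight_le_normN: "normN N (\<lambda>i. psi_deriv s * v i) \<le> normN N v"
  unfolding normN_scale using mult_right_mono[OF psi_deriv_bound[of s] normN_nonneg[of N v]] by simp

text \<open>The test function is the truncation of the solution at level m. Its gradient is the one
of the solution on the set \<bar>u\<bar> < m and zero elsewhere, so both terms on the left are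
nonnegative and each of them is bounded by the right-hand side, where the test function is at most
m.\<close>

lemma truncation_estimate:
  assumes R: "regularised_solution N \<Omega> p \<Lambda> f e u" and u: "W10g p u g" and p: "p \<ge> 2" and e: "e > 0"
    and f: "integrable M f" and m: "m > 0"
  shows "lo * energy (\<lambda>x i. of_bool (\<bar>u x\<bar> < m) * g x i) \<le> m * (LINT x|M. \<bar>f x\<bar>)"
    and "e * (LINT x|M. normN N (\<lambda>i. psi_deriv (u x) * g x i) powr (p - 2) * (of_bool (\<bar>u x\<bar> < m) * dotN N (g x) (g x)))
      \<le> m * (LINT x|M. \<bar>f x\<bar>)"
proof -
  let ?h = "\<lambda>x i. of_bool (\<bar>u x\<bar> < m) * g x i"
  let ?P = "\<lambda>x. normN N (\<lambda>i. psi_deriv (u x) * g x i) powr (p - 2)"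
  have p1: "p \<ge> 1" "p > 0" using p by simp_all
  have W: "W10g p (\<lambda>x. Trunc m (u x)) ?h" by (rule W10g_Trunc[OF u p1(1) m])
  have g2: "L2field g" and h2: "L2field ?h"
    using W10g_L2field[OF W10g_mono_exponent[OF u]] W10g_L2field[OF W10g_mono_exponent[OF W]] p by simp_all
  have eq: "(LINT x|M. dotN N (matvecN N (\<Lambda> x) (g x)) (?h x)) +
     e * (LINT x|M. ?P x * dotN N (g x) (?h x)) = (LINT x|M. f x * Trunc m (u x))"
    by (rule regularised_equation[OF R u W p1(1)])
  have "lo * energy ?h = (LINT x|M. lo * dotN N (?h x) (?h x))" unfolding energy_def by simp
  also have "\<dots> \<le> (LINT x|M. dotN N (matvecN N (\<Lambda> x) (g x)) (?h x))"
  proof (rule integral_mono_AE)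
    show "integrable M (\<lambda>x. lo * dotN N (?h x) (?h x))"
      using dotN_integrable[OF h2 h2] by (rule integrable_mult_right)
    show "integrable M (\<lambda>x. dotN N (matvecN N (\<Lambda> x) (g x)) (?h x))"
      by (rule dotN_integrable[OF matvecN_L2field[OF g2] h2])
    show "AE x in M. lo * dotN N (?h x) (?h x) \<le> dotN N (matvecN N (\<Lambda> x) (g x)) (?h x)"
      using \<Lambda>_coercive
    proof eventually_elim
      case (elim x)
      then show ?case unfolding dotN_mult_right dotN_mult_left by simp
    qed
  qed
  finally have I1: "lo * energy ?h \<le> (LINT x|M. dotN N (matvecN N (\<Lambda> x) (g x)) (?h x))" .
  have dd: "dotN N (g x) (?h x) = of_bool (\<bar>u x\<bar> < m) * dotN N (g x) (g x)" for x by (rule dotN_mult_right)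
  have I2: "0 \<le> (LINT x|M. ?P x * dotN N (g x) (?h x))"
    unfolding dd by (rule integral_nonneg_AE) (simp add: dotN_nonneg)
  have mT: "(\<lambda>x. Trunc m (u x)) \<in> borel_measurable M" by (rule Lp_measurable[OF W10gD(1)[OF W]])
  have i: "integrable M (\<lambda>x. f x * Trunc m (u x))"
  proof (rule Bochner_Integration.integrable_bound[of _ "\<lambda>x. m * \<bar>f x\<bar>"])
    show "integrable M (\<lambda>x. m * \<bar>f x\<bar>)" using f by simp
    show "(\<lambda>x. f x * Trunc m (u x)) \<in> borel_measurable M"
      by (rule borel_measurable_times[OF borel_measurable_integrable[OF f] mT])
    show "AE x in M. norm (f x * Trunc m (u x)) \<le> norm (m * \<bar>f x\<bar>)"
    proof (rule AE_I2)
      fix x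
      have "\<bar>Trunc m (u x)\<bar> * \<bar>f x\<bar> \<le> m * \<bar>f x\<bar>" by (rule mult_right_mono[OF abs_Trunc_le(2)[OF m]]) simp
      then show "norm (f x * Trunc m (u x)) \<le> norm (m * \<bar>f x\<bar>)" using m by (simp add: abs_mult mult.commute)
    qed
  qed
  have I3: "(LINT x|M. f x * Trunc m (u x)) \<le> m * (LINT x|M. \<bar>f x\<bar>)"
  proof -
    have "(LINT x|M. f x * Trunc m (u x)) \<le> (LINT x|M. m * \<bar>f x\<bar>)"
    proof (rule integral_mono[OF i])
      show "integrable M (\<lambda>x. m * \<bar>f x\<bar>)" using f by simp
      fix x
      have "\<bar>Trunc m (u x)\<bar> * \<bar>f x\<bar> \<le> m * \<bar>f x\<bar>" by (rule mult_right_mono[OF abs_Trunc_le(2)[OF m]]) simp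
      then show "f x * Trunc m (u x) \<le> m * \<bar>f x\<bar>"
        using abs_ge_self[of "f x * Trunc m (u x)"] by (simp add: abs_mult mult.commute)
    qed
    then show ?thesis by simp
  qed
  have "0 \<le> e * (LINT x|M. ?P x * dotN N (g x) (?h x))" using I2 e by simp
  then show "lo * energy ?h \<le> m * (LINT x|M. \<bar>f x\<bar>)" using I1 I3 eq by linarith
  have "0 \<le> lo * energy ?h" using lo_pos energy_nonneg by simp
  then have "e * (LINT x|M. ?P x * dotN N (g x) (?h x)) \<le> m * (LINT x|M. \<bar>f x\<bar>)" using I1 I3 eq by linarith
  then show "e * (LINT x|M. ?P x * (of_bool (\<bar>u x\<bar> < m) * dotN N (g x) (g x))) \<le> m * (LINT x|M. \<bar>f x\<bar>)"
    by (simp only: dd)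
qed

end

section \<open>Passage to the limit\<close>

lemma dotN_diff_self_le:
  "dotN N (\<lambda>i. a i - b i) (\<lambda>i. a i - b i) \<le> 2 * dotN N a a + 2 * dotN N b b"
proof -
  have "(a i - b i) * (a i - b i) \<le> 2 * (a i * a i) + 2 * (b i * b i)" for i
  proof -
    have "0 \<le> (a i + b i)\<^sup>2" by simp
    then show ?thesis by (simp add: power2_eq_square algebra_simps)
  qed
  then have "(\<Sum>i<N. (a i - b i) * (a i - b i)) \<le> (\<Sum>i<N. 2 * (a i * a i) + 2 * (b i * b i))"
    by (rule sum_mono)
  then show ?thesis unfolding dotN_def by (simp only: sum.distrib sum_distrib_left)
qed

lemma dotN_diff_lower: "- (dotN N d d / 4) \<le> dotN N a (\<lambda>i. a i - d i)"
proof -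
  have "- (1/4) * (d i * d i) \<le> a i * (a i - d i)" for i
  proof -
    have "0 \<le> (2 * a i - d i)\<^sup>2" by simp
    then show ?thesis by (simp add: power2_eq_square algebra_simps)
  qed
  then have "(\<Sum>i<N. - (1/4) * (d i * d i)) \<le> (\<Sum>i<N. a i * (a i - d i))" by (rule sum_mono)
  then have "- (1/4) * dotN N d d \<le> dotN N a (\<lambda>i. a i - d i)"
    unfolding dotN_def by (simp only: sum_distrib_left)
  then show ?thesis by simp
qed

text \<open>For an idempotent factor c, the indicator of the set where the truncation is inactive.
It isolates the quadratic form in the gradient of the test function.\<close>

lemma matvecN_split:
  assumes c: "c * c = (c :: real)"
  shows "dotN N (matvecN N A a) (\<lambda>i. c * (a i - d i)) =
    dotN N (matvecN N A (\<lambda>i. c * (a i - d i))) (\<lambda>i. c * (a i - d i)) +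
    dotN N (matvecN N A d) (\<lambda>i. c * (a i - d i))"
proof -
  let ?y = "\<lambda>i. a i - d i"
  have "dotN N (matvecN N A ?y) ?y = dotN N (matvecN N A a) ?y - dotN N (matvecN N A d) ?y"
    unfolding matvecN_diff[of N A a d] using dotN_diff_right[of N ?y "matvecN N A a" "matvecN N A d"]
    by (simp only: dotN_commute[of N _ ?y])
  moreover have "dotN N (matvecN N A (\<lambda>i. c * ?y i)) (\<lambda>i. c * ?y i) = (c * c) * dotN N (matvecN N A ?y) ?y"
    unfolding matvecN_mult dotN_mult_left dotN_mult_right by simp
  ultimately show ?thesis unfolding c dotN_mult_right by (simp add: right_diff_distrib)
qed

text \<open>The quadratic form lies above its tangents. This reduces lower semicontinuity to a
linear functional.\<close>

lemma quadratic_form_linearisation: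
  assumes pos: "\<forall>\<xi>. 0 \<le> dotN N (matvecN N A \<xi>) \<xi>" and sym: "\<forall>i<N. \<forall>j<N. A i j = A j i"
  shows "2 * dotN N (matvecN N A b) a \<le> dotN N (matvecN N A a) a + dotN N (matvecN N A b) b"
proof -
  have "0 \<le> dotN N (matvecN N A (\<lambda>i. a i - b i)) (\<lambda>i. a i - b i)" using pos by simp
  then have "0 \<le> dotN N (matvecN N A (\<lambda>i. a i - b i)) a - dotN N (matvecN N A (\<lambda>i. a i - b i)) b"
    by (simp only: dotN_diff_right)
  moreover have "dotN N (matvecN N A (\<lambda>i. a i - b i)) w = dotN N (matvecN N A a) w - dotN N (matvecN N A b) w" for w
    unfolding matvecN_diff[of N A a b] using dotN_diff_right[of N w "matvecN N A a" "matvecN N A b"]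
    by (simp only: dotN_commute[of N _ w])
  ultimately have "0 \<le> (dotN N (matvecN N A a) a - dotN N (matvecN N A b) a) -
      (dotN N (matvecN N A a) b - dotN N (matvecN N A b) b)" by (simp only:)
  then show ?thesis using dotN_matvecN_symmetric[OF sym, of a b] by linarith
qed

text \<open>Weak convergence of the truncations is not assumed: it follows from convergence almost
everywhere and the energy estimate.\<close>

locale regularised_sequence = elliptic_domain +
  fixes p :: real and f u :: "rvec \<Rightarrow> real" and e :: "nat \<Rightarrow> real"
    and v :: "nat \<Rightarrow> rvec \<Rightarrow> real" and g :: "nat \<Rightarrow> rvec \<Rightarrow> rvec"
  assumes p: "p > 2" and f: "integrable M f" and e_pos: "\<And>n. e n > 0" and e_lim: "e \<longlonglongrightarrow> 0"
    and reg: "\<And>n. regularised_solution N \<Omega> p \<Lambda> f (e n) (v n)"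
    and v: "\<And>n. W10g p (v n) (g n)"
    and lim: "AE x in M. (\<lambda>n. v n x) \<longlonglongrightarrow> u x" and u_meas: "u \<in> borel_measurable M"
begin

text \<open>The factor \<bar>\<nabla>\<psi>(v_n)\<bar> to the power p - 2 of the perturbation, with
the gradient given by the chain rule.\<close>

definition weight :: "nat \<Rightarrow> rvec \<Rightarrow> real" where
  "weight n x = normN N (\<lambda>i. psi_deriv (v n x) * g n x i) powr (p - 2)"

lemma p_ge: "p \<ge> 1" "p \<ge> 2" "p > 0"
  using p by simp_all

lemma weight_nonneg: "0 \<le> weight n x"
  by (simp add: weight_def)

lemma v_meas: "v n \<in> borel_measurable M"
  by (rule Lp_measurable[OF W10gD(1)[OF v]])

lemma g_meas: "i < N \<Longrightarrow> (\<lambda>x. g n x i) \<in> borel_measurable M"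
  by (rule Lp_measurable[OF W10gD(3)[OF v]])

lemma weight_meas: "weight n \<in> borel_measurable M"
  unfolding weight_def
  by (intro powr_const_measurable normN_measurable has_weak_grad_measurable(2)[OF weak_grad_psi[OF v p_ge(1)]])

lemma trunc_energy:
  "k > 0 \<Longrightarrow> energy (\<lambda>x i. of_bool (\<bar>v n x\<bar> < k) * g n x i) \<le> k * (LINT x|M. \<bar>f x\<bar>) / lo"
  using truncation_estimate(1)[OF reg v p_ge(2) e_pos f] lo_pos by (simp add: pos_le_divide_eq mult.commute)

lemma weight_energy:
  "m > 0 \<Longrightarrow> e n * (LINT x|M. weight n x * (of_bool (\<bar>v n x\<bar> < m) * dotN N (g n x) (g n x))) \<le> m * (LINT x|M. \<bar>f x\<bar>)"
  using truncation_estimate(2)[OF reg v p_ge(2) e_pos f] unfolding weight_def .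

lemma limit_truncation:
  assumes k: "k > 0"
  obtains G where "W10g 2 (\<lambda>x. Trunc k (u x)) G" "energy G \<le> k * (LINT x|M. \<bar>f x\<bar>) / lo"
proof -
  have W: "W10g 2 (\<lambda>x. Trunc k (v n x)) (\<lambda>x i. of_bool (\<bar>v n x\<bar> < k) * g n x i)" for n
    by (rule W10g_mono_exponent[OF W10g_Trunc[OF v p_ge(1) k]]) (use p in simp_all)
  have l: "AE x in M. (\<lambda>n. Trunc k (v n x)) \<longlonglongrightarrow> Trunc k (u x)"
    using lim
  proof eventually_elim
    case (elim x)
    have "isCont (Trunc k) (u x)" using continuous_Trunc[OF k] by (simp add: continuous_on_eq_continuous_at)
    then show ?case using elim by (rule isCont_tendsto_compose)
  qed
  have m: "(\<lambda>x. Trunc k (u x)) \<in> borel_measurable M"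
    by (rule borel_compose_continuous[OF continuous_Trunc[OF k] u_meas])
  show thesis
  proof (rule weak_closure[of "\<lambda>n x. Trunc k (v n x)" "\<lambda>n x i. of_bool (\<bar>v n x\<bar> < k) * g n x i"
      "k * (LINT x|M. \<bar>f x\<bar>) / lo" k "\<lambda>x. Trunc k (u x)"])
    show "\<bar>Trunc k (v n x)\<bar> \<le> k" for n x by (rule abs_Trunc_le(2)[OF k])
    fix G assume "W10g 2 (\<lambda>x. Trunc k (u x)) G" "energy G \<le> k * (LINT x|M. \<bar>f x\<bar>) / lo"
    then show thesis by (rule that)
  qed (use W trunc_energy[OF k] l m in simp_all)
qed

text \<open>As the weight is at most the power p - 2 of \<bar>\<nabla>v\<bar>, factors of quadratic
growth are integrable against it.\<close>

lemma weighted_integrable: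
  assumes X: "X \<in> borel_measurable M" and b: "Lp M p b" "\<And>x. x \<in> \<Omega> \<Longrightarrow> 0 \<le> b x"
    and gb: "\<And>x. x \<in> \<Omega> \<Longrightarrow> normN N (g n x) \<le> b x"
    and Xb: "\<And>x. x \<in> \<Omega> \<Longrightarrow> \<bar>X x\<bar> \<le> c * (1 + (b x)\<^sup>2)"
  shows "integrable M (\<lambda>x. weight n x * X x)"
proof (rule Bochner_Integration.integrable_bound)
  show "integrable M (\<lambda>x. \<bar>c\<bar> * (1 + 2 * \<bar>b x\<bar> powr p))" using b(1) by (simp add: Lp_def)
  show "(\<lambda>x. weight n x * X x) \<in> borel_measurable M" by (rule borel_measurable_times[OF weight_meas X])
  show "AE x in M. norm (weight n x * X x) \<le> norm (\<bar>c\<bar> * (1 + 2 * \<bar>b x\<bar> powr p))"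
  proof (rule AE_I2)
    fix x assume "x \<in> space M"
    then have x: "x \<in> \<Omega>" by simp
    have b0: "0 \<le> b x" by (rule b(2)[OF x])
    have w: "weight n x \<le> b x powr (p - 2)"
      unfolding weight_def
    proof (rule powr_mono2)
      show "0 \<le> p - 2" using p by simp
      show "0 \<le> normN N (\<lambda>i. psi_deriv (v n x) * g n x i)" by (rule normN_nonneg)
      show "normN N (\<lambda>i. psi_deriv (v n x) * g n x i) \<le> b x"
        by (rule order_trans[OF weight_le_normN gb[OF x]])
    qed
    have "b x powr (p - 2) * (b x)\<^sup>2 = b x powr p"
    proof (cases "b x = 0")
      case False
      then have bp: "b x > 0" using b0 by simp
      have "b x powr (p - 2) * (b x)\<^sup>2 = b x powr (p - 2) * b x powr 2" using bp by simp
      also have "\<dots> = b x powr p" by (simp only: powr_add[symmetric]) simp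
      finally show ?thesis .
    qed (use p in simp)
    moreover have "b x powr (p - 2) \<le> 1 + b x powr p" using powr_le_one_plus[OF b0, of "p - 2" p] p by simp
    ultimately have s: "b x powr (p - 2) * (1 + (b x)\<^sup>2) \<le> 1 + 2 * b x powr p" by (simp add: distrib_left)
    have "\<bar>X x\<bar> \<le> \<bar>c\<bar> * (1 + (b x)\<^sup>2)"
    proof -
      have "c * (1 + (b x)\<^sup>2) \<le> \<bar>c\<bar> * (1 + (b x)\<^sup>2)" by (rule mult_right_mono) simp_all
      then show ?thesis using Xb[OF x] by linarith
    qed
    then have "weight n x * \<bar>X x\<bar> \<le> b x powr (p - 2) * (\<bar>c\<bar> * (1 + (b x)\<^sup>2))"
      by (intro mult_mono w) simp_all
    also have "\<dots> = \<bar>c\<bar> * (b x powr (p - 2) * (1 + (b x)\<^sup>2))" by simp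
    also have "\<dots> \<le> \<bar>c\<bar> * (1 + 2 * b x powr p)" by (rule mult_left_mono[OF s]) simp
    finally have "weight n x * \<bar>X x\<bar> \<le> \<bar>c\<bar> * (1 + 2 * b x powr p)" .
    moreover have "norm (weight n x * X x) = weight n x * \<bar>X x\<bar>"
      using weight_nonneg[of n x] by (simp add: abs_mult)
    moreover have "norm (\<bar>c\<bar> * (1 + 2 * \<bar>b x\<bar> powr p)) = \<bar>c\<bar> * (1 + 2 * b x powr p)"
    proof -
      have "0 \<le> \<bar>c\<bar> * (1 + 2 * b x powr p)" by simp
      then show ?thesis using b0 by (simp only: real_norm_def abs_of_nonneg)
    qed
    ultimately show "norm (weight n x * X x) \<le> norm (\<bar>c\<bar> * (1 + 2 * \<bar>b x\<bar> powr p))" by (simp only:)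
  qed
qed

lemma normN_g_Lp: "Lp M p (\<lambda>x. normN N (g n x))"
  by (rule normN_Lp[OF W10gD(3)[OF v] p_ge(3)])

lemma indicator_level_meas: "(\<lambda>x. of_bool (\<bar>v n x\<bar> < m) :: real) \<in> borel_measurable M"
proof -
  note [measurable] = v_meas[of n]
  show ?thesis by measurable
qed

text \<open>Either D is at most \<delta> times \<bar>\<nabla>v\<bar> squared, and then the integral
over this set is controlled by the energy that the perturbation dissipates, or \<bar>\<nabla>v\<bar>
and hence the weight is bounded by a constant depending on \<delta>, which the factor e_n
annihilates.\<close>

lemma perturbation_null:
  assumes m: "m > 0" and D: "D \<ge> 0"
  shows "(\<lambda>n. e n * (LINT x|M. weight n x * (of_bool (\<bar>v n x\<bar> < m) * D))) \<longlonglongrightarrow> 0"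
proof (rule LIMSEQ_I)
  fix r :: real assume r: "r > 0"
  define F where "F = m * (LINT x|M. \<bar>f x\<bar>)"
  have F: "F \<ge> 0" using m by (simp add: F_def)
  obtain \<delta> where \<delta>: "\<delta> > 0" and \<delta>F: "\<delta> * F \<le> r / 2"
    by (rule small_factor[OF F r]) (rule that)
  define c where "c = sqrt (D / \<delta>) powr (p - 2) * D"
  define \<mu> where "\<mu> = measure M (space M)"
  have "(\<lambda>n. e n * (c * \<mu>)) \<longlonglongrightarrow> 0" by (rule tendsto_mult_left_zero[OF e_lim])
  from order_tendstoD(2)[OF this, of "r / 2"] r
  obtain n0 where n0: "\<And>n. n \<ge> n0 \<Longrightarrow> e n * (c * \<mu>) < r / 2" unfolding eventually_sequentially by auto
  have c0: "c \<ge> 0" using D by (simp add: c_def)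
  show "\<exists>no. \<forall>n\<ge>no. norm (e n * (LINT x|M. weight n x * (of_bool (\<bar>v n x\<bar> < m) * D)) - 0) < r"
  proof (intro exI[of _ n0] allI impI)
    fix n assume n: "n \<ge> n0"
    let ?w = "weight n" and ?o = "\<lambda>x. of_bool (\<bar>v n x\<bar> < m) :: real" and ?G = "\<lambda>x. dotN N (g n x) (g n x)"
    have pt: "?w x * (?o x * D) \<le> \<delta> * (?w x * (?o x * ?G x)) + c" for x
    proof (cases "\<bar>v n x\<bar> < m")
      case True
      show ?thesis
      proof (cases "D \<le> \<delta> * ?G x")
        case True
        then have "?w x * D \<le> ?w x * (\<delta> * ?G x)" by (rule mult_left_mono[OF _ weight_nonneg])
        then show ?thesis using \<open>\<bar>v n x\<bar> < m\<close> c0 by (simp add: algebra_simps)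
      next
        case False
        then have "(normN N (g n x))\<^sup>2 \<le> D / \<delta>" using \<delta> by (simp add: dotN_self pos_le_divide_eq mult.commute)
        then have "normN N (g n x) \<le> sqrt (D / \<delta>)" by (rule real_le_rsqrt)
        then have "normN N (\<lambda>i. psi_deriv (v n x) * g n x i) \<le> sqrt (D / \<delta>)"
          by (rule order_trans[OF weight_le_normN])
        then have "?w x \<le> sqrt (D / \<delta>) powr (p - 2)"
          unfolding weight_def using p by (intro powr_mono2 normN_nonneg) simp_all
        then have "?w x * D \<le> c" unfolding c_def by (rule mult_right_mono[OF _ D])
        moreover have "0 \<le> \<delta> * (?w x * ?G x)" using \<delta> weight_nonneg[of n x] dotN_nonneg[of N "g n x"] by simp
        ultimately show ?thesis using \<open>\<bar>v n x\<bar> < m\<close> by simp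
      qed
    next
      case False
      then show ?thesis using c0 by simp
    qed
    have om: "?o \<in> borel_measurable M" by (rule indicator_level_meas)
    have b: "\<bar>?o x * D\<bar> \<le> (D + 1) * (1 + (normN N (g n x))\<^sup>2)" for x
    proof -
      have "\<bar>?o x * D\<bar> \<le> D" using D by simp
      also have "D \<le> (D + 1) * 1" by simp
      also have "\<dots> \<le> (D + 1) * (1 + (normN N (g n x))\<^sup>2)" using D by (intro mult_left_mono) simp_all
      finally show ?thesis .
    qed
    have i1: "integrable M (\<lambda>x. ?w x * (?o x * D))"
      by (rule weighted_integrable[OF _ normN_g_Lp normN_nonneg order_refl b]) (intro borel_measurable_times om borel_measurable_const)
    have b2: "\<bar>?o x * ?G x\<bar> \<le> 1 * (1 + (normN N (g n x))\<^sup>2)" for x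
      using dotN_nonneg[of N "g n x"] by (simp add: dotN_self)
    have i2: "integrable M (\<lambda>x. ?w x * (?o x * ?G x))"
      by (rule weighted_integrable[OF _ normN_g_Lp normN_nonneg order_refl b2])
        (intro borel_measurable_times om dotN_measurable g_meas)
    have "(LINT x|M. ?w x * (?o x * D)) \<le> (LINT x|M. \<delta> * (?w x * (?o x * ?G x)) + c)"
      using i1 i2 by (intro integral_mono pt) simp_all
    also have "\<dots> = \<delta> * (LINT x|M. ?w x * (?o x * ?G x)) + c * \<mu>"
      using i2 by (simp add: \<mu>_def)
    finally have "e n * (LINT x|M. ?w x * (?o x * D)) \<le> e n * (\<delta> * (LINT x|M. ?w x * (?o x * ?G x)) + c * \<mu>)"
      using e_pos[of n] by (intro mult_left_mono) simp_all
    also have "\<dots> = \<delta> * (e n * (LINT x|M. ?w x * (?o x * ?G x))) + e n * (c * \<mu>)" by (simp add: algebra_simps)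
    also have "\<dots> \<le> \<delta> * F + e n * (c * \<mu>)"
      using weight_energy[OF m, of n] \<delta> by (simp add: F_def)
    also have "\<dots> < r" using \<delta>F n0[OF n] by linarith
    finally have "e n * (LINT x|M. ?w x * (?o x * D)) < r" .
    moreover have "0 \<le> (LINT x|M. ?w x * (?o x * D))"
      by (rule integral_nonneg_AE) (use D weight_nonneg in simp)
    then have "0 \<le> e n * (LINT x|M. ?w x * (?o x * D))" using e_pos[of n] by simp
    ultimately show "norm (e n * (LINT x|M. ?w x * (?o x * D)) - 0) < r" by simp
  qed
qed

end

text \<open>The test functions T_k(v_n - \<phi>), their gradients Z n and their limit zl, for a test
function \<phi> that is bounded by B together with its partial derivatives.\<close>

locale shifted_truncation = regularised_sequence +
  fixes \<phi> :: "rvec \<Rightarrow> real" and k B :: real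
  assumes \<phi>: "Cc_smooth N \<Omega> \<phi>" and k: "k > 0"
    and B: "B > 0" "\<forall>x\<in>topspace (RN N). \<bar>\<phi> x\<bar> \<le> B \<and> (\<forall>i<N. \<bar>pd i \<phi> x\<bar> \<le> B)"
begin

definition d :: "rvec \<Rightarrow> rvec" where
  "d x i = pd i \<phi> x"

definition z :: "nat \<Rightarrow> rvec \<Rightarrow> real" where
  "z n x = Trunc k (v n x - \<phi> x)"

definition Z :: "nat \<Rightarrow> rvec \<Rightarrow> rvec" where
  "Z n x i = of_bool (\<bar>v n x - \<phi> x\<bar> < k) * (g n x i - d x i)"

definition zl :: "rvec \<Rightarrow> real" where
  "zl x = Trunc k (u x - \<phi> x)"

text \<open>Where the truncation is inactive, \<bar>v_n\<bar> is below this constant, so the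
estimates for T_m(v_n) apply there.\<close>

definition m :: real where
  "m = k + B"

definition D :: real where
  "D = real N * (B * B)"

definition s :: "nat \<Rightarrow> real" where
  "s n = e n * (LINT x|M. weight n x * (of_bool (\<bar>v n x\<bar> < m) * (D / 4)))"

lemma m: "m > 0"
  using k B(1) by (simp add: m_def)

lemma D: "D \<ge> 0"
  by (simp add: D_def)

lemma phi_meas: "\<phi> \<in> borel_measurable M"
  by (rule borel_M_of_continuous[OF Cc_smooth_test(1)[OF \<phi>]])

lemma d_L2: "L2field d"
  unfolding L2field_def d_def using Cc_smooth_Lp(2)[OF \<phi>, of 2] by simp

lemma d_bound:
  assumes "x \<in> \<Omega>" shows "dotN N (d x) (d x) \<le> D"
proof -
  have "\<bar>d x i\<bar> \<le> B" if "i < N" for i using B(2) assms \<Omega>_subset that by (auto simp: d_def)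
  then have "d x i * d x i \<le> B * B" if "i < N" for i
    using that abs_mult_self_eq[of "d x i"] mult_mono[of "\<bar>d x i\<bar>" B "\<bar>d x i\<bar>" B] B(1) by simp
  then have "(\<Sum>i<N. d x i * d x i) \<le> real (card {..<N}) * (B * B)"
    by (intro sum_bounded_above) simp
  then show ?thesis by (simp add: dotN_def D_def)
qed

lemma inactive_level:
  assumes "x \<in> \<Omega>" "\<bar>v n x - \<phi> x\<bar> < k" shows "\<bar>v n x\<bar> < m"
proof -
  have "\<bar>\<phi> x\<bar> \<le> B" using B(2) assms(1) \<Omega>_subset by auto
  then show ?thesis using assms(2) unfolding m_def by linarith
qed

lemma z_W10g: "W10g p (z n) (Z n)"
  unfolding z_def[abs_def] Z_def[abs_def] d_def
  by (rule W10g_Trunc[OF W10g_diff_Cc_smooth[OF v \<phi> p_ge(3)] p_ge(1) k])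

lemma z_W10g_2: "W10g 2 (z n) (Z n)"
  by (rule W10g_mono_exponent[OF z_W10g]) (use p in simp_all)

lemma g_L2: "L2field (g n)"
  by (rule W10g_L2field[OF W10g_mono_exponent[OF v]]) (use p in simp_all)

lemma Z_L2: "L2field (Z n)"
  by (rule W10g_L2field[OF z_W10g_2])

lemma truncated_g_L2: "L2field (\<lambda>x i. of_bool (\<bar>v n x\<bar> < m) * g n x i)"
  by (rule W10g_L2field[OF W10g_mono_exponent[OF W10g_Trunc[OF v p_ge(1) m]]]) (use p in simp_all)

text \<open>On the set where Z n does not vanish, the gradient of v_n is the one of its truncation
at level m.\<close>

lemma Z_energy: "energy (Z n) \<le> 2 * (m * (LINT x|M. \<bar>f x\<bar>) / lo) + 2 * energy d"
proof -
  let ?h = "\<lambda>n x i. of_bool (\<bar>v n x\<bar> < m) * g n x i"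
  have "energy (Z n) \<le> (LINT x|M. 2 * dotN N (?h n x) (?h n x) + 2 * dotN N (d x) (d x))"
    unfolding energy_def
  proof (rule integral_mono)
    show "integrable M (\<lambda>x. dotN N (Z n x) (Z n x))" by (rule dotN_integrable[OF Z_L2 Z_L2])
    show "integrable M (\<lambda>x. 2 * dotN N (?h n x) (?h n x) + 2 * dotN N (d x) (d x))"
      using dotN_integrable[OF truncated_g_L2 truncated_g_L2, of n n] dotN_integrable[OF d_L2 d_L2] by simp
    fix x assume "x \<in> space M"
    then have x: "x \<in> \<Omega>" by simp
    let ?a = "of_bool (\<bar>v n x - \<phi> x\<bar> < k) :: real" and ?b = "of_bool (\<bar>v n x\<bar> < m) :: real"
    have "dotN N (Z n x) (Z n x) = ?a * dotN N (\<lambda>i. g n x i - d x i) (\<lambda>i. g n x i - d x i)"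
      unfolding Z_def dotN_mult_left dotN_mult_right by simp
    also have "\<dots> \<le> ?a * (2 * dotN N (g n x) (g n x) + 2 * dotN N (d x) (d x))"
      by (intro mult_left_mono dotN_diff_self_le) simp
    also have "\<dots> \<le> 2 * (?b * dotN N (g n x) (g n x)) + 2 * dotN N (d x) (d x)"
    proof (cases "\<bar>v n x - \<phi> x\<bar> < k")
      case True
      then show ?thesis using inactive_level[OF x, of n] by simp
    next
      case False
      then show ?thesis using dotN_nonneg[of N "g n x"] dotN_nonneg[of N "d x"] by simp
    qed
    also have "?b * dotN N (g n x) (g n x) = dotN N (?h n x) (?h n x)"
      unfolding dotN_mult_left dotN_mult_right by simp
    finally show "dotN N (Z n x) (Z n x) \<le> 2 * dotN N (?h n x) (?h n x) + 2 * dotN N (d x) (d x)" .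
  qed
  also have "\<dots> = 2 * energy (?h n) + 2 * energy d"
    unfolding energy_def using dotN_integrable[OF truncated_g_L2 truncated_g_L2, of n n] dotN_integrable[OF d_L2 d_L2] by simp
  finally show ?thesis using trunc_energy[OF m, of n] by simp
qed

lemma z_bound: "\<bar>z n x\<bar> \<le> k"
  unfolding z_def by (rule abs_Trunc_le(2)[OF k])

lemma z_limit: "AE x in M. (\<lambda>n. z n x) \<longlonglongrightarrow> zl x"
  using lim
proof eventually_elim
  case (elim x)
  have "isCont (Trunc k) (u x - \<phi> x)" using continuous_Trunc[OF k] by (simp add: continuous_on_eq_continuous_at)
  moreover have "(\<lambda>n. v n x - \<phi> x) \<longlonglongrightarrow> u x - \<phi> x" by (intro tendsto_diff elim tendsto_const)
  ultimately show ?case unfolding z_def zl_def by (rule isCont_tendsto_compose)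
qed

lemma zl_meas: "zl \<in> borel_measurable M"
  unfolding zl_def[abs_def]
  by (rule borel_compose_continuous[OF continuous_Trunc[OF k] borel_measurable_diff[OF u_meas phi_meas]])

lemma s_null: "s \<longlonglongrightarrow> 0"
  unfolding s_def[abs_def] by (rule perturbation_null[OF m]) (use D in simp)

text \<open>The quadratic function a(a - d) of a is at least -d squared over 4. This absorbs the
mixed term, so only a bounded factor remains in the integral against the weight.\<close>

lemma perturbation_lower_bound:
  "- s n \<le> e n * (LINT x|M. weight n x * dotN N (g n x) (Z n x))"
proof -
  have om: "(\<lambda>x. of_bool (\<bar>v n x\<bar> < m) :: real) \<in> borel_measurable M" by (rule indicator_level_meas)
  have i1: "integrable M (\<lambda>x. weight n x * (of_bool (\<bar>v n x\<bar> < m) * (D / 4)))"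
  proof (rule weighted_integrable[OF _ normN_g_Lp normN_nonneg order_refl])
    show "(\<lambda>x. of_bool (\<bar>v n x\<bar> < m) * (D / 4)) \<in> borel_measurable M"
      by (intro borel_measurable_times om borel_measurable_const)
    show "\<bar>of_bool (\<bar>v n x\<bar> < m) * (D / 4)\<bar> \<le> (D + 1) * (1 + (normN N (g n x))\<^sup>2)" for x
    proof -
      have "\<bar>of_bool (\<bar>v n x\<bar> < m) * (D / 4)\<bar> \<le> (D + 1) * 1" using D by simp
      also have "\<dots> \<le> (D + 1) * (1 + (normN N (g n x))\<^sup>2)" using D by (intro mult_left_mono) simp_all
      finally show ?thesis .
    qed
  qed
  have i2: "integrable M (\<lambda>x. weight n x * dotN N (g n x) (Z n x))"
  proof (rule weighted_integrable)
    have "Lp M p (\<lambda>x. normN N (Z n x))" by (rule normN_Lp[OF W10gD(3)[OF z_W10g] p_ge(3)])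
    then show "Lp M p (\<lambda>x. normN N (g n x) + normN N (Z n x))" by (rule Lp_add(1)[OF normN_g_Lp _ p_ge(3)])
    show "(\<lambda>x. dotN N (g n x) (Z n x)) \<in> borel_measurable M"
      by (intro dotN_measurable g_meas Lp_measurable[OF W10gD(3)[OF z_W10g]])
    fix x
    have a: "0 \<le> normN N (g n x)" "0 \<le> normN N (Z n x)" by (rule normN_nonneg)+
    then show "0 \<le> normN N (g n x) + normN N (Z n x)" "normN N (g n x) \<le> normN N (g n x) + normN N (Z n x)" by simp_all
    have "\<bar>dotN N (g n x) (Z n x)\<bar> \<le> (1/2) * dotN N (g n x) (g n x) + (1/2) * dotN N (Z n x) (Z n x)"
    proof -
      have "dotN N (g n x) (\<lambda>i. (-1) * Z n x i) \<le> (1/2) * dotN N (g n x) (g n x)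
          + (1/2) * dotN N (\<lambda>i. (-1) * Z n x i) (\<lambda>i. (-1) * Z n x i)" by (rule dotN_le_half)
      then have "- dotN N (g n x) (Z n x) \<le> (1/2) * dotN N (g n x) (g n x) + (1/2) * dotN N (Z n x) (Z n x)"
        unfolding dotN_mult_left dotN_mult_right by simp
      then show ?thesis using dotN_le_half[of N "g n x" "Z n x"] by linarith
    qed
    also have "\<dots> \<le> 1 * (1 + (normN N (g n x) + normN N (Z n x))\<^sup>2)"
    proof -
      have "0 \<le> normN N (g n x) * normN N (Z n x)" using a by simp
      moreover have "0 \<le> (normN N (g n x))\<^sup>2" "0 \<le> (normN N (Z n x))\<^sup>2" by simp_all
      moreover have "(1/2) * A + (1/2) * C \<le> 1 * (1 + (A + C + 2 * P))"
        if "0 \<le> P" "0 \<le> A" "0 \<le> C" for A C P :: real using that by simp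
      ultimately show ?thesis unfolding dotN_self power2_sum mult.assoc by blast
    qed
    finally show "\<bar>dotN N (g n x) (Z n x)\<bar> \<le> 1 * (1 + (normN N (g n x) + normN N (Z n x))\<^sup>2)" .
  qed
  have "(LINT x|M. - (weight n x * (of_bool (\<bar>v n x\<bar> < m) * (D / 4)))) \<le> (LINT x|M. weight n x * dotN N (g n x) (Z n x))"
  proof (rule integral_mono[OF Bochner_Integration.integrable_minus[OF i1] i2])
    fix x assume "x \<in> space M"
    then have x: "x \<in> \<Omega>" by simp
    have "- (of_bool (\<bar>v n x\<bar> < m) * (D / 4)) \<le> dotN N (g n x) (Z n x)"
    proof (cases "\<bar>v n x - \<phi> x\<bar> < k")
      case True
      then have "of_bool (\<bar>v n x\<bar> < m) = (1::real)" using inactive_level[OF x, of n] by simp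
      moreover have "dotN N (g n x) (Z n x) = dotN N (g n x) (\<lambda>i. g n x i - d x i)"
        unfolding Z_def dotN_mult_right using True by simp
      ultimately show ?thesis using dotN_diff_lower[of N "d x" "g n x"] d_bound[OF x] by simp
    next
      case False
      then have "dotN N (g n x) (Z n x) = 0" unfolding Z_def dotN_mult_right by simp
      then show ?thesis using D by simp
    qed
    then have "weight n x * - (of_bool (\<bar>v n x\<bar> < m) * (D / 4)) \<le> weight n x * dotN N (g n x) (Z n x)"
      by (rule mult_left_mono[OF _ weight_nonneg])
    then show "- (weight n x * (of_bool (\<bar>v n x\<bar> < m) * (D / 4))) \<le> weight n x * dotN N (g n x) (Z n x)" by simp
  qed
  then have "- (LINT x|M. weight n x * (of_bool (\<bar>v n x\<bar> < m) * (D / 4))) \<le> (LINT x|M. weight n x * dotN N (g n x) (Z n x))"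
    using integral_minus[of M "\<lambda>x. weight n x * (of_bool (\<bar>v n x\<bar> < m) * (D / 4))"] by linarith
  then have "e n * - (LINT x|M. weight n x * (of_bool (\<bar>v n x\<bar> < m) * (D / 4))) \<le> e n * (LINT x|M. weight n x * dotN N (g n x) (Z n x))"
    using e_pos[of n] by (intro mult_left_mono) simp_all
  then show ?thesis unfolding s_def by simp
qed

lemma source_limit: "(\<lambda>n. LINT x|M. f x * z n x) \<longlonglongrightarrow> (LINT x|M. f x * zl x)"
proof (rule integral_dominated_convergence[where w = "\<lambda>x. k * \<bar>f x\<bar>"])
  show "(\<lambda>x. f x * zl x) \<in> borel_measurable M" by (rule borel_measurable_times[OF borel_measurable_integrable[OF f] zl_meas])
  show "(\<lambda>x. f x * z n x) \<in> borel_measurable M" for n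
    by (rule borel_measurable_times[OF borel_measurable_integrable[OF f] Lp_measurable[OF W10gD(1)[OF z_W10g]]])
  show "integrable M (\<lambda>x. k * \<bar>f x\<bar>)" using f by simp
  show "AE x in M. (\<lambda>n. f x * z n x) \<longlonglongrightarrow> f x * zl x"
    using z_limit by eventually_elim (rule tendsto_mult_left)
  show "AE x in M. norm (f x * z n x) \<le> k * \<bar>f x\<bar>" for n
  proof (rule AE_I2)
    fix x
    have "\<bar>z n x\<bar> * \<bar>f x\<bar> \<le> k * \<bar>f x\<bar>" by (rule mult_right_mono[OF z_bound]) simp
    then show "norm (f x * z n x) \<le> k * \<bar>f x\<bar>" by (simp add: abs_mult mult.commute)
  qed
qed

text \<open>Writing v_n = (v_n - \<phi>) + \<phi> leaves the quadratic form in Z n and a term that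
is linear in Z n. The quadratic form is replaced by its tangent at the field Zl, which will be the
limit of the sequence, so that the estimate passes to the weak limit. Symmetry of the matrix makes
the two mixed terms of the tangent equal.\<close>

lemma tangent_estimate:
  assumes ZlL: "L2field Zl"
    and b_dot: "\<And>x w. dotN N (b x) w = 2 * dotN N (matvecN N (\<Lambda> x) (Zl x)) w + dotN N (matvecN N (\<Lambda> x) (d x)) w"
    and bL: "L2field b"
  shows "(LINT x|M. dotN N (b x) (Z n x)) \<le>
    (LINT x|M. f x * z n x) + s n + (LINT x|M. dotN N (matvecN N (\<Lambda> x) (Zl x)) (Zl x))"
proof -
  have AZl: "L2field (\<lambda>x. matvecN N (\<Lambda> x) (Zl x))" by (rule matvecN_L2field[OF ZlL])
  have Ag: "L2field (\<lambda>x. matvecN N (\<Lambda> x) (g n x))" by (rule matvecN_L2field[OF g_L2])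
  have eq: "(LINT x|M. dotN N (matvecN N (\<Lambda> x) (g n x)) (Z n x)) +
     e n * (LINT x|M. weight n x * dotN N (g n x) (Z n x)) = (LINT x|M. f x * z n x)"
    unfolding weight_def by (rule regularised_equation[OF reg v z_W10g p_ge(1)])
  have "(LINT x|M. dotN N (b x) (Z n x)) \<le>
      (LINT x|M. dotN N (matvecN N (\<Lambda> x) (g n x)) (Z n x) + dotN N (matvecN N (\<Lambda> x) (Zl x)) (Zl x))"
  proof (rule integral_mono_AE)
    show "integrable M (\<lambda>x. dotN N (b x) (Z n x))" by (rule dotN_integrable[OF bL Z_L2])
    show "integrable M (\<lambda>x. dotN N (matvecN N (\<Lambda> x) (g n x)) (Z n x) + dotN N (matvecN N (\<Lambda> x) (Zl x)) (Zl x))"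
      using dotN_integrable[OF Ag Z_L2] dotN_integrable[OF AZl ZlL] by (intro Bochner_Integration.integrable_add)
    show "AE x in M. dotN N (b x) (Z n x) \<le>
        dotN N (matvecN N (\<Lambda> x) (g n x)) (Z n x) + dotN N (matvecN N (\<Lambda> x) (Zl x)) (Zl x)"
      using \<Lambda>_coercive \<Lambda>_symmetric
    proof eventually_elim
      case (elim x)
      have pos: "\<forall>\<xi>. 0 \<le> dotN N (matvecN N (\<Lambda> x) \<xi>) \<xi>"
      proof
        fix \<xi>
        have "0 \<le> lo * dotN N \<xi> \<xi>" using lo_pos dotN_nonneg[of N \<xi>] by simp
        then show "0 \<le> dotN N (matvecN N (\<Lambda> x) \<xi>) \<xi>" using elim(1) order_trans by blast
      qed
      have "dotN N (matvecN N (\<Lambda> x) (g n x)) (Z n x) =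
          dotN N (matvecN N (\<Lambda> x) (Z n x)) (Z n x) + dotN N (matvecN N (\<Lambda> x) (d x)) (Z n x)"
        unfolding Z_def[abs_def] by (rule matvecN_split) simp
      then show ?case
        using quadratic_form_linearisation[OF pos elim(2), of "Zl x" "Z n x"] unfolding b_dot by linarith
    qed
  qed
  also have "\<dots> = (LINT x|M. dotN N (matvecN N (\<Lambda> x) (g n x)) (Z n x)) + (LINT x|M. dotN N (matvecN N (\<Lambda> x) (Zl x)) (Zl x))"
    using dotN_integrable[OF Ag Z_L2] dotN_integrable[OF AZl ZlL] by (rule Bochner_Integration.integral_add)
  finally have 1: "(LINT x|M. dotN N (b x) (Z n x)) \<le> (LINT x|M. dotN N (matvecN N (\<Lambda> x) (g n x)) (Z n x)) + (LINT x|M. dotN N (matvecN N (\<Lambda> x) (Zl x)) (Zl x))" .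
  then show ?thesis using perturbation_lower_bound[of n] eq by linarith
qed

text \<open>At the weak limit the tangent touches the quadratic form, so no loss remains.\<close>

lemma entropy_inequality:
  assumes uq: "W10g q u gu" "q \<ge> 1"
  shows "(LINT x|M. dotN N (matvecN N (\<Lambda> x) (weak_grad N \<Omega> u x)) (weak_grad N \<Omega> zl x)) \<le> (LINT x|M. f x * zl x)"
proof -
  obtain Zl where Zl: "W10g 2 zl Zl" and pair:
    "\<And>b c c0. L2field b \<Longrightarrow> (\<And>n. (LINT x|M. dotN N (b x) (Z n x)) \<le> c n) \<Longrightarrow> c \<longlonglongrightarrow> c0 \<Longrightarrow>
       (LINT x|M. dotN N (b x) (Zl x)) \<le> c0"
  proof (rule weak_closure[of z Z "2 * (m * (LINT x|M. \<bar>f x\<bar>) / lo) + 2 * energy d" k zl, OF z_W10g_2 Z_energy z_bound z_limit zl_meas], goal_cases)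
    case (1 G)
    show ?case by (rule 1(1)[OF 1(2,4)])
  qed
  have ZlL: "L2field Zl" by (rule W10g_L2field[OF Zl])
  have AZl: "L2field (\<lambda>x. matvecN N (\<Lambda> x) (Zl x))" by (rule matvecN_L2field[OF ZlL])
  have Ad: "L2field (\<lambda>x. matvecN N (\<Lambda> x) (d x))" by (rule matvecN_L2field[OF d_L2])
  define Q where "Q = (LINT x|M. dotN N (matvecN N (\<Lambda> x) (Zl x)) (Zl x))"
  \<comment> \<open>The tangent of the quadratic form at the limiting gradient, together with the linear term.\<close>
  define b where "b x i = 2 * matvecN N (\<Lambda> x) (Zl x) i + 1 * matvecN N (\<Lambda> x) (d x) i" for x i
  have bL: "L2field b" unfolding b_def[abs_def] by (rule L2field_lincomb[OF AZl Ad])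
  have b_dot: "dotN N (b x) w = 2 * dotN N (matvecN N (\<Lambda> x) (Zl x)) w + dotN N (matvecN N (\<Lambda> x) (d x)) w" for x w
    using dotN_lin_right[of N w 2 "matvecN N (\<Lambda> x) (Zl x)" 1 "matvecN N (\<Lambda> x) (d x)"]
    unfolding b_def by (simp add: dotN_commute[of N _ w])
  have "(\<lambda>n. (LINT x|M. f x * z n x) + s n + Q) \<longlonglongrightarrow> (LINT x|M. f x * zl x) + 0 + Q"
    by (intro tendsto_add source_limit s_null tendsto_const)
  from pair[OF bL tangent_estimate[OF ZlL b_dot bL, folded Q_def] this]
  have "(LINT x|M. dotN N (b x) (Zl x)) \<le> (LINT x|M. f x * zl x) + Q" by simp
  moreover have "(LINT x|M. dotN N (b x) (Zl x)) = 2 * Q + (LINT x|M. dotN N (matvecN N (\<Lambda> x) (d x)) (Zl x))"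
    unfolding b_dot Q_def using dotN_integrable[OF AZl ZlL] dotN_integrable[OF Ad ZlL] by simp
  ultimately have main: "Q + (LINT x|M. dotN N (matvecN N (\<Lambda> x) (d x)) (Zl x)) \<le> (LINT x|M. f x * zl x)" by linarith
  have q0: "q > 0" using uq(2) by simp
  have Wq: "W10g q zl (\<lambda>x i. of_bool (\<bar>u x - \<phi> x\<bar> < k) * (gu x i - d x i))"
    unfolding zl_def[abs_def] d_def by (rule W10g_Trunc[OF W10g_diff_Cc_smooth[OF uq(1) \<phi> q0] uq(2) k])
  \<comment> \<open>The limit of the gradients is the gradient of T_k(u - \<phi>) computed from the weak
    gradient of u, which lies in a larger Sobolev space.\<close>
  have e1: "AE x in M. \<forall>i<N. Zl x i = of_bool (\<bar>u x - \<phi> x\<bar> < k) * (gu x i - d x i)"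
    by (rule weak_grad_unique[OF W10gD(2)[OF Zl] W10gD(2)[OF Wq]]) simp
  note Hu = W10gD(2)[OF uq(1)] and Hz = W10gD(2)[OF Zl]
  have "(LINT x|M. dotN N (matvecN N (\<Lambda> x) (weak_grad N \<Omega> u x)) (weak_grad N \<Omega> zl x)) =
     (LINT x|M. dotN N (matvecN N (\<Lambda> x) (Zl x)) (Zl x) + dotN N (matvecN N (\<Lambda> x) (d x)) (Zl x))"
  proof (rule integral_cong_AE)
    show "(\<lambda>x. dotN N (matvecN N (\<Lambda> x) (weak_grad N \<Omega> u x)) (weak_grad N \<Omega> zl x)) \<in> borel_measurable M"
      by (intro dotN_measurable matvecN_measurable has_weak_grad_measurable(2)[OF has_weak_grad_weak_grad[OF Hu]]
        has_weak_grad_measurable(2)[OF has_weak_grad_weak_grad[OF Hz]])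
    show "(\<lambda>x. dotN N (matvecN N (\<Lambda> x) (Zl x)) (Zl x) + dotN N (matvecN N (\<Lambda> x) (d x)) (Zl x)) \<in> borel_measurable M"
      using dotN_integrable[OF AZl ZlL] dotN_integrable[OF Ad ZlL]
      by (intro borel_measurable_add borel_measurable_integrable)
    show "AE x in M. dotN N (matvecN N (\<Lambda> x) (weak_grad N \<Omega> u x)) (weak_grad N \<Omega> zl x) =
      dotN N (matvecN N (\<Lambda> x) (Zl x)) (Zl x) + dotN N (matvecN N (\<Lambda> x) (d x)) (Zl x)"
      using weak_grad_eq[OF Hu] weak_grad_eq[OF Hz] e1
    proof eventually_elim
      case (elim x)
      let ?Y = "\<lambda>i. of_bool (\<bar>u x - \<phi> x\<bar> < k) * (gu x i - d x i)"
      have "dotN N (matvecN N (\<Lambda> x) (weak_grad N \<Omega> u x)) (weak_grad N \<Omega> zl x) = dotN N (matvecN N (\<Lambda> x) (gu x)) ?Y"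
        by (intro dotN_cong matvecN_cong) (use elim in simp_all)
      also have "\<dots> = dotN N (matvecN N (\<Lambda> x) ?Y) ?Y + dotN N (matvecN N (\<Lambda> x) (d x)) ?Y"
        by (rule matvecN_split) simp
      also have "dotN N (matvecN N (\<Lambda> x) ?Y) ?Y = dotN N (matvecN N (\<Lambda> x) (Zl x)) (Zl x)"
        by (intro dotN_cong matvecN_cong) (use elim in simp_all)
      also have "dotN N (matvecN N (\<Lambda> x) (d x)) ?Y = dotN N (matvecN N (\<Lambda> x) (d x)) (Zl x)"
        by (intro dotN_cong) (use elim in simp_all)
      finally show ?case .
    qed
  qed
  also have "\<dots> = Q + (LINT x|M. dotN N (matvecN N (\<Lambda> x) (d x)) (Zl x))"
    unfolding Q_def using dotN_integrable[OF AZl ZlL] dotN_integrable[OF Ad ZlL] by (rule Bochner_Integration.integral_add)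
  also have "\<dots> \<le> (LINT x|M. f x * zl x)" by (rule main)
  finally show ?thesis .
qed

end

context regularised_sequence
begin

theorem limit_entropy_inequality:
  assumes \<phi>: "Cc_smooth N \<Omega> \<phi>" and k: "k > 0" and uq: "W10g q u gu" "q \<ge> 1"
  shows "(LINT x|M. dotN N (matvecN N (\<Lambda> x) (weak_grad N \<Omega> u x))
             (weak_grad N \<Omega> (\<lambda>y. Trunc k (u y - \<phi> y)) x)) \<le> (LINT x|M. f x * Trunc k (u x - \<phi> x))"
proof -
  obtain B where B: "B > 0" "\<forall>x\<in>topspace (RN N). \<bar>\<phi> x\<bar> \<le> B \<and> (\<forall>i<N. \<bar>pd i \<phi> x\<bar> \<le> B)"
    using Cc_smooth_bounded[OF \<phi>] by blast
  interpret S: shifted_truncation N \<Omega> lo hi \<Lambda> p f u e v g \<phi> k B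
    by unfold_locales (rule \<phi> k B)+
  show ?thesis using S.entropy_inequality[OF uq] unfolding S.zl_def[abs_def] .
qed

text \<open>The energy estimate for the truncated approximations does not depend on n and survives
the weak limit.\<close>

lemma limit_truncation_bound:
  assumes k: "k > 0"
  shows "H10 N \<Omega> (\<lambda>x. Trunc k (u x))"
    and "Lp M 2 (\<lambda>x. normN N (weak_grad N \<Omega> (\<lambda>y. Trunc k (u y)) x))"
    and "Lp_norm M 2 (\<lambda>x. normN N (weak_grad N \<Omega> (\<lambda>y. Trunc k (u y)) x)) \<le> sqrt (k * Lp_norm M 1 f / lo)"
proof -
  obtain G where G: "W10g 2 (\<lambda>x. Trunc k (u x)) G" "energy G \<le> k * (LINT x|M. \<bar>f x\<bar>) / lo"
    by (rule limit_truncation[OF k])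
  show "H10 N \<Omega> (\<lambda>x. Trunc k (u x))" by (rule W10g_imp_W10[OF G(1)]) simp
  let ?w = "weak_grad N \<Omega> (\<lambda>y. Trunc k (u y))"
  note H = W10gD(2)[OF G(1)]
  have mw: "(\<lambda>x. normN N (?w x)) \<in> borel_measurable M"
    by (intro normN_measurable has_weak_grad_measurable(2)[OF has_weak_grad_weak_grad[OF H]])
  have LG: "Lp M 2 (\<lambda>x. normN N (G x))" by (rule normN_Lp[OF W10gD(3)[OF G(1)]]) simp_all
  have ae: "AE x in M. normN N (?w x) = normN N (G x)"
    using weak_grad_eq[OF H]
  proof eventually_elim
    case (elim x)
    show ?case by (rule normN_cong) (use elim in simp)
  qed
  have ae': "AE x in M. \<bar>normN N (?w x)\<bar> \<le> \<bar>normN N (G x)\<bar>" using ae by eventually_elim simp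
  show "Lp M 2 (\<lambda>x. normN N (?w x))" by (rule Lp_bound(1)[OF LG mw ae']) simp
  have "(LINT x|M. \<bar>normN N (?w x)\<bar> powr 2) \<le> (LINT x|M. \<bar>normN N (G x)\<bar> powr 2)"
    by (rule Lp_bound(2)[OF LG mw ae']) simp
  also have "\<dots> = energy G" unfolding energy_def dotN_self by simp
  also have "\<dots> \<le> k * (LINT x|M. \<bar>f x\<bar>) / lo" by (rule G(2))
  finally have le: "(LINT x|M. \<bar>normN N (?w x)\<bar> powr 2) \<le> k * (LINT x|M. \<bar>f x\<bar>) / lo" .
  have n1: "Lp_norm M 1 f = (LINT x|M. \<bar>f x\<bar>)" unfolding Lp_norm_def by simp
  have "Lp_norm M 2 (\<lambda>x. normN N (?w x)) = sqrt (LINT x|M. \<bar>normN N (?w x)\<bar> powr 2)"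
    unfolding Lp_norm_def by (rule powr_half_sqrt) (rule powr_integral_nonneg)
  also have "\<dots> \<le> sqrt (k * Lp_norm M 1 f / lo)" unfolding n1 by (rule real_sqrt_le_mono[OF le])
  finally show "Lp_norm M 2 (\<lambda>x. normN N (?w x)) \<le> sqrt (k * Lp_norm M 1 f / lo)" .
qed

end

text \<open>The weak gradient of u comes from an exponent between 1 and N/(N-1); the midpoint of
this interval will do.\<close>

lemma regularised_limit_is_entropy_solution:
  assumes N: "2 \<le> N" and O: "open_bounded N \<Omega>" and p: "real N < p" and L: "elliptic_coeff N \<Omega> lo hi \<Lambda>"
    and f: "Lp (leb_on N \<Omega>) 1 f" and e: "\<And>n. 0 < e n" "e \<longlonglongrightarrow> 0"
    and reg: "\<And>n. regularised_solution N \<Omega> p \<Lambda> f (e n) (v n)"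
    and u: "SN N \<Omega> u" and lim: "AE x in leb_on N \<Omega>. (\<lambda>n. v n x) \<longlonglongrightarrow> u x"
  shows "k > 0 \<Longrightarrow> Lp (leb_on N \<Omega>) 2 (\<lambda>x. normN N (weak_grad N \<Omega> (\<lambda>y. Trunc k (u y)) x))"
    and "k > 0 \<Longrightarrow> Lp_norm (leb_on N \<Omega>) 2 (\<lambda>x. normN N (weak_grad N \<Omega> (\<lambda>y. Trunc k (u y)) x))
           \<le> sqrt (k * Lp_norm (leb_on N \<Omega>) 1 f / lo)"
    and "entropy_solution N \<Omega> \<Lambda> f u"
proof -
  interpret E: elliptic_domain N \<Omega> lo hi \<Lambda> by unfold_locales (rule O, rule L)
  have p2: "p > 2" using N p by linarith
  have "\<exists>g. E.W10g p (v n) g" for n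
  proof (rule E.W10_imp_W10g)
    show "W10 N \<Omega> p (v n)" using reg[of n] by (simp add: regularised_solution_def)
  qed (use p2 in simp)
  then have "\<exists>g. \<forall>n. E.W10g p (v n) (g n)" by (intro choice allI)
  then obtain g where "\<forall>n. E.W10g p (v n) (g n)" by (elim exE) (rule that)
  then have g: "E.W10g p (v n) (g n)" for n by simp
  define q where "q = (1 + real N / (real N - 1)) / 2"
  have "real N - 1 > 0" using N by simp
  then have "real N / (real N - 1) > 1" by simp
  moreover have "1 < (1 + r) / 2 \<and> (1 + r) / 2 < r" if "r > 1" for r :: real using that by simp
  ultimately have q: "1 < q" "q < real N / (real N - 1)" unfolding q_def by blast+
  then have "W10 N \<Omega> q u" using u unfolding SN_def by simp
  then obtain gu where gu: "E.W10g q u gu" using E.W10_imp_W10g[of q u] q(1) by (auto simp: less_imp_le)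
  have mu: "u \<in> borel_measurable (leb_on N \<Omega>)" by (rule Lp_measurable[OF E.W10gD(1)[OF gu]])
  have fi: "integrable (leb_on N \<Omega>) f" by (rule E.Lp_imp_integrable[OF f]) simp
  interpret R: regularised_sequence N \<Omega> lo hi \<Lambda> p f u e v g
    by unfold_locales (rule p2 fi e reg g lim mu)+
  show "k > 0 \<Longrightarrow> Lp (leb_on N \<Omega>) 2 (\<lambda>x. normN N (weak_grad N \<Omega> (\<lambda>y. Trunc k (u y)) x))"
    by (rule R.limit_truncation_bound(2))
  show "k > 0 \<Longrightarrow> Lp_norm (leb_on N \<Omega>) 2 (\<lambda>x. normN N (weak_grad N \<Omega> (\<lambda>y. Trunc k (u y)) x))
           \<le> sqrt (k * Lp_norm (leb_on N \<Omega>) 1 f / lo)"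
    by (rule R.limit_truncation_bound(3))
  show "entropy_solution N \<Omega> \<Lambda> f u"
    unfolding entropy_solution_def
    by (intro conjI allI impI mu u R.limit_truncation_bound(1) R.limit_entropy_inequality[OF _ _ gu])
      (use q in simp_all)
qed

theorem lemma4p5:
  shows "\<exists>C :: real \<Rightarrow> real \<Rightarrow> real \<Rightarrow> real.
    \<forall>(N :: nat) \<Omega> (p :: real) (lo :: real) (hi :: real) \<Lambda> f
      (\<epsilon> :: nat \<Rightarrow> real) (v :: nat \<Rightarrow> rvec \<Rightarrow> real) (\<sigma> :: nat \<Rightarrow> nat) u.
      2 \<le> N \<longrightarrow> open_bounded N \<Omega> \<longrightarrow> real N < p \<longrightarrow>
      elliptic_coeff N \<Omega> lo hi \<Lambda> \<longrightarrow>
      Lp (leb_on N \<Omega>) 1 f \<longrightarrow>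
      (\<forall>n. 0 < \<epsilon> n) \<longrightarrow> \<epsilon> \<longlonglongrightarrow> 0 \<longrightarrow>
      (\<forall>n. regularised_solution N \<Omega> p \<Lambda> f (\<epsilon> n) (v n)) \<longrightarrow>
      SN N \<Omega> u \<longrightarrow>
      strict_mono \<sigma> \<longrightarrow> approx_converges N \<Omega> (\<lambda>n. v (\<sigma> n)) u \<longrightarrow>
      (\<forall>k>0.
         Lp (leb_on N \<Omega>) 2 (\<lambda>x. normN N (weak_grad N \<Omega> (\<lambda>y. Trunc k (u y)) x)) \<and>
         Lp_norm (leb_on N \<Omega>) 2 (\<lambda>x. normN N (weak_grad N \<Omega> (\<lambda>y. Trunc k (u y)) x))
           \<le> C lo k (Lp_norm (leb_on N \<Omega>) 1 f)) \<and>
      entropy_solution N \<Omega> \<Lambda> f u"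
proof (intro exI[of _ "\<lambda>lo k F. sqrt (k * F / lo)"] allI impI)
  fix N :: nat and \<Omega> and p lo hi :: real and \<Lambda> f and \<epsilon> :: "nat \<Rightarrow> real" and v :: "nat \<Rightarrow> rvec \<Rightarrow> real"
    and \<sigma> :: "nat \<Rightarrow> nat" and u
  assume A: "2 \<le> N" "open_bounded N \<Omega>" "real N < p" "elliptic_coeff N \<Omega> lo hi \<Lambda>" "Lp (leb_on N \<Omega>) 1 f"
    and e: "\<forall>n. 0 < \<epsilon> n" "\<epsilon> \<longlonglongrightarrow> 0" and reg: "\<forall>n. regularised_solution N \<Omega> p \<Lambda> f (\<epsilon> n) (v n)"
    and u: "SN N \<Omega> u" and \<sigma>: "strict_mono \<sigma>" and c: "approx_converges N \<Omega> (\<lambda>n. v (\<sigma> n)) u"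
  have e': "0 < \<epsilon> (\<sigma> n)" for n using e(1) by simp
  have l': "(\<lambda>n. \<epsilon> (\<sigma> n)) \<longlonglongrightarrow> 0" using LIMSEQ_subseq_LIMSEQ[OF e(2) \<sigma>] by (simp add: comp_def)
  have r': "regularised_solution N \<Omega> p \<Lambda> f (\<epsilon> (\<sigma> n)) (v (\<sigma> n))" for n using reg by simp
  have ae: "AE x in leb_on N \<Omega>. (\<lambda>n. v (\<sigma> n) x) \<longlonglongrightarrow> u x" using c by (simp add: approx_converges_def)
  note main = regularised_limit_is_entropy_solution[OF A e' l' r' u ae]
  show "(\<forall>k>0.
         Lp (leb_on N \<Omega>) 2 (\<lambda>x. normN N (weak_grad N \<Omega> (\<lambda>y. Trunc k (u y)) x)) \<and>
         Lp_norm (leb_on N \<Omega>) 2 (\<lambda>x. normN N (weak_grad N \<Omega> (\<lambda>y. Trunc k (u y)) x))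
           \<le> sqrt (k * Lp_norm (leb_on N \<Omega>) 1 f / lo)) \<and>
      entropy_solution N \<Omega> \<Lambda> f u"
    by (intro conjI allI impI main)
qed

end
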